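(* Suppose that $(\Gamma,G)\in\mathcal{OG}(4)$ is basic of quasiprimitive type. Then $G$ has a unique minimal normal subgroup $N=T^k$ for some finite nonabelian simple group $T$, $k\leq 2$, and one of the following holds: (a) $k=1$, and there are many known examples; or (b) $k=2$, $G=N\cdot 2$, and $\Gamma$ is a Cayley graph for $N$ as in the Twisted Wreath Construction described in the context; or (c) $k=2$, $N$ is not regular (on the vertex set of $\Gamma$), and there are many known examples.
   Context: All graphs are finite, simple and undirected. $\mathcal{OG}(4)$ is the set of pairs $(\Gamma,G)$ where $\Gamma$ is a connected graph of valency $4$ with vertex set $X$, $G\leq\mathrm{Aut}(\Gamma)$ is transitive on $X$ and on edges, and $\Gamma$ is $G$-oriented: there is a $G$-orbit $\Delta\subset X\times X$, disjoint from $\Delta^*=\{(y,x)\mid (x,y)\in\Delta\}$, such that the edges of $\Gamma$ are exactly the pairs $\{x,y\}$ with $(x,y)\in\Delta$ or $(y,x)\in\Delta$. A pair $(\Gamma,G)\in\mathcal{OG}(4)$ is basic of quasiprimitive type if $G$ is quasiprimitive on $X$, that is, every nontrivial normal subgroup of $G$ is transitive on $X$. A permutation group is regular if it is transitive and only the identity fixes a point. $G=N\cdot 2$ means that $N$ is normal of index $2$ in $G$. "Examples" in (a) and (c) means pairs $(\Gamma,G)\in\mathcal{OG}(4)$ that are basic of quasiprimitive type and satisfy the conditions of that case. For a group $N$ and an inverse-closed subset $S\subseteq N\setminus\{1_N\}$, the Cayley graph $\mathrm{Cay}(N,S)$ has vertex set $N$ and edges the pairs $\{x,y\}$ with $xy^{-1}\in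 S$; $N$ acts on it by right multiplication as a group of automorphisms regular on vertices. Twisted Wreath Construction: let $T$ be a nonabelian simple group, and let $\{a,b\}$ be a generating set for $T$ such that no automorphism of $T$ interchanges $a$ and $b$. Let $N=T\times T$, $S_0=\{(a,b),(b,a)\}$, $S=S_0\cup S_0^{-1}$, and $\Gamma=\mathrm{Cay}(N,S)$. Let $\tau\in\mathrm{Aut}(N)$ be the map $\tau:(x,y)\mapsto(y,x)$, and let $G=N\rtimes\langle\tau\rangle$. (Here $N$ acts by right multiplication and $\tau$ acts naturally on the vertex set $N$.) *)

theory Defs
  imports
    "HOL-Algebra.Group_Action"
    "HOL-Algebra.SimpleGroups"
    "HOL-Algebra.Product_Groups"
    "HOL-Algebra.Generated_Groups"
    "Graph_Theory.Digraph_Component"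
begin

section \<open>Permutation groups\<close>

text \<open>
  A permutation group on \<open>X\<close> is given by the set of its elements, a subgroup of the symmetric
  group \<^term>\<open>BijGroup X\<close>, whose elements are the bijections of \<open>X\<close> that are extensional on \<open>X\<close>.
\<close>

definition perm_group :: "'a set \<Rightarrow> ('a \<Rightarrow> 'a) set \<Rightarrow> ('a \<Rightarrow> 'a) monoid" where
  "perm_group X G = (BijGroup X)\<lparr>carrier := G\<rparr>"

definition transitive_on :: "'a set \<Rightarrow> ('a \<Rightarrow> 'a) set \<Rightarrow> bool" where
  "transitive_on X G \<longleftrightarrow> transitive_action (perm_group X G) X (\<lambda>g. g)"

definition regular_on :: "'a set \<Rightarrow> ('a \<Rightarrow> 'a) set \<Rightarrow> bool" where
  "regular_on X G \<longleftrightarrow> transitive_on X G \<and> (\<forall>g\<in>G. \<forall>x\<in>X. g x = x \<longrightarrow> g = \<one>\<^bsub>BijGroup X\<^esub>)"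

definition quasiprimitive_on :: "'a set \<Rightarrow> ('a \<Rightarrow> 'a) set \<Rightarrow> bool" where
  "quasiprimitive_on X G \<longleftrightarrow>
     (\<forall>N. N \<lhd> perm_group X G \<and> N \<noteq> {\<one>\<^bsub>perm_group X G\<^esub>} \<longrightarrow> transitive_on X N)"

text \<open>The permutations of \<open>Y\<close> obtained from those in \<open>G\<close> by renaming points along \<open>f : X \<rightarrow> Y\<close>.\<close>

definition transport :: "'a set \<Rightarrow> 'b set \<Rightarrow> ('a \<Rightarrow> 'b) \<Rightarrow> ('a \<Rightarrow> 'a) set \<Rightarrow> ('b \<Rightarrow> 'b) set" where
  "transport X Y f G = (\<lambda>g. \<lambda>y\<in>Y. f (g (inv_into X f y))) ` G"


section \<open>Minimal normal subgroups\<close>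

definition minimal_normal :: "'a set \<Rightarrow> ('a, 'b) monoid_scheme \<Rightarrow> bool" where
  "minimal_normal N G \<longleftrightarrow> N \<lhd> G \<and> N \<noteq> {\<one>\<^bsub>G\<^esub>} \<and>
     (\<forall>M. M \<lhd> G \<and> M \<noteq> {\<one>\<^bsub>G\<^esub>} \<and> M \<subseteq> N \<longrightarrow> M = N)"

definition unique_minimal_normal :: "'a set \<Rightarrow> ('a, 'b) monoid_scheme \<Rightarrow> bool" where
  "unique_minimal_normal N G \<longleftrightarrow> minimal_normal N G \<and> (\<forall>M. minimal_normal M G \<longrightarrow> M = N)"

definition finite_nonabelian_simple :: "('a, 'b) monoid_scheme \<Rightarrow> bool" where
  "finite_nonabelian_simple T \<longleftrightarrow> simple_group T \<and> finite (carrier T) \<and> \<not> comm_group T"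

definition direct_power :: "('a, 'b) monoid_scheme \<Rightarrow> nat \<Rightarrow> (nat \<Rightarrow> 'a) monoid" where
  "direct_power T k = product_group {..<k} (\<lambda>_. T)"

text \<open>The permutation group \<open>G\<close> on \<open>X\<close> has a unique minimal normal subgroup, namely \<open>N\<close>, and
  \<open>N\<close> is isomorphic to \<open>T\<^sup>k\<close> with \<open>T\<close> finite nonabelian simple.\<close>

definition unique_minimal_normal_power ::
    "'a set \<Rightarrow> ('a \<Rightarrow> 'a) set \<Rightarrow> ('a \<Rightarrow> 'a) set \<Rightarrow> ('b, 'c) monoid_scheme \<Rightarrow> nat \<Rightarrow> bool" where
  "unique_minimal_normal_power X G N T k \<longleftrightarrow>
     unique_minimal_normal N (perm_group X G) \<and>
     finite_nonabelian_simple T \<and>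
     perm_group X N \<cong> direct_power T k"


section \<open>Oriented graphs of valency four\<close>

text \<open>
  Finite simple undirected graphs are the library's \<^const>\<open>pair_graph\<close>s, that is, finite loopless
  digraphs whose set of arcs (ordered pairs) is symmetric. The edge \<open>{x,y}\<close> is the pair of
  opposite arcs \<open>(x,y)\<close>, \<open>(y,x)\<close>, and the valency of a vertex is its out-degree.
\<close>

definition graph_aut :: "'a pair_pre_digraph \<Rightarrow> ('a \<Rightarrow> 'a) set" where
  "graph_aut \<Gamma> = {g \<in> Bij (pverts \<Gamma>).
     \<forall>x\<in>pverts \<Gamma>. \<forall>y\<in>pverts \<Gamma>. (g x, g y) \<in> parcs \<Gamma> \<longleftrightarrow> (x, y) \<in> parcs \<Gamma>}"

definition edge_transitive :: "'a pair_pre_digraph \<Rightarrow> ('a \<Rightarrow> 'a) set \<Rightarrow> bool" where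
  "edge_transitive \<Gamma> G \<longleftrightarrow>
     (\<forall>(x, y)\<in>parcs \<Gamma>. \<forall>(u, v)\<in>parcs \<Gamma>. \<exists>g\<in>G. {g x, g y} = {u, v})"

definition oriented_by :: "'a pair_pre_digraph \<Rightarrow> ('a \<Rightarrow> 'a) set \<Rightarrow> bool" where
  "oriented_by \<Gamma> G \<longleftrightarrow>
     (\<exists>x\<in>pverts \<Gamma>. \<exists>y\<in>pverts \<Gamma>. \<exists>\<Delta>.
        \<Delta> = orbit (perm_group (pverts \<Gamma>) G) (\<lambda>g. map_prod g g) (x, y) \<and>
        \<Delta> \<inter> \<Delta>\<inverse> = {} \<and> parcs \<Gamma> = \<Delta> \<union> \<Delta>\<inverse>)"

definition OG4 :: "('a pair_pre_digraph \<times> ('a \<Rightarrow> 'a) set) set" where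
  "OG4 = {(\<Gamma>, G).
     pair_graph \<Gamma> \<and> connected (with_proj \<Gamma>) \<and>
     (\<forall>x\<in>pverts \<Gamma>. out_degree (with_proj \<Gamma>) x = 4) \<and>
     subgroup G (BijGroup (pverts \<Gamma>)) \<and> G \<subseteq> graph_aut \<Gamma> \<and>
     transitive_on (pverts \<Gamma>) G \<and> edge_transitive \<Gamma> G \<and> oriented_by \<Gamma> G}"

definition basic_quasiprimitive :: "'a pair_pre_digraph \<Rightarrow> ('a \<Rightarrow> 'a) set \<Rightarrow> bool" where
  "basic_quasiprimitive \<Gamma> G \<longleftrightarrow> (\<Gamma>, G) \<in> OG4 \<and> quasiprimitive_on (pverts \<Gamma>) G"


section \<open>The Twisted Wreath Construction\<close>

definition cayley_graph :: "('a, 'b) monoid_scheme \<Rightarrow> 'a set \<Rightarrow> 'a pair_pre_digraph" where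
  "cayley_graph N S = \<lparr> pverts = carrier N,
     parcs = {(x, y). x \<in> carrier N \<and> y \<in> carrier N \<and> x \<otimes>\<^bsub>N\<^esub> inv\<^bsub>N\<^esub> y \<in> S} \<rparr>"

definition right_mults :: "('a, 'b) monoid_scheme \<Rightarrow> ('a \<Rightarrow> 'a) set" where
  "right_mults N = (\<lambda>n. \<lambda>x\<in>carrier N. x \<otimes>\<^bsub>N\<^esub> n) ` carrier N"

definition tw_generators :: "('a, 'b) monoid_scheme \<Rightarrow> 'a \<Rightarrow> 'a \<Rightarrow> bool" where
  "tw_generators T a b \<longleftrightarrow>
     a \<in> carrier T \<and> b \<in> carrier T \<and> generate T {a, b} = carrier T \<and>
     \<not> (\<exists>\<phi>\<in>iso T T. \<phi> a = b \<and> \<phi> b = a)"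

definition tw_connection_set :: "('a, 'b) monoid_scheme \<Rightarrow> 'a \<Rightarrow> 'a \<Rightarrow> ('a \<times> 'a) set" where
  "tw_connection_set T a b =
     (let S0 = {(a, b), (b, a)} in S0 \<union> (\<lambda>s. inv\<^bsub>T \<times>\<times> T\<^esub> s) ` S0)"

definition tw_graph :: "('a, 'b) monoid_scheme \<Rightarrow> 'a \<Rightarrow> 'a \<Rightarrow> ('a \<times> 'a) pair_pre_digraph" where
  "tw_graph T a b = cayley_graph (T \<times>\<times> T) (tw_connection_set T a b)"

text \<open>The semidirect product \<open>N \<rtimes> \<langle>\<tau>\<rangle>\<close> with \<open>N = T \<times> T\<close>, realised as the group of permutations of the
  set \<open>N\<close> generated by the right multiplications and the coordinate swap \<open>\<tau>\<close>.\<close>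

definition tw_group :: "('a, 'b) monoid_scheme \<Rightarrow> (('a \<times> 'a) \<Rightarrow> ('a \<times> 'a)) set" where
  "tw_group T = generate (BijGroup (carrier (T \<times>\<times> T)))
     (right_mults (T \<times>\<times> T) \<union> {\<lambda>p\<in>carrier (T \<times>\<times> T). prod.swap p})"

text \<open>
  \<open>\<Gamma>\<close> is a Cayley graph for \<open>N\<close> as in the construction over \<open>T\<close>: for suitable \<open>a\<close>, \<open>b\<close> there is a
  graph isomorphism onto the constructed graph under which \<open>N\<close> becomes \<open>T \<times> T\<close> acting by right
  multiplication and \<open>G\<close> becomes \<open>(T \<times> T) \<rtimes> \<langle>\<tau>\<rangle>\<close>.
\<close>

definition twisted_wreath ::
    "'a pair_pre_digraph \<Rightarrow> ('a \<Rightarrow> 'a) set \<Rightarrow> ('a \<Rightarrow> 'a) set \<Rightarrow> ('b, 'c) monoid_scheme \<Rightarrow> bool" where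
  "twisted_wreath \<Gamma> G N T \<longleftrightarrow>
     (\<exists>a b f. tw_generators T a b \<and>
        bij_betw f (pverts \<Gamma>) (carrier (T \<times>\<times> T)) \<and>
        (\<forall>x\<in>pverts \<Gamma>. \<forall>y\<in>pverts \<Gamma>.
           (x, y) \<in> parcs \<Gamma> \<longleftrightarrow> (f x, f y) \<in> parcs (tw_graph T a b)) \<and>
        transport (pverts \<Gamma>) (carrier (T \<times>\<times> T)) f N = right_mults (T \<times>\<times> T) \<and>
        transport (pverts \<Gamma>) (carrier (T \<times>\<times> T)) f G = tw_group T)"


section \<open>Examples\<close>

text \<open>
  The orders of the graphs in the examples of the cases \<open>k = 1\<close>, and \<open>k = 2\<close> with \<open>N\<close> not regular.
  There are finitely many graphs of a given order up to isomorphism, so infinitely many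
  pairwise non-isomorphic graphs occur exactly if the set of orders is infinite. Every finite
  graph has a copy on natural numbers, and \<open>T\<close> embeds into \<open>N\<close>, so the types chosen for the
  vertices and for the elements of \<open>T\<close> are no restriction.
\<close>

definition example_orders_simple :: "nat set" where
  "example_orders_simple =
     {card (pverts \<Gamma>) | (\<Gamma> :: nat pair_pre_digraph) G N (T :: (nat \<Rightarrow> nat) monoid).
        basic_quasiprimitive \<Gamma> G \<and> unique_minimal_normal_power (pverts \<Gamma>) G N T 1}"

definition example_orders_nonregular :: "nat set" where
  "example_orders_nonregular =
     {card (pverts \<Gamma>) | (\<Gamma> :: nat pair_pre_digraph) G N (T :: (nat \<Rightarrow> nat) monoid).
        basic_quasiprimitive \<Gamma> G \<and> unique_minimal_normal_power (pverts \<Gamma>) G N T 2 \<and>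
        \<not> regular_on (pverts \<Gamma>) N}"

end

theory Submission
  imports Defs "HOL-Algebra.Sym_Groups" "HOL-Algebra.Multiplicative_Group"
begin

text \<open>
  Let \<open>\<Delta>\<close> be the orientation of \<open>\<Gamma>\<close>; both its valencies are \<open>2\<close>, and it is strongly connected. A normal
  subgroup \<open>N \<noteq> 1\<close> of \<open>G\<close> is transitive on vertices. If \<open>N\<close> is transitive on \<open>s\<close>-arcs but not on
  \<open>(s+1)\<close>-arcs, then an element of \<open>N\<close> fixing an \<open>s\<close>-arc fixes all its successors, and hence everything;
  so \<open>N\<close> is regular on \<open>s\<close>-arcs for some \<open>s\<close>. The two elements \<open>a\<close>, \<open>b\<close> of \<open>N\<close> taking an \<open>s\<close>-arc to its
  successors generate \<open>N\<close>, and the stabiliser in \<open>G\<close> of this \<open>s\<close>-arc permutes \<open>{a, b}\<close> by conjugation.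
  It follows in turn that \<open>N\<close> is not abelian, that its centraliser is trivial, and that its index in \<open>G\<close>
  is at most \<open>2\<close>. Therefore the minimal normal subgroup is unique and is either simple or the product
  of a simple group and its conjugate. If it is a product and regular on vertices, then \<open>a\<close> and \<open>b\<close>
  are \<open>(a\<^sub>1, a\<^sub>2)\<close> and \<open>(a\<^sub>2, a\<^sub>1)\<close>, which is the Twisted Wreath Construction.

  The examples are coset graphs. Let \<open>T\<close> be the alternating group of odd degree \<open>n \<ge> 9\<close>, \<open>a\<close> an \<open>n\<close>-cycle and
  \<open>u = (1 2)(3 4)\<close>, so that \<open>a\<^sup>n = 1 \<noteq> (a u)\<^sup>n\<close>. For \<open>k = 1\<close> take \<open>T\<close> with the subgroup \<open>\<langle>u\<rangle>\<close> and the element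
  \<open>a\<close>; for \<open>k = 2\<close> take the wreath product of \<open>T\<close> with the swap \<open>\<tau>\<close>, the subgroup \<open>\<langle>(u, u), \<tau>\<rangle>\<close> and the
  element \<open>(a, a u)\<close>.
\<close>

section \<open>Normal subgroups and \<open>s\<close>-arcs\<close>

text \<open>Vertex stabilisers in \<open>N\<close> may be nontrivial, so generators cannot be read
  off at a vertex. Passing to s-arcs restores regularity, and after that all control over
  \<open>G\<close> rests on one fact: an element fixing both \<open>a\<close> and \<open>b\<close>
  under conjugation centralises \<open>N\<close>. The asymmetry of the orientation excludes abelian
  \<open>N\<close>, where \<open>b\<close> would be the inverse of \<open>a\<close>. In the wreath
  product example the second coordinate \<open>a u\<close> has two purposes. Conjugation by
  \<open>(a, a u)\<close> takes the swap to \<open>(u, u)\<close> times the swap, which is again in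
  the chosen subgroup, so the out-valency is 2 although that subgroup has order 4. Moreover the n-th
  power of \<open>(a, a u)\<close> is a nontrivial element of one factor, which rules out that only
  a diagonal subgroup is generated. As \<open>(u, u)\<close> lies in the base group and fixes a
  vertex, the base group is not regular. The degree is odd because only then is an n-cycle even. It
  is at least 9 because the simplicity argument uses six points touched by a commutator and two
  spare ones.\<close>

lemma (in group) inv_mult_eq_one:
  assumes "x \<in> carrier G" "y \<in> carrier G" "inv x \<otimes> y = \<one>" shows "y = x"
  using assms by (metis inv_closed inv_equality inv_inv)

locale qp_digraph = group G for G (structure) +
  fixes X :: "'x set" and act :: "'a \<Rightarrow> 'x \<Rightarrow> 'x" (infixr "\<cdot>" 75) and D :: "('x \<times> 'x) set"
  assumes finG: "finite (carrier G)" and finX: "finite X" and X_ne: "X \<noteq> {}"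
    and act_closed [simp]: "\<lbrakk>g \<in> carrier G; x \<in> X\<rbrakk> \<Longrightarrow> g \<cdot> x \<in> X"
    and act_one [simp]: "x \<in> X \<Longrightarrow> \<one> \<cdot> x = x"
    and act_mult [simp]: "\<lbrakk>g \<in> carrier G; h \<in> carrier G; x \<in> X\<rbrakk> \<Longrightarrow> (g \<otimes> h) \<cdot> x = g \<cdot> h \<cdot> x"
    and faithful: "\<lbrakk>g \<in> carrier G; \<And>x. x \<in> X \<Longrightarrow> g \<cdot> x = x\<rbrakk> \<Longrightarrow> g = \<one>"
    and D_sub: "D \<subseteq> X \<times> X"
    and D_inv: "\<lbrakk>g \<in> carrier G; (x, y) \<in> D\<rbrakk> \<Longrightarrow> (g \<cdot> x, g \<cdot> y) \<in> D"
    and out2: "x \<in> X \<Longrightarrow> card (D `` {x}) = 2"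
    and arc_trans: "\<lbrakk>(x, y) \<in> D; (u, v) \<in> D\<rbrakk> \<Longrightarrow> \<exists>g\<in>carrier G. g \<cdot> x = u \<and> g \<cdot> y = v"
    and strong: "\<lbrakk>x \<in> X; y \<in> X\<rbrakk> \<Longrightarrow> (x, y) \<in> D\<^sup>*"
    and asym: "(x, y) \<in> D \<Longrightarrow> (y, x) \<notin> D"
    and qp: "\<lbrakk>N \<lhd> G; N \<noteq> {\<one>}; x \<in> X; y \<in> X\<rbrakk> \<Longrightarrow> \<exists>n\<in>N. n \<cdot> x = y"
begin

lemma DX: "(x, y) \<in> D \<Longrightarrow> x \<in> X" "(x, y) \<in> D \<Longrightarrow> y \<in> X"
  using D_sub by auto

lemma act_inv [simp]:
  assumes "g \<in> carrier G" "x \<in> X" shows "inv g \<cdot> g \<cdot> x = x" "g \<cdot> inv g \<cdot> x = x"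
  using assms act_mult[of "inv g" g x] act_mult[of g "inv g" x] by (auto simp del: act_mult)

lemma D_inv_iff:
  assumes "g \<in> carrier G" "x \<in> X" "y \<in> X" shows "(g \<cdot> x, g \<cdot> y) \<in> D \<longleftrightarrow> (x, y) \<in> D"
  using assms D_inv[of g x y] D_inv[of "inv g" "g \<cdot> x" "g \<cdot> y"] by auto

lemma out_obtain:
  assumes "x \<in> X" "(x, y) \<in> D" "(x, z) \<in> D" "y \<noteq> z" "(x, t) \<in> D" shows "t = y \<or> t = z"
proof -
  have "finite (D `` {x})" using out2[OF assms(1)] by (intro card_ge_0_finite) simp
  then have "D `` {x} = {y, z}"
    using assms out2[OF assms(1)] by (intro card_seteq[symmetric]) auto
  then show ?thesis using assms by auto
qed

text \<open>An \<open>s\<close>-arc is a list of \<open>s + 1\<close> vertices, with its terminal vertex at the head.\<close>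

definition walks :: "nat \<Rightarrow> 'x list set" where
  "walks s = {w. length w = Suc s \<and> set w \<subseteq> X \<and> successively (\<lambda>y x. (x, y) \<in> D) w}"

lemma walks_0: "walks 0 = (\<lambda>x. [x]) ` X"
  by (auto simp: walks_def length_Suc_conv)

lemma walks_Cons: "y # w \<in> walks (Suc s) \<longleftrightarrow> w \<in> walks s \<and> (hd w, y) \<in> D"
  by (auto simp: walks_def successively_Cons dest: DX)

lemma walks_hd: "w \<in> walks s \<Longrightarrow> hd w \<in> X"
  by (cases w) (auto simp: walks_def)

lemma walks_ne: "w \<in> walks s \<Longrightarrow> w \<noteq> []"
  by (auto simp: walks_def)

lemma walks_set: "w \<in> walks s \<Longrightarrow> set w \<subseteq> X"
  by (auto simp: walks_def)

lemma walks_map [simp]: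
  assumes "g \<in> carrier G" "w \<in> walks s" shows "map (act g) w \<in> walks s"
  using assms unfolding walks_def
  by (auto simp: successively_map intro!: D_inv elim: successively_mono)

text \<open>Dropping the oldest vertex keeps the length, so s-arcs can be pushed forward along arcs
  indefinitely. Both the spreading of fixed points and the generation of \<open>N\<close> proceed by
  such shifts.\<close>

lemma walks_shift:
  assumes "w \<in> walks s" "(hd w, y) \<in> D" shows "take (Suc s) (y # w) \<in> walks s"
proof -
  have "y # w \<in> walks (Suc s)" using assms by (simp add: walks_Cons)
  moreover have "successively P (take n xs)" if "successively P xs" for P n and xs :: "'x list"
    using that successively_append_iff[of P "take n xs" "drop n xs"] by simp
  moreover have "set (take (Suc s) (y # w)) \<subseteq> set (y # w)" by (rule set_take_subset)
  ultimately show ?thesis unfolding walks_def mem_Collect_eq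
    by (intro conjI) (auto simp del: take_Suc_Cons dest!: subsetD)
qed

lemma map_act_mult:
  "\<lbrakk>g \<in> carrier G; h \<in> carrier G; w \<in> walks s\<rbrakk> \<Longrightarrow> map (act (g \<otimes> h)) w = map (act g) (map (act h) w)"
  by (auto dest!: walks_set)

lemma map_act_inv [simp]:
  "\<lbrakk>g \<in> carrier G; w \<in> walks s\<rbrakk> \<Longrightarrow> map (act (inv g)) (map (act g) w) = w"
  "\<lbrakk>g \<in> carrier G; w \<in> walks s\<rbrakk> \<Longrightarrow> map (act g) (map (act (inv g)) w) = w"
  by (auto dest!: walks_set intro!: map_idI)

lemma map_act_one: "w \<in> walks s \<Longrightarrow> map (act \<one>) w = w"
  by (auto dest!: walks_set intro!: map_idI)

section \<open>Transitivity and regularity on s-arcs\<close>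

definition walk_trans :: "'a set \<Rightarrow> nat \<Rightarrow> bool" where
  "walk_trans N s \<longleftrightarrow> (\<forall>u\<in>walks s. \<forall>v\<in>walks s. \<exists>n\<in>N. map (act n) u = v)"

definition walk_semireg :: "'a set \<Rightarrow> nat \<Rightarrow> bool" where
  "walk_semireg N s \<longleftrightarrow> (\<forall>u\<in>walks s. \<forall>n\<in>N. map (act n) u = u \<longrightarrow> n = \<one>)"

text \<open>If \<open>n\<close> fixes an s-arc but moves a successor of its head, it interchanges
  the two successors, which makes \<open>N\<close> transitive on (s+1)-arcs. Otherwise every shift
  of a fixed s-arc is fixed too, and strong connectivity carries this to all vertices.\<close>

lemma walk_semireg_or_trans_Suc:
  assumes N: "subgroup N G" and tr: "walk_trans N s" and ntr: "\<not> walk_trans N (Suc s)"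
  shows "walk_semireg N s"
proof -
  interpret N: subgroup N G by (fact N)
  have fix_succ: "n \<cdot> y = y"
    if n: "n \<in> N" and w: "w \<in> walks s" and nw: "map (act n) w = w" and y: "(hd w, y) \<in> D" for n w y
  proof (rule ccontr)
    assume ny: "n \<cdot> y \<noteq> y"
    have hw: "hd w \<in> X" "y \<in> X" using w y walks_hd DX by auto
    have "n \<cdot> hd w = hd w" using nw walks_ne[OF w] by (metis hd_map)
    then have nD: "(hd w, n \<cdot> y) \<in> D" using D_inv[OF _ y, of n] n by simp
    \<comment> \<open>Every (s+1)-arc \<open>u\<close> is an image of \<open>y # w\<close>: let
      \<open>m\<close> take \<open>w\<close> to the tail of \<open>u\<close>. If \<open>m\<close>
      sends \<open>y\<close> to the wrong successor, use \<open>m \<otimes> n\<close>, since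
      \<open>n\<close> fixes \<open>w\<close> and moves \<open>y\<close> to the other
      successor.\<close>
    have base: "\<exists>m\<in>N. map (act m) (y # w) = u" if u: "u \<in> walks (Suc s)" for u
    proof -
      obtain y' w' where u': "u = y' # w'" using u by (cases u) (auto simp: walks_def)
      then have w': "w' \<in> walks s" and y': "(hd w', y') \<in> D" using u by (auto simp: walks_Cons)
      obtain m where m: "m \<in> N" "map (act m) w = w'" using tr w w' unfolding walk_trans_def by blast
      then have mh: "m \<cdot> hd w = hd w'" using walks_ne[OF w] by (metis hd_map)
      have "(hd w, inv m \<cdot> y') \<in> D"
        using D_inv[of "inv m", OF _ y'] m hw act_inv(1)[of m "hd w"] unfolding mh by simp
      then have "inv m \<cdot> y' = y \<or> inv m \<cdot> y' = n \<cdot> y"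
        using out_obtain[OF hw(1) y nD] ny by metis
      moreover have "y' \<in> X" using y' DX by auto
      ultimately have "m \<cdot> y = y' \<or> m \<cdot> n \<cdot> y = y'" using m by (metis act_inv(2) N.mem_carrier)
      then show ?thesis
      proof
        assume "m \<cdot> y = y'" then show ?thesis using m u' by auto
      next
        assume "m \<cdot> n \<cdot> y = y'"
        then have "map (act (m \<otimes> n)) (y # w) = u"
          using m u' n hw nw map_act_mult[of m n w s] w by auto
        then show ?thesis using m n by blast
      qed
    qed
    have yw: "y # w \<in> walks (Suc s)" using w y by (simp add: walks_Cons)
    have "\<exists>m\<in>N. map (act m) u = v" if u: "u \<in> walks (Suc s)" and v: "v \<in> walks (Suc s)" for u v
    proof -
      obtain m1 m2 where m: "m1 \<in> N" "map (act m1) (y # w) = u" "m2 \<in> N" "map (act m2) (y # w) = v"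
        using base u v by metis
      have "map (act (m2 \<otimes> inv m1)) u = map (act m2) (map (act (inv m1)) u)"
        using m u by (intro map_act_mult) auto
      also have "map (act (inv m1)) u = y # w"
        using m yw map_act_inv(1)[of m1 "y # w" "Suc s"] by auto
      finally have "map (act (m2 \<otimes> inv m1)) u = v" using m by simp
      then show ?thesis using m by blast
    qed
    then show False using ntr unfolding walk_trans_def by blast
  qed
  show ?thesis unfolding walk_semireg_def
  proof (intro ballI impI)
    fix w n assume w: "w \<in> walks s" and n: "n \<in> N" and nw: "map (act n) w = w"
    \<comment> \<open>The induction carries a fixed s-arc along, not just a fixed vertex, because
      \<open>fix_succ\<close> needs the whole s-arc to be fixed.\<close>
    have ex: "\<exists>v\<in>walks s. hd v = x \<and> map (act n) v = v" if "(hd w, x) \<in> D\<^sup>*" for x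
      using that
    proof (induction rule: rtrancl_induct)
      case base then show ?case using w nw by blast
    next
      case (step x y)
      then obtain v where v: "v \<in> walks s" "hd v = x" "map (act n) v = v" by blast
      then have "n \<cdot> y = y" using fix_succ[OF n] step by blast
      then have "map (act n) (take (Suc s) (y # v)) = take (Suc s) (y # v)"
        using v(3) by (simp flip: take_map)
      moreover have "take (Suc s) (y # v) \<in> walks s" using walks_shift v step by blast
      ultimately show ?case by (intro bexI[of _ "take (Suc s) (y # v)"]) auto
    qed
    show "n = \<one>"
    proof (rule faithful)
      show "n \<in> carrier G" using n by auto
      fix x assume "x \<in> X"
      then obtain v where v: "v \<in> walks s" "hd v = x" "map (act n) v = v"
        using ex strong walks_hd[OF w] by blast
      then show "n \<cdot> x = x" using walks_ne by (metis hd_map)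
    qed
  qed
qed

lemma finite_walks: "finite (walks s)"
  by (rule finite_subset[OF _ finite_lists_length_eq[OF finX, of "Suc s"]]) (auto simp: walks_def)

text \<open>The growth that makes transitivity on s-arcs fail for large \<open>s\<close>.\<close>

lemma card_walks: "2 ^ s \<le> card (walks s)"
proof (induction s)
  case 0
  show ?case using X_ne finX by (simp add: walks_0 card_image inj_on_def card_gt_0_iff Suc_le_eq)
next
  case (Suc s)
  have "walks (Suc s) = (\<lambda>(w, y). y # w) ` (SIGMA w : walks s. D `` {hd w})" (is "_ = ?f ` ?S")
  proof (intro equalityI subsetI)
    fix u assume "u \<in> walks (Suc s)"
    then show "u \<in> ?f ` ?S" by (cases u) (auto simp: walks_Cons, simp add: walks_def)
  qed (auto simp: walks_Cons)
  moreover have "inj_on ?f ?S" by (auto simp: inj_on_def)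
  ultimately have "card (walks (Suc s)) = card ?S" by (simp add: card_image)
  also have "\<dots> = (\<Sum>w\<in>walks s. card (D `` {hd w}))"
    using finite_walks by (intro card_SigmaI) (auto intro!: finite_subset[OF _ finX] dest: DX)
  also have "\<dots> = 2 * card (walks s)" using out2 walks_hd by simp
  finally show ?case using Suc by simp
qed

lemma ex_walk_regular:
  assumes N: "N \<lhd> G" "N \<noteq> {\<one>}"
  shows "\<exists>s. walk_trans N s \<and> walk_semireg N s"
proof -
  have sub: "subgroup N G" using N normal_imp_subgroup by blast
  then have fN: "finite N" using finG finite_subset subgroup.subset by blast
  have "\<exists>s. walk_trans N s \<and> \<not> walk_trans N (Suc s)"
  proof (rule ccontr)
    assume *: "\<not> ?thesis"
    have "walk_trans N 0" using qp[OF N] by (auto simp: walk_trans_def walks_0)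
    then have "walk_trans N s" for s using * by (induction s) auto
    \<comment> \<open>The length \<open>card N\<close> is already too large: transitivity would give
      \<open>2 ^ card N \<le> card N\<close>.\<close>
    then have "walk_trans N (card N)" .
    then have tr: "\<exists>n\<in>N. map (act n) u = v" if "u \<in> walks (card N)" "v \<in> walks (card N)" for u v
      using that unfolding walk_trans_def by simp
    obtain w where w: "w \<in> walks (card N)" using card_walks[of "card N"]
      by (metis card.empty equals0I not_one_le_zero order_trans one_le_power one_le_numeral)
    have sub: "walks (card N) \<subseteq> (\<lambda>n. map (act n) w) ` N"
      using tr[OF w] by (metis image_eqI subsetI)
    have "card (walks (card N)) \<le> card N"
      by (rule surj_card_le[OF fN sub])
    then have "2 ^ card N \<le> card N" using card_walks[of "card N"] by linarith
    then show False using less_exp[of "card N"] by simp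
  qed
  then show ?thesis using walk_semireg_or_trans_Suc[OF sub] by blast
qed

text \<open>The images of \<open>w\<close> under the subgroup generated by \<open>a\<close> and
  \<open>b\<close> are closed under shifts, hence are all s-arcs, and regularity makes the subgroup
  all of \<open>N\<close>. An element fixing \<open>w\<close> permutes the two shifts of
  \<open>w\<close>, and by regularity it permutes \<open>a\<close> and \<open>b\<close> by
  conjugation in the same way.\<close>

lemma regular_generators:
  assumes N: "N \<lhd> G" and tr: "walk_trans N s" and sr: "walk_semireg N s" and w: "w \<in> walks s"
  obtains a b where "a \<in> N" "b \<in> N" "a \<noteq> b" "generate G {a, b} = N"
    "(hd w, a \<cdot> hd w) \<in> D" "(hd w, b \<cdot> hd w) \<in> D"
    "\<And>g. \<lbrakk>g \<in> carrier G; map (act g) w = w\<rbrakk> \<Longrightarrow>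
        g \<otimes> a \<otimes> inv g \<in> {a, b} \<and> g \<otimes> b \<otimes> inv g \<in> {a, b}"
proof -
  interpret N: normal N G by (fact N)
  have wne: "w \<noteq> []" and hw: "hd w \<in> X" and lw: "length w = Suc s"
    using w walks_ne walks_hd by (auto simp: walks_def)
  obtain y z where yz: "D `` {hd w} = {y, z}" "y \<noteq> z"
    using out2[OF hw] by (meson card_2_iff)
  then have yzD: "(hd w, y) \<in> D" "(hd w, z) \<in> D" by auto
  then have yzX: "y \<in> X" "z \<in> X" using DX by auto
  define sh where "sh x v = take (Suc s) (x # v)" for x and v :: "'x list"
  have hd_sh: "hd (sh x v) = x" for x v by (simp add: sh_def)
  have sh_act: "map (act g) (sh x v) = sh (g \<cdot> x) (map (act g) v)" for g x v
    by (simp add: sh_def take_map)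
  have shw: "sh y w \<in> walks s" "sh z w \<in> walks s"
    using walks_shift[OF w] yzD by (auto simp: sh_def)
  obtain a b where a: "a \<in> N" "map (act a) w = sh y w" and b: "b \<in> N" "map (act b) w = sh z w"
    using tr w shw unfolding walk_trans_def by metis
  have ay: "a \<cdot> hd w = y" and bz: "b \<cdot> hd w = z"
    using a(2) b(2) wne hd_sh by (metis hd_map)+
  have ab: "a \<noteq> b" using ay bz yz by auto
  have uniq: "n = m" if "n \<in> N" "m \<in> N" "map (act n) w = map (act m) w" for n m
  proof -
    have "map (act (inv m \<otimes> n)) w = map (act (inv m)) (map (act n) w)"
      using that w by (intro map_act_mult) auto
    also have "\<dots> = w" unfolding that(3) using that w by (intro map_act_inv) auto
    finally have "map (act (inv m \<otimes> n)) w = w" .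
    then have "inv m \<otimes> n = \<one>" using sr w that unfolding walk_semireg_def by blast
    then show ?thesis using that inv_mult_eq_one[of m n] by auto
  qed
  define K where "K = generate G {a, b}"
  have Ksub: "subgroup K G" unfolding K_def using a b by (intro generate_is_subgroup) auto
  interpret K: subgroup K G by (fact Ksub)
  have aK: "a \<in> K" "b \<in> K" unfolding K_def by (auto intro: generate.incl)
  have KN: "K \<subseteq> N" unfolding K_def
    by (rule generate_subgroup_incl) (use a b N.subgroup_axioms in auto)
  define S where "S = (\<lambda>k. map (act k) w) ` K"
  \<comment> \<open>An element \<open>k\<close> carries the two shifts of \<open>w\<close> to the
    two shifts of its image, so the shift to \<open>x\<close> is the image of \<open>w\<close> under
    \<open>k \<otimes> a\<close> or \<open>k \<otimes> b\<close>.\<close>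
  have S_sh: "sh x v \<in> S" if v: "v \<in> S" and x: "(hd v, x) \<in> D" for v x
  proof -
    obtain k where k: "k \<in> K" "v = map (act k) w" using v unfolding S_def by auto
    then have hv: "hd v = k \<cdot> hd w" using wne by (simp add: hd_map)
    have xX: "x \<in> X" using x DX by auto
    have "(hd w, inv k \<cdot> x) \<in> D" using D_inv[OF _ x, of "inv k"] k hv hw by simp
    then have "inv k \<cdot> x = y \<or> inv k \<cdot> x = z" using yz by auto
    then have "x = k \<cdot> y \<or> x = k \<cdot> z" using xX k by force
    then obtain c where c: "c \<in> K" "sh x v = map (act k) (map (act c) w)"
      using a b aK k sh_act by metis
    then have "sh x v = map (act (k \<otimes> c)) w" using k map_act_mult[of k c w s] w by simp
    then show ?thesis unfolding S_def using k c by blast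
  qed
  let ?P = "\<lambda>y x. (x, y) \<in> D"
  have S_take: "take (Suc s) (p @ w) \<in> S" if "successively ?P (p @ w)" for p
    using that
  proof (induction p)
    case Nil
    have "w = map (act \<one>) w" using map_act_one w by simp
    then show ?case using lw unfolding S_def by auto
  next
    case (Cons x p)
    have ne: "p @ w \<noteq> []" using wne by simp
    then have "successively ?P (p @ w)" "(hd (p @ w), x) \<in> D"
      using Cons.prems by (auto simp: successively_Cons)
    moreover have "hd (take (Suc s) (p @ w)) = hd (p @ w)" using ne by (cases "p @ w") auto
    ultimately have "sh x (take (Suc s) (p @ w)) \<in> S" using S_sh Cons.IH by metis
    moreover have "sh x (take (Suc s) (p @ w)) = take (Suc s) ((x # p) @ w)"
      unfolding sh_def by (simp only: take_Suc_Cons append_Cons take_take min_absorb1 le_SucI le_refl)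
    ultimately show ?case by simp
  qed
  have ex_path: "\<exists>p. successively ?P (p @ w) \<and> hd (p @ w) = x" if "(hd w, x) \<in> D\<^sup>*" for x
    using that
  proof (induction rule: rtrancl_induct)
    case base
    then show ?case using w by (intro exI[of _ "[]"]) (auto simp: walks_def)
  next
    case (step x y)
    then obtain p where "successively ?P (p @ w)" "hd (p @ w) = x" by blast
    then show ?case using step by (intro exI[of _ "y # p"]) (auto simp: successively_Cons)
  qed
  \<comment> \<open>Walk from the head of \<open>w\<close> to the initial vertex of
    \<open>v\<close>, which is \<open>last v\<close>, and continue along \<open>v\<close>. The final
    window of length \<open>Suc s\<close> is then \<open>v\<close>.\<close>
  have all_S: "v \<in> S" if v: "v \<in> walks s" for v
  proof -
    have vne: "v \<noteq> []" using v walks_ne by auto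
    then have "last v \<in> X" using walks_set[OF v] by auto
    then obtain p where p: "successively ?P (p @ w)" "hd (p @ w) = last v"
      using ex_path strong[OF hw] by blast
    obtain r where r: "p @ w = last v # r" using p(2) wne by (cases "p @ w") auto
    have eq: "(butlast v @ p) @ w = v @ r" using vne r by (metis append.assoc append_Cons
          append_Nil append_butlast_last_id)
    have "successively ?P (v @ r)"
      using p(1) r v by (cases r) (auto simp: successively_append_iff successively_Cons walks_def)
    then have "take (Suc s) (v @ r) \<in> S" using S_take[of "butlast v @ p"] eq by metis
    then show ?thesis using v by (simp add: walks_def)
  qed
  have "N \<subseteq> K"
  proof
    fix n assume n: "n \<in> N"
    then have "map (act n) w \<in> S" using all_S w by auto
    then obtain k where "k \<in> K" "map (act n) w = map (act k) w" unfolding S_def by auto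
    then show "n \<in> K" using uniq n KN by (metis subsetD)
  qed
  then have gen: "generate G {a, b} = N" using KN unfolding K_def by auto
  have conj: "g \<otimes> c \<otimes> inv g \<in> {a, b}"
    if g: "g \<in> carrier G" "map (act g) w = w" and c: "c \<in> {a, b}" for g c
  proof -
    have cN: "c \<in> N" using c a b by auto
    obtain x where x: "map (act c) w = sh x w" "(hd w, x) \<in> D" using c a b yzD by auto
    have gw: "map (act (inv g)) w = w" using map_act_inv(1)[of g w s] g w by simp
    have "map (act (g \<otimes> c \<otimes> inv g)) w = map (act g) (map (act c) (map (act (inv g)) w))"
      using g cN w map_act_mult[of "g \<otimes> c" "inv g" w s]
        map_act_mult[of g c w s] gw by simp
    then have 1: "map (act (g \<otimes> c \<otimes> inv g)) w = sh (g \<cdot> x) w" using gw x sh_act g by simp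
    have "g \<cdot> hd w = hd w" using g(2) wne by (metis hd_map)
    then have "(hd w, g \<cdot> x) \<in> D" using D_inv[OF g(1) x(2)] by simp
    then have "g \<cdot> x = y \<or> g \<cdot> x = z" using yz by auto
    then have "map (act (g \<otimes> c \<otimes> inv g)) w \<in> {map (act a) w, map (act b) w}"
      using 1 a b by auto
    moreover have "g \<otimes> c \<otimes> inv g \<in> N" using N.inv_op_closed2 g cN by blast
    ultimately show ?thesis using uniq a b by blast
  qed
  show ?thesis
  proof (rule that[OF a(1) b(1) ab gen])
    show "(hd w, a \<cdot> hd w) \<in> D" "(hd w, b \<cdot> hd w) \<in> D" using ay bz yzD by auto
    show "g \<otimes> a \<otimes> inv g \<in> {a, b} \<and> g \<otimes> b \<otimes> inv g \<in> {a, b}"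
      if "g \<in> carrier G" "map (act g) w = w" for g
      using conj[OF that] by blast
  qed
qed

end

section \<open>The minimal normal subgroup\<close>

context group
begin

definition cj :: "'a \<Rightarrow> 'a \<Rightarrow> 'a" where
  "cj g x = g \<otimes> x \<otimes> inv g"

lemma cj_closed [simp]: "\<lbrakk>g \<in> carrier G; x \<in> carrier G\<rbrakk> \<Longrightarrow> cj g x \<in> carrier G"
  by (simp add: cj_def)

lemma cj_one_right [simp]: "g \<in> carrier G \<Longrightarrow> cj g \<one> = \<one>"
  by (simp add: cj_def)

lemma cj_one_left [simp]: "x \<in> carrier G \<Longrightarrow> cj \<one> x = x"
  by (simp add: cj_def)

lemma cj_mult:
  assumes "g \<in> carrier G" "x \<in> carrier G" "y \<in> carrier G"
  shows "cj g (x \<otimes> y) = cj g x \<otimes> cj g y"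
proof -
  have "inv g \<otimes> (g \<otimes> (y \<otimes> inv g)) = y \<otimes> inv g"
    using assms by (simp flip: m_assoc)
  then show ?thesis using assms by (simp add: cj_def m_assoc)
qed

lemma cj_cj:
  "\<lbrakk>g \<in> carrier G; h \<in> carrier G; x \<in> carrier G\<rbrakk> \<Longrightarrow> cj (g \<otimes> h) x = cj g (cj h x)"
  by (simp add: cj_def m_assoc inv_mult_group)

lemma cj_inv: "\<lbrakk>g \<in> carrier G; x \<in> carrier G\<rbrakk> \<Longrightarrow> cj g (inv x) = inv (cj g x)"
  by (simp add: cj_def m_assoc inv_mult_group)

lemma cj_inv_cj [simp]:
  "\<lbrakk>g \<in> carrier G; x \<in> carrier G\<rbrakk> \<Longrightarrow> cj (inv g) (cj g x) = x"
  "\<lbrakk>g \<in> carrier G; x \<in> carrier G\<rbrakk> \<Longrightarrow> cj g (cj (inv g) x) = x"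
  by (simp_all flip: cj_cj)

lemma cj_inj: "\<lbrakk>g \<in> carrier G; x \<in> carrier G; y \<in> carrier G; cj g x = cj g y\<rbrakk> \<Longrightarrow> x = y"
  by (metis cj_inv_cj(1))

lemma cj_fix_iff:
  "\<lbrakk>g \<in> carrier G; x \<in> carrier G\<rbrakk> \<Longrightarrow> cj g x = x \<longleftrightarrow> g \<otimes> x = x \<otimes> g"
  by (metis cj_def inv_solve_right m_closed)

lemma normal_cj: "\<lbrakk>N \<lhd> G; g \<in> carrier G; n \<in> N\<rbrakk> \<Longrightarrow> cj g n \<in> N"
  unfolding cj_def by (rule normal.inv_op_closed2)

lemma normal_cjI:
  "\<lbrakk>subgroup N G; \<And>g n. \<lbrakk>g \<in> carrier G; n \<in> N\<rbrakk> \<Longrightarrow> cj g n \<in> N\<rbrakk> \<Longrightarrow> N \<lhd> G"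
  unfolding cj_def by (simp add: normal_inv_iff)

lemma cj_fixed_subgroup:
  assumes "g \<in> carrier G" shows "subgroup {x \<in> carrier G. cj g x = x} G"
  using assms by (unfold_locales) (auto simp: cj_mult cj_inv)

lemma centralizer_normal:
  assumes N: "N \<lhd> G" shows "{g \<in> carrier G. \<forall>n\<in>N. cj g n = n} \<lhd> G" (is "?C \<lhd> G")
proof -
  have NG: "N \<subseteq> carrier G" using N normal_imp_subgroup subgroup.subset by blast
  have "subgroup ?C G"
    using NG by unfold_locales (auto simp: cj_cj subset_iff, metis cj_inv_cj(1))
  moreover have "cj g c \<in> ?C" if g: "g \<in> carrier G" and c: "c \<in> ?C" for g c
  proof -
    have "cj (cj g c) n = n" if n: "n \<in> N" for n
    proof -
      have "cj (inv g) n \<in> N" using normal_cj[OF N] g n by simp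
      then have "cj c (cj (inv g) n) = cj (inv g) n" using c by auto
      then show ?thesis using g c n NG by (auto simp: cj_def[of g c] cj_cj subset_iff)
    qed
    then show ?thesis using g c by auto
  qed
  ultimately show ?thesis by (rule normal_cjI)
qed

text \<open>\<open>M\<close> is normal in \<open>N\<close>, expressed by operations of the ambient group.\<close>

definition nsub :: "'a set \<Rightarrow> 'a set \<Rightarrow> bool" where
  "nsub M N \<longleftrightarrow> subgroup M G \<and> M \<subseteq> N \<and> (\<forall>n\<in>N. \<forall>m\<in>M. cj n m \<in> M)"

lemma nsub_iff_normal:
  assumes N: "subgroup N G" shows "nsub M N \<longleftrightarrow> M \<lhd> G\<lparr>carrier := N\<rparr>"
proof -
  interpret N: group "G\<lparr>carrier := N\<rparr>" using N by (rule subgroup_imp_group)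
  have "(\<forall>n\<in>N. \<forall>m\<in>M. cj n m \<in> M) \<longleftrightarrow> (\<forall>n\<in>N. \<forall>m\<in>M. n \<otimes> m \<otimes> inv\<^bsub>G\<lparr>carrier := N\<rparr>\<^esub> n \<in> M)"
    using m_inv_consistent[OF N] by (simp add: cj_def)
  moreover have "subgroup M G \<and> M \<subseteq> N \<longleftrightarrow> subgroup M (G\<lparr>carrier := N\<rparr>)"
    using N incl_subgroup[OF N, of M] subgroup_incl[of M N] subgroup.subset[of M "G\<lparr>carrier := N\<rparr>"]
    by auto
  ultimately show ?thesis unfolding nsub_def N.normal_inv_iff by auto
qed

lemma nsub_carrier: "nsub M (carrier G) \<longleftrightarrow> M \<lhd> G"
  using nsub_iff_normal[OF subgroup_self] by simp

lemma nsub_Int: "\<lbrakk>nsub L N; nsub M N\<rbrakk> \<Longrightarrow> nsub (L \<inter> M) N"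
  unfolding nsub_def using subgroups_Inter_pair[of L M] by (metis Int_iff le_infI1)

text \<open>The commutator of \<open>x\<close> and \<open>y\<close> lies in \<open>L\<close> when
  read as \<open>x \<otimes> cj y (inv x)\<close> and in \<open>M\<close> when read as
  \<open>cj x y \<otimes> inv y\<close>.\<close>

lemma nsub_commute:
  assumes "nsub L N" "nsub M N" "L \<inter> M = {\<one>}" "x \<in> L" "y \<in> M"
  shows "x \<otimes> y = y \<otimes> x"
proof -
  interpret L: subgroup L G using assms by (simp add: nsub_def)
  interpret M: subgroup M G using assms by (simp add: nsub_def)
  have xy: "x \<in> carrier G" "y \<in> carrier G" "x \<in> N" "y \<in> N"
    using assms by (auto simp: nsub_def)
  have "cj y (inv x) \<in> L" "cj x y \<in> M" using assms xy L.m_inv_closed by (auto simp: nsub_def)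
  then have "x \<otimes> cj y (inv x) \<in> L" "cj x y \<otimes> inv y \<in> M" using assms by auto
  moreover have "x \<otimes> cj y (inv x) = cj x y \<otimes> inv y" using xy by (simp add: cj_def m_assoc)
  ultimately have "cj x y \<otimes> inv y = \<one>" using assms(3) by auto
  then have "cj x y = y" using xy inv_equality[of "cj x y" "inv y"] by simp
  then show ?thesis using xy cj_fix_iff by blast
qed

lemma simple_groupI_nsub:
  assumes M: "subgroup M G" "M \<noteq> {\<one>}" "finite M"
    and s: "\<And>L. nsub L M \<Longrightarrow> L = {\<one>} \<or> L = M"
  shows "simple_group (G\<lparr>carrier := M\<rparr>)"
proof -
  interpret M: group "G\<lparr>carrier := M\<rparr>" using M by (intro subgroup_imp_group)
  have "\<one> \<in> M" using M subgroup.one_closed by blast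
  then have "card M > 1" using M card_1_singletonE[of M] card_gt_0_iff[of M]
    by (metis One_nat_def Suc_lessI empty_iff singletonD)
  then show ?thesis
    using s nsub_iff_normal[OF M(1)] by unfold_locales (auto simp: order_def)
qed

text \<open>Serves twice: inside \<open>G\<close> it gives the minimal normal subgroup, and inside
  that subgroup it gives a simple factor.\<close>

lemma ex_minimal_nsub:
  assumes N: "subgroup N G" "N \<noteq> {\<one>}" "finite N"
  obtains M where "nsub M N" "M \<noteq> {\<one>}"
    "\<And>L. \<lbrakk>nsub L N; L \<noteq> {\<one>}; L \<subseteq> M\<rbrakk> \<Longrightarrow> L = M"
proof -
  let ?A = "{M. nsub M N \<and> M \<noteq> {\<one>}}"
  have "?A \<subseteq> Pow N" by (auto simp: nsub_def)
  then have "finite ?A" using N finite_subset by blast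
  moreover have "N \<in> ?A" using N
    by (auto simp: nsub_def cj_def intro!: subgroup.m_closed subgroup.m_inv_closed)
  ultimately obtain M where "M \<in> ?A" "\<And>L. L \<in> ?A \<Longrightarrow> L \<subseteq> M \<Longrightarrow> L = M"
    using finite_has_minimal[of ?A] by fastforce
  then show ?thesis using that by blast
qed

end

section \<open>Centraliser, index and minimal normal subgroup\<close>

context qp_digraph
begin

text \<open>The case \<open>s = 0\<close> of \<open>regular_generators\<close>. Arc-transitivity
  adds an element \<sigma> fixing \<open>x\<close> and moving \<open>a \<cdot> x\<close> to
  \<open>b \<cdot> x\<close>; as \<open>N\<close> is regular on vertices, \<sigma> conjugates
  \<open>a\<close> to \<open>b\<close> and therefore \<open>b\<close> to \<open>a\<close>.
  Semiregularity at the single vertex \<open>x\<close> spreads to the others by conjugation.\<close>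

lemma vertex_generators:
  assumes N: "N \<lhd> G" "N \<noteq> {\<one>}" and x: "x \<in> X"
    and sr: "\<And>n. \<lbrakk>n \<in> N; n \<cdot> x = x\<rbrakk> \<Longrightarrow> n = \<one>"
  obtains a b \<sigma> where "a \<in> N" "b \<in> N" "a \<noteq> b" "generate G {a, b} = N"
    "(x, a \<cdot> x) \<in> D" "(x, b \<cdot> x) \<in> D"
    "\<And>g. \<lbrakk>g \<in> carrier G; g \<cdot> x = x\<rbrakk> \<Longrightarrow> cj g a \<in> {a, b} \<and> cj g b \<in> {a, b}"
    "\<sigma> \<in> carrier G" "\<sigma> \<cdot> x = x" "cj \<sigma> a = b" "cj \<sigma> b = a"
proof -
  interpret N: normal N G by (fact N(1))
  have tr: "walk_trans N 0" using qp[OF N] by (auto simp: walk_trans_def walks_0)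
  have sr: "walk_semireg N 0" unfolding walk_semireg_def
  proof (intro ballI impI)
    fix u n assume u: "u \<in> walks 0" and n: "n \<in> N" and nu: "map (act n) u = u"
    then obtain y where y: "y \<in> X" "n \<cdot> y = y" by (auto simp: walks_0)
    obtain m where m: "m \<in> N" "m \<cdot> y = x" using qp[OF N y(1) x] by auto
    then have "cj m n \<cdot> x = x" using n y x unfolding cj_def m(2)[symmetric] by simp
    moreover have "cj m n \<in> N" using normal_cj N n m by auto
    ultimately have "cj m n = \<one>" using sr by blast
    then show "n = \<one>" using n m cj_inj[of m n \<one>] by auto
  qed
  have w: "[x] \<in> walks 0" using x by (auto simp: walks_0)
  obtain a b where ab: "a \<in> N" "b \<in> N" "a \<noteq> b" "generate G {a, b} = N"
    and D: "(x, a \<cdot> x) \<in> D" "(x, b \<cdot> x) \<in> D"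
    and c: "\<And>g. \<lbrakk>g \<in> carrier G; g \<cdot> x = x\<rbrakk> \<Longrightarrow> cj g a \<in> {a, b} \<and> cj g b \<in> {a, b}"
    by (rule regular_generators[OF N(1) tr sr w]) (auto simp: cj_def)
  obtain \<sigma> where s: "\<sigma> \<in> carrier G" "\<sigma> \<cdot> x = x" "\<sigma> \<cdot> a \<cdot> x = b \<cdot> x"
    using arc_trans[OF D] by auto
  have neq: "a \<cdot> x \<noteq> b \<cdot> x"
  proof
    assume "a \<cdot> x = b \<cdot> x"
    then have "map (act (inv b \<otimes> a)) [x] = [x]" using ab x by simp
    moreover have "inv b \<otimes> a \<in> N" using ab by simp
    ultimately have "inv b \<otimes> a = \<one>" using sr[unfolded walk_semireg_def, rule_format, OF w] by simp
    then show False using ab inv_mult_eq_one[of b a] by auto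
  qed
  have "inv \<sigma> \<cdot> x = x" using s x act_inv(1)[of \<sigma> x] by simp
  then have "cj \<sigma> a \<cdot> x = b \<cdot> x" using s ab x by (simp add: cj_def)
  then have 1: "cj \<sigma> a = b" using c[OF s(1,2)] neq by auto
  then have "cj \<sigma> b \<noteq> b" using ab s cj_inj[of \<sigma> a b] by auto
  then have "cj \<sigma> b = a" using c[OF s(1,2)] by auto
  then show ?thesis using that[OF ab D c s(1,2) 1] by auto
qed

lemma cj_trivial_generate:
  assumes "g \<in> carrier G" "a \<in> carrier G" "b \<in> carrier G" "cj g a = a" "cj g b = b"
    "n \<in> generate G {a, b}"
  shows "cj g n = n"
  using generate_subgroup_incl[OF _ cj_fixed_subgroup[OF assms(1)], of "{a, b}"] assms by auto

text \<open>For abelian \<open>N\<close> the element \<open>a b\<^sup>-\<^sup>1\<close> generates a normal subgroup of \<open>G\<close>, hence all of \<open>N\<close>, and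
  \<open>\<sigma>\<close> inverts it. So \<open>b = a\<^sup>-\<^sup>1\<close>, which contradicts the asymmetry of \<open>D\<close>.\<close>

lemma normal_not_abelian:
  assumes N: "N \<lhd> G" "N \<noteq> {\<one>}"
  shows "\<not> (\<forall>x\<in>N. \<forall>y\<in>N. x \<otimes> y = y \<otimes> x)"
proof
  assume comm: "\<forall>x\<in>N. \<forall>y\<in>N. x \<otimes> y = y \<otimes> x"
  interpret N: normal N G by (fact N(1))
  have cjN: "cj x y = y" if "x \<in> N" "y \<in> N" for x y
    using that comm cj_fix_iff[of x y] by auto
  obtain x where x: "x \<in> X" using X_ne by auto
  have sr: "n = \<one>" if n: "n \<in> N" "n \<cdot> x = x" for n
  proof (rule faithful)
    fix y assume "y \<in> X"
    then obtain m where m: "m \<in> N" "m \<cdot> x = y" using qp[OF N x] by auto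
    then have "(n \<otimes> m) \<cdot> x = (m \<otimes> n) \<cdot> x" using comm n by auto
    then show "n \<cdot> y = y" using m n x by auto
  qed (use n in auto)
  obtain a b \<sigma> where ab: "a \<in> N" "b \<in> N" "a \<noteq> b" "generate G {a, b} = N"
    and D: "(x, a \<cdot> x) \<in> D" "(x, b \<cdot> x) \<in> D"
    and cjab: "\<And>g. \<lbrakk>g \<in> carrier G; g \<cdot> x = x\<rbrakk> \<Longrightarrow> cj g a \<in> {a, b} \<and> cj g b \<in> {a, b}"
    and s: "\<sigma> \<in> carrier G" "\<sigma> \<cdot> x = x" "cj \<sigma> a = b" "cj \<sigma> b = a"
    using vertex_generators[OF N x sr] by metis
  define c where "c = a \<otimes> inv b"
  have cN: "c \<in> N" using ab by (auto simp: c_def)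
  have c1: "c \<noteq> \<one>" using ab inv_mult_eq_one[of "inv a" "inv b"] inv_inv unfolding c_def
    by (metis N.mem_carrier inv_closed)
  have invc: "inv c = b \<otimes> inv a" using ab by (simp add: c_def inv_mult_group)
  \<comment> \<open>Write \<open>g = n \<otimes> h\<close> with \<open>h\<close> fixing
    \<open>x\<close>. Conjugation by \<open>h\<close> permutes \<open>a\<close> and
    \<open>b\<close>, so it fixes or inverts \<open>c\<close>, and conjugation by \<open>n\<close>
    changes nothing because \<open>N\<close> is abelian.\<close>
  have cjc: "cj g c \<in> {c, inv c}" if g: "g \<in> carrier G" for g
  proof -
    obtain n where n: "n \<in> N" "n \<cdot> x = g \<cdot> x" using qp[OF N x, of "g \<cdot> x"] g x by auto
    define h where "h = inv n \<otimes> g"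
    have h: "h \<in> carrier G" "h \<cdot> x = x" "g = n \<otimes> h"
      using n g x act_inv(1)[of n x] by (auto simp: h_def simp flip: m_assoc)
    have "cj h a \<noteq> cj h b" using ab h cj_inj[of h a b] by auto
    moreover have "cj h c = cj h a \<otimes> inv (cj h b)"
      using h ab by (simp add: c_def cj_mult cj_inv)
    ultimately have hc: "cj h c \<in> {c, inv c}"
      using cjab[OF h(1,2)] unfolding invc by (auto simp: c_def)
    have "cj g c = cj n (cj h c)" using h n cN by (simp add: cj_cj)
    also have "\<dots> = cj h c" using hc cN n cjN by auto
    finally show ?thesis using hc by simp
  qed
  define L where "L = generate G {c, inv c}"
  have "L \<lhd> G" unfolding L_def
  proof (rule normal_generateI)
    show "{c, inv c} \<subseteq> carrier G" using cN by auto
    fix h g assume h: "h \<in> {c, inv c}" and g: "g \<in> carrier G"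
    have "cj g (inv c) = inv (cj g c)" using g cN by (simp add: cj_inv)
    then have "cj g h \<in> {c, inv c}" using h cjc[OF g] cN by auto
    then show "g \<otimes> h \<otimes> inv g \<in> {c, inv c}" by (simp add: cj_def)
  qed
  moreover have "c \<in> L" unfolding L_def by (auto intro: generate.incl)
  moreover have LN: "L \<subseteq> N" unfolding L_def
    using generate_subgroup_incl[OF _ N.subgroup_axioms, of "{c, inv c}"] cN by auto
  ultimately obtain l where l: "l \<in> L" "l \<cdot> x = a \<cdot> x"
    using qp[of L x "a \<cdot> x"] c1 x ab by auto
  then have "(inv l \<otimes> a) \<cdot> x = x" using ab x LN act_inv(1)[of l x] by (auto simp: subset_iff)
  moreover have "inv l \<otimes> a \<in> N" using l ab LN by (simp add: subset_iff)
  ultimately have "inv l \<otimes> a = \<one>" using sr by blast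
  then have "a = l" using l ab LN inv_mult_eq_one[of l a] by (auto simp: subset_iff)
  then have aL: "a \<in> L" using l by simp
  \<comment> \<open>Commutativity makes the elements inverted by \<sigma> a subgroup. It contains
    \<open>c\<close>, hence \<open>L\<close>, hence \<open>a\<close>.\<close>
  have "subgroup {y \<in> N. cj \<sigma> y = inv y} G" (is "subgroup ?S G")
  proof
    fix u v assume uv: "u \<in> ?S" "v \<in> ?S"
    then have "cj \<sigma> (u \<otimes> v) = inv u \<otimes> inv v" using s by (auto simp: cj_mult)
    also have "\<dots> = inv v \<otimes> inv u" using comm uv by auto
    finally show "u \<otimes> v \<in> ?S" using uv by (auto simp: inv_mult_group)
  qed (use s in \<open>auto simp: cj_inv\<close>)
  moreover have "cj \<sigma> c = inv c" using s ab by (simp add: invc) (simp add: c_def cj_mult cj_inv)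
  then have "{c, inv c} \<subseteq> ?S" using cN s by (auto simp: cj_inv)
  ultimately have "a \<in> ?S" using aL unfolding L_def using generate_subgroup_incl by blast
  then have "b = inv a" using s by simp
  then have "(a \<cdot> x, x) \<in> D" using D_inv[OF _ D(2), of a] ab x by simp
  then show False using D asym by auto
qed

text \<open>If the centraliser \<open>C\<close> is not trivial then \<open>C\<close> and \<open>N\<close> are both regular on vertices. Some \<open>d a\<close> with
  \<open>d \<in> C\<close> fixes the base vertex and acts on \<open>N\<close> as conjugation by \<open>a\<close> does. It fixes \<open>a\<close>, hence also \<open>b\<close>.\<close>

lemma centralizer_trivial:
  assumes N: "N \<lhd> G" "N \<noteq> {\<one>}" and c: "c \<in> carrier G" and cN: "\<And>n. n \<in> N \<Longrightarrow> cj c n = n"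
  shows "c = \<one>"
proof (rule ccontr)
  assume c1: "c \<noteq> \<one>"
  interpret N: normal N G by (fact N(1))
  define C where "C = {g \<in> carrier G. \<forall>n\<in>N. cj g n = n}"
  have C: "C \<lhd> G" "C \<noteq> {\<one>}" using centralizer_normal[OF N(1)] c c1 cN by (auto simp: C_def)
  have CN: "d \<otimes> n = n \<otimes> d" if "d \<in> C" "n \<in> N" for d n
    using that cj_fix_iff[of d n] by (auto simp: C_def)
  obtain x where x: "x \<in> X" using X_ne by auto
  have sr: "n = \<one>" if n: "n \<in> N" "n \<cdot> x = x" for n
  proof (rule faithful)
    fix y assume "y \<in> X"
    then obtain m where m: "m \<in> C" "m \<cdot> x = y" using qp[OF C x] by auto
    then have "(n \<otimes> m) \<cdot> x = (m \<otimes> n) \<cdot> x" using CN[OF m(1) n(1)] by simp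
    then show "n \<cdot> y = y" using m n x by (auto simp: C_def)
  qed (use n in auto)
  obtain a b \<sigma> where ab: "a \<in> N" "b \<in> N" "a \<noteq> b" "generate G {a, b} = N"
    and cjab: "\<And>g. \<lbrakk>g \<in> carrier G; g \<cdot> x = x\<rbrakk> \<Longrightarrow> cj g a \<in> {a, b} \<and> cj g b \<in> {a, b}"
    using vertex_generators[OF N x sr] by metis
  obtain d where d: "d \<in> C" "d \<cdot> a \<cdot> x = x" using qp[OF C, of "a \<cdot> x" x] x ab by auto
  then have dG: "d \<in> carrier G" by (auto simp: C_def)
  have abN: "cj a b \<in> N" using ab normal_cj N by auto
  have "cj (d \<otimes> a) b = cj a b" using d dG ab abN by (auto simp: cj_cj C_def)
  moreover have "(d \<otimes> a) \<cdot> x = x" using d dG ab x by simp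
  ultimately have "cj a b \<in> {a, b}" using cjab[of "d \<otimes> a"] dG ab by auto
  moreover have aa: "cj a a = a" using ab cj_fix_iff by auto
  ultimately have cab: "cj a b = b" using cj_inj[of a a b] ab by auto
  then have cba: "cj b a = a" using ab cj_fix_iff[of a b] cj_fix_iff[of b a] by auto
  have bb: "cj b b = b" using ab cj_fix_iff by auto
  have "cj a n = n" "cj b n = n" if "n \<in> N" for n
    using that ab aa cab cba bb cj_trivial_generate[of a a b n] cj_trivial_generate[of b a b n] by auto
  then have "cj n a = a" "cj n b = b" if "n \<in> N" for n
    using that ab cj_fix_iff by (metis N.mem_carrier)+
  then have "cj n m = m" if "n \<in> N" "m \<in> N" for n m
    using that ab cj_trivial_generate[of n a b m] by auto
  then have "n \<otimes> m = m \<otimes> n" if "n \<in> N" "m \<in> N" for n m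
    using that cj_fix_iff by (metis N.mem_carrier)
  then show False using normal_not_abelian[OF N] by blast
qed

text \<open>Modulo \<open>N\<close>, an element outside \<open>N\<close> can be taken to fix the
  s-arc \<open>w\<close>. It must interchange \<open>a\<close> and \<open>b\<close>, since fixing
  both would make it centralise \<open>N\<close>. Two such elements differ by one that fixes both,
  so they are equal. The conclusion says that all elements outside \<open>N\<close> form a single
  left coset.\<close>

lemma index_at_most_two:
  assumes N: "N \<lhd> G" "N \<noteq> {\<one>}" and g: "g \<in> carrier G" "g \<notin> N" and h: "h \<in> carrier G" "h \<notin> N"
  shows "inv g \<otimes> h \<in> N"
proof -
  interpret N: normal N G by (fact N(1))
  obtain s where s: "walk_trans N s" "walk_semireg N s" using ex_walk_regular[OF N] by auto
  have "walks s \<noteq> {}" using card_walks[of s] by (metis card.empty not_one_le_zero order_trans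
        one_le_power one_le_numeral)
  then obtain w where w: "w \<in> walks s" by auto
  obtain a b where ab: "a \<in> N" "b \<in> N" "a \<noteq> b" "generate G {a, b} = N"
    and c: "\<And>g. \<lbrakk>g \<in> carrier G; map (act g) w = w\<rbrakk> \<Longrightarrow> cj g a \<in> {a, b} \<and> cj g b \<in> {a, b}"
    by (rule regular_generators[OF N(1) s w]) (auto simp: cj_def)
  have fix_ab: "k = \<one>" if "k \<in> carrier G" "cj k a = a" "cj k b = b" for k
    using centralizer_trivial[OF N that(1)] cj_trivial_generate[of k a b] that ab by auto
  have reduce: "\<exists>n\<in>N. \<exists>k\<in>carrier G. g = n \<otimes> k \<and> k \<notin> N \<and> cj k a = b \<and> cj k b = a"
    if g: "g \<in> carrier G" "g \<notin> N" for g
  proof -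
    obtain n where n: "n \<in> N" "map (act n) w = map (act g) w"
      using s(1) w walks_map[OF g(1) w] unfolding walk_trans_def by blast
    define k where "k = inv n \<otimes> g"
    have k: "k \<in> carrier G" "g = n \<otimes> k" using n g by (auto simp: k_def simp flip: m_assoc)
    have kN: "k \<notin> N" using k n g by auto
    have "map (act k) w = map (act (inv n)) (map (act g) w)"
      unfolding k_def using n g w by (intro map_act_mult) auto
    also have "\<dots> = w" unfolding n(2)[symmetric] using n w by (intro map_act_inv) auto
    finally have cc: "cj k a \<in> {a, b}" "cj k b \<in> {a, b}" using c k by auto
    moreover have "cj k a \<noteq> cj k b" using cj_inj[of k a b] k ab by auto
    moreover have "\<not> (cj k a = a \<and> cj k b = b)" using fix_ab[OF k(1)] kN by auto
    ultimately have "cj k a = b" "cj k b = a" by auto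
    then show ?thesis using n k kN by blast
  qed
  obtain n k where n: "n \<in> N" "k \<in> carrier G" "g = n \<otimes> k" "cj k a = b" "cj k b = a"
    using reduce[OF g] by blast
  obtain m l where m: "m \<in> N" "l \<in> carrier G" "h = m \<otimes> l" "cj l a = b" "cj l b = a"
    using reduce[OF h] by blast
  have "cj (inv k) b = a" "cj (inv k) a = b" using n ab cj_inv_cj(1)[of k a] cj_inv_cj(1)[of k b] by auto
  then have "inv k \<otimes> l = \<one>" using fix_ab[of "inv k \<otimes> l"] n m ab by (auto simp: cj_cj)
  then have kl: "l = k" using n m inv_mult_eq_one[of k l] by simp
  have "inv g \<otimes> h = cj (inv k) (inv n \<otimes> m)"
    using n m kl by (simp add: cj_def inv_mult_group m_assoc)
  then show ?thesis using normal_cj[OF N(1)] n m by auto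
qed

text \<open>With trivial intersection the two subgroups would centralise each other.\<close>

lemma normal_Int_nontrivial:
  assumes "M \<lhd> G" "M \<noteq> {\<one>}" "N \<lhd> G" "N \<noteq> {\<one>}" shows "M \<inter> N \<noteq> {\<one>}"
proof
  assume 1: "M \<inter> N = {\<one>}"
  have sub: "M \<subseteq> carrier G" "N \<subseteq> carrier G"
    using assms normal_imp_subgroup subgroup.subset by blast+
  have "m = \<one>" if m: "m \<in> M" for m
  proof (rule centralizer_trivial[OF assms(3,4)])
    fix n assume "n \<in> N"
    then show "cj m n = n"
      using nsub_commute[of M "carrier G" N m n, unfolded nsub_carrier, OF assms(1,3) 1 m]
        m sub cj_fix_iff[of m n] by (simp add: subset_iff)
  qed (use m sub in auto)
  then have "M \<subseteq> {\<one>}" by blast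
  moreover have "\<one> \<in> M" using assms normal_imp_subgroup subgroup.one_closed by blast
  ultimately have "M = {\<one>}" by blast
  then show False using assms(2) by contradiction
qed

lemma ex_unique_minimal_normal: "\<exists>N. unique_minimal_normal N G"
proof -
  obtain x where x: "x \<in> X" using X_ne by auto
  \<comment> \<open>\<open>G\<close> is nontrivial because it moves one out-neighbour of
    \<open>x\<close> to the other.\<close>
  then obtain y z where yz: "D `` {x} = {y, z}" "y \<noteq> z" using out2 by (meson card_2_iff)
  then obtain g where "g \<in> carrier G" "g \<cdot> y = z" using arc_trans[of x y x z] by auto
  moreover have "(x, y) \<in> D" using yz by auto
  then have "y \<in> X" using DX by blast
  ultimately have "carrier G \<noteq> {\<one>}" using yz by auto
  then obtain N where N: "N \<lhd> G" "N \<noteq> {\<one>}" "\<And>L. \<lbrakk>L \<lhd> G; L \<noteq> {\<one>}; L \<subseteq> N\<rbrakk> \<Longrightarrow> L = N"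
    using ex_minimal_nsub[OF subgroup_self _ finG] unfolding nsub_carrier by metis
  have "M = N" if "minimal_normal M G" for M
  proof -
    have M: "M \<lhd> G" "M \<noteq> {\<one>}" "\<And>L. \<lbrakk>L \<lhd> G; L \<noteq> {\<one>}; L \<subseteq> M\<rbrakk> \<Longrightarrow> L = M"
      using that unfolding minimal_normal_def by blast+
    have "M \<inter> N \<lhd> G" using M N nsub_Int unfolding nsub_carrier[symmetric] by blast
    moreover have "M \<inter> N \<noteq> {\<one>}" using M N normal_Int_nontrivial by blast
    ultimately have "M \<inter> N = M" "M \<inter> N = N" using M(3) N(3) by blast+
    then show ?thesis by blast
  qed
  then show ?thesis using N unfolding unique_minimal_normal_def minimal_normal_def by blast
qed

text \<open>Let \<open>M\<close> be minimal among the nontrivial normal subgroups of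
  \<open>N\<close>. Because of the index bound it has at most one further conjugate in
  \<open>G\<close>. The two commute, and their product is normal in \<open>G\<close>, hence all of
  \<open>N\<close>; the other factor centralises \<open>M\<close>, so a normal subgroup of
  \<open>M\<close> is normal in \<open>N\<close>, and \<open>M\<close> is simple. The factorisation
  is stated for every \<open>h\<close> outside \<open>N\<close> so that \<open>h\<close> can later
  be chosen in a vertex stabiliser.\<close>

lemma minimal_normal_structure:
  assumes min: "minimal_normal N G"
  shows "simple_group (G\<lparr>carrier := N\<rparr>) \<or>
    (\<exists>M. simple_group (G\<lparr>carrier := M\<rparr>) \<and> subgroup M G \<and> M \<subseteq> N \<and> \<not> carrier G \<subseteq> N \<and>
      (\<forall>h\<in>carrier G - N. M \<inter> cj h ` M = {\<one>} \<and>
        (\<forall>x\<in>M. \<forall>y\<in>M. x \<otimes> cj h y = cj h y \<otimes> x) \<and> (\<lambda>(x, y). x \<otimes> cj h y) ` (M \<times> M) = N))"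
proof -
  have N: "N \<lhd> G" "N \<noteq> {\<one>}" and Nmin: "\<And>L. \<lbrakk>L \<lhd> G; L \<noteq> {\<one>}; L \<subseteq> N\<rbrakk> \<Longrightarrow> L = N"
    using min unfolding minimal_normal_def by blast+
  interpret N: normal N G by (fact N(1))
  have finN: "finite N" using finG N.subset finite_subset by blast
  obtain M where M: "nsub M N" "M \<noteq> {\<one>}" and Mmin: "\<And>L. \<lbrakk>nsub L N; L \<noteq> {\<one>}; L \<subseteq> M\<rbrakk> \<Longrightarrow> L = M"
    using ex_minimal_nsub[OF N.subgroup_axioms N(2) finN] by metis
  interpret M: subgroup M G using M by (simp add: nsub_def)
  have finM: "finite M" using finN M finite_subset by (auto simp: nsub_def)
  have MN: "M \<subseteq> N" and cjM: "\<And>n m. n \<in> N \<Longrightarrow> m \<in> M \<Longrightarrow> cj n m \<in> M"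
    using M by (auto simp: nsub_def)
  show ?thesis
  proof (cases "M = N")
    case True
    then have "simple_group (G\<lparr>carrier := N\<rparr>)"
      using Mmin N finN N.subgroup_axioms by (intro simple_groupI_nsub) (auto simp: nsub_def)
    then show ?thesis ..
  next
    case False
    then have "\<not> M \<lhd> G" using Nmin M MN by blast
    then obtain g m0 where g: "g \<in> carrier G" and m0: "m0 \<in> M" "cj g m0 \<notin> M"
      using normal_cjI M.subgroup_axioms by blast
    then have gN: "g \<notin> N" using cjM by blast
    have idx: "inv h \<otimes> k \<in> N" if "h \<in> carrier G" "h \<notin> N" "k \<in> carrier G" "k \<notin> N" for h k
      using index_at_most_two[OF N] that by blast
    define M' where "M' = cj g ` M"
    have sM': "subgroup M' G"
    proof
      show "\<one> \<in> M'" unfolding M'_def using g by (intro image_eqI[of _ _ \<one>]) auto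
    qed (use g in \<open>auto simp: M'_def cj_mult[symmetric] cj_inv[symmetric]\<close>)
    have cjM': "cj n x \<in> M'" if n: "n \<in> N" and x: "x \<in> M'" for n x
    proof -
      obtain m where m: "m \<in> M" "x = cj g m" using x by (auto simp: M'_def)
      have "cj (inv g) n \<in> N" using normal_cj N g n by auto
      then have "cj (cj (inv g) n) m \<in> M" using m cjM by auto
      moreover have "cj n x = cj g (cj (cj (inv g) n) m)"
        using m n g cj_def[of "inv g" n] by (simp add: cj_cj)
      ultimately show ?thesis by (auto simp: M'_def)
    qed
    have M'N: "nsub M' N" using sM' cjM' N(1) g MN normal_cj by (auto simp: nsub_def M'_def)
    have MM': "M \<inter> M' = {\<one>}"
    proof (rule ccontr)
      assume "M \<inter> M' \<noteq> {\<one>}"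
      then have "M \<inter> M' = M" using Mmin nsub_Int[OF M(1) M'N] by blast
      then have "M \<subseteq> M'" by blast
      moreover have "card M' \<le> card M" unfolding M'_def using finM card_image_le by blast
      ultimately have "M = M'" using finM by (simp add: card_seteq M'_def)
      then show False using m0 by (auto simp: M'_def)
    qed
    have comm: "x \<otimes> y = y \<otimes> x" if "x \<in> M" "y \<in> M'" for x y
      using nsub_commute[OF M(1) M'N MM'] that by blast
    \<comment> \<open>Both \<open>inv g \<otimes> h\<close> and \<open>h \<otimes> g\<close> lie in
      \<open>N\<close>, so every element outside \<open>N\<close> interchanges \<open>M\<close> and
      \<open>M'\<close>.\<close>
    have cjout: "cj h x \<in> M'" "cj h y \<in> M" if h: "h \<in> carrier G" "h \<notin> N" and x: "x \<in> M" and y: "y \<in> M'" for h x y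
    proof -
      have "inv g \<otimes> h \<in> N" using idx g gN h by blast
      then have "cj (inv g \<otimes> h) x \<in> M" using cjM x by blast
      then have "cj g (cj (inv g \<otimes> h) x) \<in> M'" by (auto simp: M'_def)
      then show "cj h x \<in> M'" using g h x by (simp add: cj_cj)
      obtain z where z: "z \<in> M" "y = cj g z" using y by (auto simp: M'_def)
      have "inv h \<notin> N" using h N.m_inv_closed inv_inv by metis
      then have "h \<otimes> g \<in> N" using idx[of "inv h" g] g gN h by auto
      then have "cj (h \<otimes> g) z \<in> M" using cjM z by blast
      then show "cj h y \<in> M" using z g h by (simp add: cj_cj)
    qed
    have M'G: "M' \<subseteq> carrier G" using sM' subgroup.subset by blast
    define P where "P = {x \<otimes> y | x y. x \<in> M \<and> y \<in> M'}"
    have PI: "x \<otimes> y \<in> P" if "x \<in> M" "y \<in> M'" for x y using that by (auto simp: P_def)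
    have sP: "subgroup P G"
    proof
      show "P \<subseteq> carrier G" using M'G by (auto simp: P_def)
      show "\<one> \<in> P" using PI[of \<one> \<one>] subgroup.one_closed[OF sM'] by simp
      fix u assume "u \<in> P"
      then obtain x y where u: "u = x \<otimes> y" "x \<in> M" "y \<in> M'" by (auto simp: P_def)
      then have yG: "y \<in> carrier G" using M'G by auto
      have "inv y \<in> M'" using u subgroup.m_inv_closed[OF sM'] by simp
      moreover have "inv u = inv y \<otimes> inv x" using u yG by (simp add: inv_mult_group)
      ultimately show "inv u \<in> P" using PI[of "inv x" "inv y"] comm[of "inv x" "inv y"] u by simp
      fix v assume "v \<in> P"
      then obtain x' y' where v: "v = x' \<otimes> y'" "x' \<in> M" "y' \<in> M'" by (auto simp: P_def)
      then have y'G: "y' \<in> carrier G" using M'G by auto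
      have "u \<otimes> v = x \<otimes> (y \<otimes> x') \<otimes> y'" using u v yG y'G by (simp add: m_assoc)
      also have "y \<otimes> x' = x' \<otimes> y" using comm[OF v(2) u(3)] by simp
      finally have "u \<otimes> v = (x \<otimes> x') \<otimes> (y \<otimes> y')" using u v yG y'G by (simp add: m_assoc)
      then show "u \<otimes> v \<in> P" using PI u v subgroup.m_closed[OF sM'] by simp
    qed
    have "P \<lhd> G"
    proof (rule normal_cjI[OF sP])
      fix h u assume h: "h \<in> carrier G" and "u \<in> P"
      then obtain x y where u: "u = x \<otimes> y" "x \<in> M" "y \<in> M'" by (auto simp: P_def)
      then have eq: "cj h u = cj h x \<otimes> cj h y" using h M'G by (auto simp: cj_mult subset_iff)
      show "cj h u \<in> P"
      proof (cases "h \<in> N")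
        case True
        then show ?thesis using eq PI u cjM cjM' by auto
      next
        case False
        then have "cj h x \<in> M'" "cj h y \<in> M" using cjout h u by auto
        then show ?thesis using eq PI comm by metis
      qed
    qed
    moreover have "P \<noteq> {\<one>}"
    proof -
      obtain m where m: "m \<in> M" "m \<noteq> \<one>" using M(2) M.one_closed by blast
      then have "m \<in> P" using PI[of m \<one>] subgroup.one_closed[OF sM'] by simp
      then show ?thesis using m by blast
    qed
    moreover have "P \<subseteq> N" using M'N MN by (auto simp: P_def nsub_def)
    ultimately have PN: "P = N" using Nmin by blast
    have "simple_group (G\<lparr>carrier := M\<rparr>)"
    proof (rule simple_groupI_nsub[OF M.subgroup_axioms M(2) finM])
      fix L assume L: "nsub L M"
      have LM: "L \<subseteq> M" using L by (simp add: nsub_def)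
      have "cj n l \<in> L" if n: "n \<in> N" and l: "l \<in> L" for n l
      proof -
        obtain x y where n: "n = x \<otimes> y" "x \<in> M" "y \<in> M'" using n PN by (auto simp: P_def)
        have lG: "l \<in> carrier G" and yG: "y \<in> carrier G" using l LM n M'G by auto
        have "cj y l = l" using comm[of l y] l LM n cj_fix_iff[of y l] lG yG by auto
        then have "cj n l = cj x l" using n lG yG by (simp add: cj_cj)
        then show ?thesis using L n l by (simp add: nsub_def)
      qed
      then have "nsub L N" using L LM MN by (auto simp: nsub_def)
      then show "L = {\<one>} \<or> L = M" using Mmin LM by blast
    qed
    moreover have "M \<inter> cj h ` M = {\<one>} \<and>
        (\<forall>x\<in>M. \<forall>y\<in>M. x \<otimes> cj h y = cj h y \<otimes> x) \<and> (\<lambda>(x, y). x \<otimes> cj h y) ` (M \<times> M) = N"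
      if h: "h \<in> carrier G" "h \<notin> N" for h
    proof -
      have "M' \<subseteq> cj h ` M"
      proof
        fix y assume "y \<in> M'"
        then obtain z where z: "z \<in> M" "y = cj g z" by (auto simp: M'_def)
        have "inv h \<otimes> g \<in> N" using idx h g gN by blast
        then have "cj (inv h \<otimes> g) z \<in> M" using cjM z by blast
        then have "cj h (cj (inv h \<otimes> g) z) \<in> cj h ` M" by blast
        then show "y \<in> cj h ` M" using z h g by (simp add: cj_cj)
      qed
      then have eq: "cj h ` M = M'" using cjout(1)[OF h _ subgroup.one_closed[OF sM']] by blast
      have "(\<lambda>(x, y). x \<otimes> cj h y) ` (M \<times> M) = {x \<otimes> y | x y. x \<in> M \<and> y \<in> cj h ` M}" by force
      then have "(\<lambda>(x, y). x \<otimes> cj h y) ` (M \<times> M) = N" unfolding eq PN[symmetric] P_def .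
      moreover have "x \<otimes> cj h y = cj h y \<otimes> x" if "x \<in> M" "y \<in> M" for x y
        using comm that eq by blast
      ultimately show ?thesis using eq MM' by blast
    qed
    moreover have "\<not> carrier G \<subseteq> N" using g gN by blast
    ultimately have "simple_group (G\<lparr>carrier := M\<rparr>) \<and> subgroup M G \<and> M \<subseteq> N \<and> \<not> carrier G \<subseteq> N \<and>
      (\<forall>h\<in>carrier G - N. M \<inter> cj h ` M = {\<one>} \<and>
        (\<forall>x\<in>M. \<forall>y\<in>M. x \<otimes> cj h y = cj h y \<otimes> x) \<and> (\<lambda>(x, y). x \<otimes> cj h y) ` (M \<times> M) = N)"
      using M.subgroup_axioms MN by simp
    then show ?thesis by (intro disjI2 exI[of _ M])
  qed
qed

end

section \<open>The Twisted Wreath Construction\<close>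

lemma iso_direct_power_1: "(\<lambda>x. \<lambda>i\<in>{..<1}. x) \<in> iso T (direct_power T 1)"
proof -
  have "bij_betw (\<lambda>x. \<lambda>i\<in>{..<1 :: nat}. x) (carrier T) (\<Pi>\<^sub>E i\<in>{..<1 :: nat}. carrier T)"
    by (rule bij_betwI[where g = "\<lambda>f. f 0"]) (auto simp: PiE_def extensional_def fun_eq_iff)
  then show ?thesis
    by (auto simp: iso_def hom_def direct_power_def fun_eq_iff)
qed

lemma iso_direct_power_2:
  "(\<lambda>(x, y). \<lambda>i\<in>{..<2}. if i = 0 then x else y) \<in> iso (T \<times>\<times> T) (direct_power T 2)"
proof -
  have lt2: "i < 2 \<longleftrightarrow> i = 0 \<or> i = 1" for i :: nat by auto
  have "bij_betw (\<lambda>(x, y). \<lambda>i\<in>{..<2 :: nat}. if i = 0 then x else y)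
      (carrier T \<times> carrier T) (\<Pi>\<^sub>E i\<in>{..<2 :: nat}. carrier T)"
    by (rule bij_betwI[where g = "\<lambda>f. (f 0, f 1)"])
      (auto simp: PiE_def extensional_def fun_eq_iff Pi_def lt2 split: if_splits)
  then show ?thesis
    by (auto simp: iso_def hom_def direct_power_def restrict_def PiE_iff extensional_def fun_eq_iff
        split: if_splits)
qed

text \<open>\<open>N\<close> as the internal direct product of \<open>M\<close> and its conjugate
  under \<open>s\<close>. The map \<open>phi\<close> below uses \<open>s\<close> to identify the
  second factor with \<open>M\<close>, so that for an involution \<open>s\<close> conjugation
  becomes the coordinate swap.\<close>

locale conj_factors = group G for G (structure) +
  fixes M N :: "'a set" and s :: 'a
  assumes M_sub: "subgroup M G" and s_carrier [simp]: "s \<in> carrier G"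
    and M_Int: "M \<inter> cj s ` M = {\<one>}"
    and M_comm: "\<lbrakk>x \<in> M; y \<in> M\<rbrakk> \<Longrightarrow> x \<otimes> cj s y = cj s y \<otimes> x"
    and M_img: "(\<lambda>(x, y). x \<otimes> cj s y) ` (M \<times> M) = N"
begin

definition T where "T = G\<lparr>carrier := M\<rparr>"

definition phi :: "'a \<times> 'a \<Rightarrow> 'a" where "phi = (\<lambda>(x, y). x \<otimes> cj s y)"

lemma T_simps [simp]: "carrier T = M" "monoid.mult T = monoid.mult G" "one T = one G"
  by (simp_all add: T_def)

lemma T_group: "group T"
  unfolding T_def by (rule subgroup_imp_group[OF M_sub])

lemma TT_group: "group (T \<times>\<times> T)"
  by (rule DirProd_group[OF T_group T_group])

lemma M_carrier [simp]: "x \<in> M \<Longrightarrow> x \<in> carrier G"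
  using subgroup.mem_carrier[OF M_sub] .

lemma M_closed [simp]: "\<one> \<in> M" "\<lbrakk>x \<in> M; y \<in> M\<rbrakk> \<Longrightarrow> x \<otimes> y \<in> M" "x \<in> M \<Longrightarrow> inv x \<in> M"
  using subgroup.one_closed[OF M_sub] subgroup.m_closed[OF M_sub]
    subgroup.m_inv_closed[OF M_sub] by auto

lemma T_inv [simp]: "x \<in> M \<Longrightarrow> inv\<^bsub>T\<^esub> x = inv x"
  unfolding T_def by (rule m_inv_consistent[OF M_sub])

lemma phi_hom: "phi \<in> hom (T \<times>\<times> T) G"
proof (rule homI)
  fix p q assume "p \<in> carrier (T \<times>\<times> T)" "q \<in> carrier (T \<times>\<times> T)"
  then obtain x y x' y' where pq: "p = (x, y)" "q = (x', y')" "x \<in> M" "y \<in> M" "x' \<in> M" "y' \<in> M"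
    by auto
  have "(x \<otimes> x') \<otimes> (cj s y \<otimes> cj s y') = x \<otimes> (x' \<otimes> cj s y) \<otimes> cj s y'"
    using pq by (simp add: m_assoc)
  also have "x' \<otimes> cj s y = cj s y \<otimes> x'" using pq M_comm by simp
  also have "x \<otimes> (cj s y \<otimes> x') \<otimes> cj s y' = (x \<otimes> cj s y) \<otimes> (x' \<otimes> cj s y')"
    using pq by (simp add: m_assoc)
  finally show "phi (p \<otimes>\<^bsub>T \<times>\<times> T\<^esub> q) = phi p \<otimes> phi q"
    using pq by (simp add: phi_def cj_mult)
qed (auto simp: phi_def)

sublocale phi: group_hom "T \<times>\<times> T" G phi
  using TT_group phi_hom is_group by (simp add: group_hom_def group_hom_axioms_def)

lemma phi_inj: "inj_on phi (M \<times> M)"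
proof -
  have "kernel (T \<times>\<times> T) G phi = {\<one>\<^bsub>T \<times>\<times> T\<^esub>}"
  proof -
    have "x = \<one> \<and> y = \<one>" if "x \<in> M" "y \<in> M" "x \<otimes> cj s y = \<one>" for x y
    proof -
      have "x = inv (cj s y)" using that by (metis M_carrier cj_closed inv_equality s_carrier inv_inv inv_closed)
      then have eq: "x = cj s (inv y)" using that by (simp add: cj_inv)
      then have "x \<in> M \<inter> cj s ` M" using that M_closed(3) by blast
      then have "x = \<one>" unfolding M_Int by simp
      moreover from this have "inv y = \<one>" using eq that cj_inj[of s "inv y" \<one>] by simp
      ultimately show ?thesis using that by (metis M_carrier inv_inv inv_one)
    qed
    then show ?thesis by (auto simp: kernel_def phi_def)
  qed
  then show ?thesis using phi.trivial_ker_imp_inj by simp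
qed

lemma phi_img: "phi ` (M \<times> M) = N"
  using M_img by (simp add: phi_def)

lemma phi_iso: "phi \<in> iso (T \<times>\<times> T) (G\<lparr>carrier := N\<rparr>)"
proof -
  have "bij_betw phi (M \<times> M) N" using phi_inj phi_img by (simp add: bij_betw_def)
  then show ?thesis
    using phi_hom phi_img by (auto simp: iso_def hom_def)
qed

lemma iso_direct_power: "G\<lparr>carrier := N\<rparr> \<cong> direct_power T 2"
  using TT_group phi_iso iso_direct_power_2[of T]
  by (meson group.iso_sym is_isoI iso_trans)

lemma phi_eq_iff: "\<lbrakk>p \<in> M \<times> M; q \<in> M \<times> M\<rbrakk> \<Longrightarrow> phi p = phi q \<longleftrightarrow> p = q"
  using phi_inj by (auto simp: inj_on_def)

lemma phi_closed [simp]: "p \<in> M \<times> M \<Longrightarrow> phi p \<in> carrier G"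
  using phi.hom_closed by simp

lemma phi_N: "p \<in> M \<times> M \<Longrightarrow> phi p \<in> N"
  using phi_img by blast

lemma N_eq_phi: "n \<in> N \<Longrightarrow> \<exists>p\<in>M \<times> M. n = phi p"
  using phi_img by blast

lemma cj_phi_swap:
  assumes "s \<otimes> s = \<one>" "p \<in> M \<times> M" shows "cj s (phi p) = phi (prod.swap p)"
proof -
  obtain x y where p: "p = (x, y)" "x \<in> M" "y \<in> M" using assms by auto
  have "cj s (cj s y) = y" using p assms(1) cj_cj[of s s y] by simp
  then show ?thesis using p M_comm[of y x] by (simp add: phi_def cj_mult)
qed

text \<open>If \<open>a1\<close> and \<open>a2\<close> generate \<open>K\<close>, then
  \<open>K \<times> K\<close> already contains both generators of \<open>N\<close>, so
  \<open>K\<close> is \<open>M\<close>. An automorphism interchanging them would put both generators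
  into its graph, a subgroup that contains \<open>(m, \<one>)\<close> only for trivial
  \<open>m\<close>.\<close>

lemma tw_generators_phi:
  assumes p: "a1 \<in> M" "a2 \<in> M" and gen: "generate G {phi (a1, a2), phi (a2, a1)} = N"
    and M1: "M \<noteq> {\<one>}"
  shows "tw_generators T a1 a2"
proof -
  interpret T: group T by (rule T_group)
  have N_least: "N \<subseteq> H" if "subgroup H G" "phi (a1, a2) \<in> H" "phi (a2, a1) \<in> H" for H
    using generate_subgroup_incl[OF _ that(1), of "{phi (a1, a2), phi (a2, a1)}"] that gen by auto
  define K where "K = generate T {a1, a2}"
  have K: "subgroup K T" unfolding K_def using p by (intro T.generate_is_subgroup) auto
  have aK: "a1 \<in> K" "a2 \<in> K" unfolding K_def by (auto intro: generate.incl)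
  have KM: "K \<subseteq> M" using subgroup.subset[OF K] by simp
  have "subgroup (phi ` (K \<times> K)) G"
    using phi.subgroup_img_is_subgroup[OF DirProd_subgroups[OF T_group K T_group K]] .
  then have NK: "N \<subseteq> phi ` (K \<times> K)" using N_least aK by blast
  have "M \<subseteq> K"
  proof
    fix m assume m: "m \<in> M"
    then have "phi (m, \<one>) \<in> phi ` (K \<times> K)" using NK phi_N[of "(m, \<one>)"] by auto
    then obtain k l where "k \<in> K" "l \<in> K" "phi (m, \<one>) = phi (k, l)" by auto
    then show "m \<in> K" using phi_eq_iff[of "(m, \<one>)" "(k, l)"] m KM by auto
  qed
  then have "generate T {a1, a2} = carrier T" using KM K_def by auto
  moreover have False if th: "\<theta> \<in> iso T T" "\<theta> a1 = a2" "\<theta> a2 = a1" for \<theta>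
  proof -
    have thM: "\<theta> m \<in> M" if "m \<in> M" for m using th that by (auto simp: iso_def hom_def)
    have "(\<lambda>m. (m, \<theta> m)) \<in> hom T (T \<times>\<times> T)"
      using th thM by (auto simp: iso_def hom_def)
    then have "(\<lambda>m. phi (m, \<theta> m)) \<in> hom T G"
      using Group.hom_compose[OF _ phi_hom] by (simp add: comp_def)
    then interpret h: group_hom T G "\<lambda>m. phi (m, \<theta> m)"
      using T_group is_group by (simp add: group_hom_def group_hom_axioms_def)
    have "subgroup ((\<lambda>m. phi (m, \<theta> m)) ` M) G" using h.img_is_subgroup by simp
    moreover have "phi (a1, a2) \<in> (\<lambda>m. phi (m, \<theta> m)) ` M"
      "phi (a2, a1) \<in> (\<lambda>m. phi (m, \<theta> m)) ` M"
      using p th by (auto intro: image_eqI[of _ _ a1] image_eqI[of _ _ a2])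
    ultimately have NT: "N \<subseteq> (\<lambda>m. phi (m, \<theta> m)) ` M" using N_least by blast
    obtain m where m: "m \<in> M" "m \<noteq> \<one>" using M1 M_closed(1) by blast
    then have "phi (m, \<one>) \<in> (\<lambda>m. phi (m, \<theta> m)) ` M" using NT phi_N[of "(m, \<one>)"] by auto
    then obtain l where l: "l \<in> M" "phi (m, \<one>) = phi (l, \<theta> l)" by auto
    then have "m = l" "\<theta> l = \<one>" using phi_eq_iff[of "(m, \<one>)" "(l, \<theta> l)"] m thM by auto
    moreover have "\<theta> \<one> = \<one>" using th T_group hom_one[of \<theta> T T] by (simp add: iso_def)
    moreover have "inj_on \<theta> M" using th by (simp add: iso_def bij_betw_def)
    ultimately show False using m by (metis M_closed(1) inj_onD)
  qed
  ultimately show ?thesis using p by (auto simp: tw_generators_def)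
qed

end

section \<open>From a regular product to the Cayley graph\<close>

context qp_digraph
begin

lemma card_rcosets_two:
  assumes N: "N \<lhd> G" "N \<noteq> {\<one>}" and s: "s \<in> carrier G" "s \<notin> N"
  shows "card (rcosets N) = 2"
proof -
  interpret N: normal N G by (fact N(1))
  have "N #> g \<in> {N, N #> s}" if g: "g \<in> carrier G" for g
  proof (cases "g \<in> N")
    case True
    then show ?thesis using g coset_join2 N.subgroup_axioms by auto
  next
    case False
    then have "inv g \<notin> N" "inv s \<notin> N" using s g N.m_inv_closed inv_inv by metis+
    then have "g \<otimes> inv s \<in> N" using index_at_most_two[OF N, of "inv g" "inv s"] s g by simp
    moreover have "g = (g \<otimes> inv s) \<otimes> s" using s g by (simp add: m_assoc)
    ultimately have "g \<in> N #> s" unfolding r_coset_def by blast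
    then show ?thesis using repr_independence s N.subgroup_axioms by blast
  qed
  moreover have "N #> \<one> = N" using N.subset by simp
  moreover have "s \<in> N #> s" using rcos_self s N.subgroup_axioms by blast
  ultimately have "rcosets N = {N, N #> s}" "N \<noteq> N #> s"
    unfolding RCOSETS_def using s by (blast, blast)
  then show ?thesis by simp
qed

text \<open>The stabiliser element \<sigma> interchanging \<open>a\<close> and \<open>b\<close> is
  an involution, because its square lies in \<open>N\<close> and fixes \<open>x\<close>. Splitting
  \<open>N\<close> along \<sigma> turns conjugation by \<sigma> into the swap, which forces
  \<open>b\<close> to be \<open>a\<close> with its coordinates exchanged. The last two conjuncts are
  \<open>transport\<close> unfolded.\<close>

lemma twisted_wreath_of_regular:
  assumes N: "N \<lhd> G" "N \<noteq> {\<one>}"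
    and sr: "\<And>n x. \<lbrakk>n \<in> N; x \<in> X; n \<cdot> x = x\<rbrakk> \<Longrightarrow> n = \<one>"
    and M: "subgroup M G" "M \<noteq> {\<one>}"
    and fac: "\<And>h. h \<in> carrier G - N \<Longrightarrow> conj_factors G M N h"
  defines "T \<equiv> G\<lparr>carrier := M\<rparr>"
  shows "card (rcosets N) = 2 \<and> (\<exists>a b f. tw_generators T a b \<and> bij_betw f X (M \<times> M) \<and>
    (\<forall>x\<in>X. \<forall>y\<in>X. (x, y) \<in> D \<union> D\<inverse> \<longleftrightarrow> (f x, f y) \<in> parcs (tw_graph T a b)) \<and>
    (\<lambda>g. \<lambda>p\<in>M \<times> M. f (g \<cdot> inv_into X f p)) ` N = right_mults (T \<times>\<times> T) \<and>
    (\<lambda>g. \<lambda>p\<in>M \<times> M. f (g \<cdot> inv_into X f p)) ` carrier G = tw_group T)"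
proof -
  interpret N: normal N G by (fact N(1))
  obtain x where x: "x \<in> X" using X_ne by auto
  obtain a b \<sigma> where ab: "a \<in> N" "b \<in> N" "a \<noteq> b" "generate G {a, b} = N"
    and abD: "(x, a \<cdot> x) \<in> D" "(x, b \<cdot> x) \<in> D"
    and s: "\<sigma> \<in> carrier G" "\<sigma> \<cdot> x = x" "cj \<sigma> a = b" "cj \<sigma> b = a"
    using vertex_generators[OF N x sr[OF _ x]] by metis
  have sN: "\<sigma> \<notin> N"
  proof
    assume "\<sigma> \<in> N"
    then have "\<sigma> = \<one>" using sr x s(2) by blast
    then show False using s(3) ab by simp
  qed
  then have "inv \<sigma> \<notin> N" using s N.m_inv_closed inv_inv by metis
  then have "\<sigma> \<otimes> \<sigma> \<in> N" using index_at_most_two[OF N, of "inv \<sigma>" \<sigma>] s sN by simp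
  then have ss: "\<sigma> \<otimes> \<sigma> = \<one>" using sr[OF _ x] s x by simp
  interpret F: conj_factors G M N \<sigma> using fac s sN by blast
  have T: "T = F.T" by (simp add: T_def F.T_def)
  have sx: "inv \<sigma> \<cdot> x = x" using s x act_inv(1)[of \<sigma> x] by simp
  obtain a1 a2 where a: "a1 \<in> M" "a2 \<in> M" "a = F.phi (a1, a2)" using F.N_eq_phi[OF ab(1)] by auto
  have b: "b = F.phi (a2, a1)" using F.cj_phi_swap[OF ss, of "(a1, a2)"] a s by simp
  have gen: "tw_generators T a1 a2"
    unfolding T using F.tw_generators_phi[OF a(1,2) _ M(2)] ab(4) a b by simp
  \<comment> \<open>The inverse turns the left action into right multiplications.\<close>
  define e where "e p = inv (F.phi p) \<cdot> x" for p
  have NX: "n = m" if "n \<in> N" "m \<in> N" "n \<cdot> x = m \<cdot> x" for n m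
  proof -
    have "(inv m \<otimes> n) \<cdot> x = x" using that x by simp
    moreover have "inv m \<otimes> n \<in> N" using that by simp
    ultimately have "inv m \<otimes> n = \<one>" using sr x by blast
    then show ?thesis using inv_mult_eq_one[of m n] that by simp
  qed
  have eX: "e p \<in> X" if "p \<in> M \<times> M" for p using that x by (simp add: e_def)
  have e_bij: "bij_betw e (M \<times> M) X"
  proof (rule bij_betw_imageI)
    show "inj_on e (M \<times> M)"
    proof (rule inj_onI)
      fix p q assume pq: "p \<in> M \<times> M" "q \<in> M \<times> M" "e p = e q"
      then have "inv (F.phi p) = inv (F.phi q)" 
        using NX[of "inv (F.phi p)" "inv (F.phi q)"] F.phi_N by (simp add: e_def)
      then show "p = q" using pq F.phi_eq_iff F.phi_closed by (metis inv_inv)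
    qed
    show "e ` (M \<times> M) = X"
    proof (intro equalityI subsetI)
      fix y assume "y \<in> X"
      then obtain n where n: "n \<in> N" "n \<cdot> x = y" using qp[OF N x] by blast
      obtain p where p: "p \<in> M \<times> M" "inv n = F.phi p" using F.N_eq_phi[of "inv n"] n by auto
      then have "e p = y" using n by (simp add: e_def flip: p(2))
      then show "y \<in> e ` (M \<times> M)" using p by blast
    qed (use eX in auto)
  qed
  define f where "f = inv_into (M \<times> M) e"
  have fe: "f (e p) = p" if "p \<in> M \<times> M" for p
    unfolding f_def using that e_bij by (simp add: bij_betw_def)
  have f_bij: "bij_betw f X (M \<times> M)" unfolding f_def using e_bij by (rule bij_betw_inv_into)
  have ef: "e (f y) = y" if "y \<in> X" for y
    unfolding f_def using that e_bij by (simp add: bij_betw_def f_inv_into_f)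
  have fX: "f y \<in> M \<times> M" if "y \<in> X" for y using f_bij that by (auto simp: bij_betw_def)
  have inv_f: "inv_into X f p = e p" if "p \<in> M \<times> M" for p
    using that fe eX f_bij by (intro inv_into_f_eq) (auto simp: bij_betw_def)
  let ?P = "T \<times>\<times> T"
  interpret P: group ?P using F.TT_group T by simp
  have P_simps: "carrier ?P = M \<times> M" by (simp add: T_def)
  note P_m = P.m_closed[unfolded P_simps] and P_i = P.inv_closed[unfolded P_simps]
  have phi_mult: "F.phi (p \<otimes>\<^bsub>?P\<^esub> q) = F.phi p \<otimes> F.phi q" if "p \<in> M \<times> M" "q \<in> M \<times> M" for p q
    using that F.phi.hom_mult[of p q] by (simp add: T)
  have phi_inv: "F.phi (inv\<^bsub>?P\<^esub> p) = inv (F.phi p)" if "p \<in> M \<times> M" for p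
    using that F.phi.hom_inv[of p] by (simp add: T)
  note P_closed = P_m P_i
  have act_phi: "F.phi r \<cdot> e p = e (p \<otimes>\<^bsub>?P\<^esub> inv\<^bsub>?P\<^esub> r)" if "p \<in> M \<times> M" "r \<in> M \<times> M" for p r
    using that x P_closed by (simp add: e_def phi_mult phi_inv inv_mult_group)
  have act_s: "\<sigma> \<cdot> e p = e (prod.swap p)" if p: "p \<in> M \<times> M" for p
  proof -
    have "e (prod.swap p) = cj \<sigma> (inv (F.phi p)) \<cdot> x"
      using p s by (simp add: e_def cj_inv F.cj_phi_swap[OF ss])
    also have "\<dots> = \<sigma> \<cdot> e p" using p s sx x by (simp add: cj_def e_def)
    finally show ?thesis by simp
  qed
  have Dx: "(x, n \<cdot> x) \<in> D \<longleftrightarrow> n = a \<or> n = b" if n: "n \<in> N" for n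
  proof
    assume "(x, n \<cdot> x) \<in> D"
    moreover have "a \<cdot> x \<noteq> b \<cdot> x" using NX ab by blast
    ultimately have "n \<cdot> x = a \<cdot> x \<or> n \<cdot> x = b \<cdot> x" using out_obtain[OF x abD] by blast
    then show "n = a \<or> n = b" using NX ab n by blast
  qed (use abD in auto)
  \<comment> \<open>Moving the pair by \<open>F.phi p\<close> puts its first vertex at
    \<open>x\<close> and its second at the image of \<open>x\<close> under \<open>p\<close> times
    the inverse of \<open>q\<close>.\<close>
  have De: "(e p, e q) \<in> D \<longleftrightarrow> p \<otimes>\<^bsub>?P\<^esub> inv\<^bsub>?P\<^esub> q \<in> {(a1, a2), (a2, a1)}"
    if p: "p \<in> M \<times> M" and q: "q \<in> M \<times> M" for p q
  proof -
    let ?r = "p \<otimes>\<^bsub>?P\<^esub> inv\<^bsub>?P\<^esub> q"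
    have r: "?r \<in> M \<times> M" using P_m[OF p P_i[OF q]] .
    have "F.phi p \<cdot> e p = x" "F.phi p \<cdot> e q = F.phi ?r \<cdot> x"
      using p q x P_closed by (simp_all add: e_def phi_mult phi_inv)
    then have "(e p, e q) \<in> D \<longleftrightarrow> (x, F.phi ?r \<cdot> x) \<in> D"
      using D_inv_iff[of "F.phi p" "e p" "e q"] p q eX by simp
    also have "\<dots> \<longleftrightarrow> F.phi ?r = a \<or> F.phi ?r = b" by (rule Dx[OF F.phi_N[OF r]])
    also have "\<dots> \<longleftrightarrow> ?r \<in> {(a1, a2), (a2, a1)}"
      unfolding a(3) b using F.phi_eq_iff[OF r, of "(a1, a2)"] F.phi_eq_iff[OF r, of "(a2, a1)"] a(1,2) by simp
    finally show ?thesis .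
  qed
  have inv_swap: "p \<otimes>\<^bsub>?P\<^esub> inv\<^bsub>?P\<^esub> q = inv\<^bsub>?P\<^esub> (q \<otimes>\<^bsub>?P\<^esub> inv\<^bsub>?P\<^esub> p)"
    if "p \<in> M \<times> M" "q \<in> M \<times> M" for p q
    using that[folded P_simps] by (simp add: P.inv_mult_group del: carrier_DirProd)
  have arcs: "(y, z) \<in> D \<union> D\<inverse> \<longleftrightarrow> (f y, f z) \<in> parcs (tw_graph T a1 a2)"
    if yz: "y \<in> X" "z \<in> X" for y z
  proof -
    obtain p q where pq: "p \<in> M \<times> M" "q \<in> M \<times> M" "y = e p" "z = e q"
      using fX[OF yz(1)] fX[OF yz(2)] ef[OF yz(1)] ef[OF yz(2)] by metis
    let ?S = "{(a1, a2), (a2, a1)}" and ?r = "p \<otimes>\<^bsub>?P\<^esub> inv\<^bsub>?P\<^esub> q"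
    have r: "?r \<in> M \<times> M" using P_m[OF pq(1) P_i[OF pq(2)]] .
    have "inv\<^bsub>?P\<^esub> ?r \<in> ?S \<longleftrightarrow> ?r \<in> (\<lambda>s. inv\<^bsub>?P\<^esub> s) ` ?S"
    proof
      assume "inv\<^bsub>?P\<^esub> ?r \<in> ?S"
      then have "inv\<^bsub>?P\<^esub> (inv\<^bsub>?P\<^esub> ?r) \<in> (\<lambda>s. inv\<^bsub>?P\<^esub> s) ` ?S" by (rule imageI)
      then show "?r \<in> (\<lambda>s. inv\<^bsub>?P\<^esub> s) ` ?S" using r P.inv_inv P_simps by metis
    next
      assume "?r \<in> (\<lambda>s. inv\<^bsub>?P\<^esub> s) ` ?S"
      then obtain t where t: "t \<in> ?S" "?r = inv\<^bsub>?P\<^esub> t" by blast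
      then have "t \<in> carrier ?P" using a P_simps by auto
      then show "inv\<^bsub>?P\<^esub> ?r \<in> ?S" using t P.inv_inv by metis
    qed
    then have "(y, z) \<in> D \<union> D\<inverse> \<longleftrightarrow> ?r \<in> ?S \<union> (\<lambda>s. inv\<^bsub>?P\<^esub> s) ` ?S"
      using De[OF pq(1,2)] De[OF pq(2,1)] inv_swap[OF pq(2,1)] pq by auto
    then show ?thesis using pq fe P_simps
      by (simp add: tw_graph_def cayley_graph_def tw_connection_set_def Let_def)
  qed
  define t where "t g = (\<lambda>p\<in>M \<times> M. f (g \<cdot> inv_into X f p))" for g
  have t_eq: "t g = (\<lambda>p\<in>M \<times> M. f (g \<cdot> e p))" for g
    unfolding t_def using inv_f by (intro restrict_ext) simp
  let ?B = "BijGroup (M \<times> M)"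
  have t_Bij: "t g \<in> Bij (M \<times> M)" if g: "g \<in> carrier G" for g
  proof -
    have "bij_betw (t g) (M \<times> M) (M \<times> M)"
      by (rule bij_betwI[where g = "t (inv g)"])
        (use g in \<open>auto simp: t_eq fX eX ef fe simp del: mem_Sigma_iff\<close>)
    then show ?thesis by (simp add: Bij_def t_def)
  qed
  have "t \<in> hom G ?B"
  proof (rule homI)
    fix g h assume gh: "g \<in> carrier G" "h \<in> carrier G"
    have "t (g \<otimes> h) = compose (M \<times> M) (t g) (t h)"
      using gh eX fX ef by (auto simp: t_eq compose_def fun_eq_iff simp del: mem_Sigma_iff)
    then show "t (g \<otimes> h) = t g \<otimes>\<^bsub>?B\<^esub> t h" using t_Bij gh by (simp add: BijGroup_def)
  qed (use t_Bij in \<open>simp add: BijGroup_def\<close>)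
  then interpret t: group_hom G ?B t
    using is_group group_BijGroup by (simp add: group_hom_def group_hom_axioms_def)
  have t_phi: "t (F.phi r) = (\<lambda>p\<in>M \<times> M. p \<otimes>\<^bsub>?P\<^esub> inv\<^bsub>?P\<^esub> r)" if "r \<in> M \<times> M" for r
    unfolding t_eq using that act_phi fe P_closed by (intro restrict_ext) simp
  have t_s: "t \<sigma> = (\<lambda>p\<in>M \<times> M. prod.swap p)"
    unfolding t_eq using act_s fe by (intro restrict_ext) auto
  have tN: "t ` N = right_mults ?P"
  proof (intro equalityI subsetI)
    fix u assume "u \<in> t ` N"
    then obtain r where "r \<in> M \<times> M" "u = t (F.phi r)" using F.N_eq_phi by blast
    then show "u \<in> right_mults ?P"
      unfolding right_mults_def P_simps using t_phi P_closed by blast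
  next
    fix u assume "u \<in> right_mults ?P"
    then obtain r where r: "r \<in> M \<times> M" "u = (\<lambda>p\<in>M \<times> M. p \<otimes>\<^bsub>?P\<^esub> r)"
      unfolding right_mults_def P_simps by blast
    have "t (F.phi (inv\<^bsub>?P\<^esub> r)) = u"
      unfolding t_phi[OF P_i[OF r(1)]] r(2) P.inv_inv[unfolded P_simps, OF r(1)] ..
    moreover have "F.phi (inv\<^bsub>?P\<^esub> r) \<in> N" by (rule F.phi_N[OF P_i[OF r(1)]])
    ultimately show "u \<in> t ` N" by (metis imageI)
  qed
  \<comment> \<open>By the index bound \<open>g \<otimes> \<sigma>\<close> lies in \<open>N\<close>
    for \<open>g\<close> outside \<open>N\<close>. Under \<open>t\<close> the generators become the
    right multiplications and the swap, which are those of \<open>tw_group\<close>.\<close>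
  have "carrier G \<subseteq> generate G (N \<union> {\<sigma>})"
  proof
    fix g assume g: "g \<in> carrier G"
    show "g \<in> generate G (N \<union> {\<sigma>})"
    proof (cases "g \<in> N")
      case False
      then have "inv g \<notin> N" using g N.m_inv_closed inv_inv by metis
      then have "g \<otimes> \<sigma> \<in> N" using index_at_most_two[OF N, of "inv g" \<sigma>] s sN g by simp
      then have "(g \<otimes> \<sigma>) \<otimes> \<sigma> \<in> generate G (N \<union> {\<sigma>})"
        by (intro generate.eng generate.incl) auto
      then show ?thesis using g s ss by (simp add: m_assoc)
    qed (auto intro: generate.incl)
  qed
  moreover have "N \<union> {\<sigma>} \<subseteq> carrier G" using s by auto
  ultimately have "generate G (N \<union> {\<sigma>}) = carrier G" using generate_incl by blast
  then have "t ` carrier G = generate ?B (t ` (N \<union> {\<sigma>}))"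
    using t.generate_img[of "N \<union> {\<sigma>}"] s N.subset by auto
  also have "\<dots> = tw_group T"
    unfolding tw_group_def image_Un tN P_simps using t_s by simp
  finally have "t ` carrier G = tw_group T" .
  moreover have "card (rcosets N) = 2" by (rule card_rcosets_two[OF N s(1) sN])
  ultimately show ?thesis using gen f_bij arcs tN unfolding t_def by blast
qed

end

section \<open>Basic pairs of quasiprimitive type\<close>

lemma perm_group_carrier [simp]: "carrier (perm_group X G) = G"
  by (simp add: perm_group_def)

lemma perm_group_one [simp]: "\<one>\<^bsub>perm_group X G\<^esub> = (\<lambda>x\<in>X. x)"
  by (simp add: perm_group_def BijGroup_def)

lemma perm_group_mult:
  "\<lbrakk>G \<subseteq> Bij X; g \<in> G; h \<in> G\<rbrakk> \<Longrightarrow> g \<otimes>\<^bsub>perm_group X G\<^esub> h = compose X g h"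
  by (auto simp: perm_group_def BijGroup_def)

lemma perm_group_carrier_update: "(perm_group X G)\<lparr>carrier := N\<rparr> = perm_group X N"
  by (simp add: perm_group_def)

lemma perm_group_is_group: "subgroup G (BijGroup X) \<Longrightarrow> group (perm_group X G)"
  unfolding perm_group_def by (rule group.subgroup_imp_group[OF group_BijGroup])

lemma subgroup_Bij: "subgroup G (BijGroup X) \<Longrightarrow> G \<subseteq> Bij X"
  using subgroup.subset[of G "BijGroup X"] by (simp add: BijGroup_def)

lemma finite_Bij: "finite X \<Longrightarrow> finite (Bij X)"
  using finite_PiE[of X "\<lambda>_. X"] by (rule finite_subset[rotated])
    (auto simp: Bij_def PiE_def bij_betw_def)

lemma transitive_on_iff:
  assumes "subgroup G (BijGroup X)"
  shows "transitive_on X G \<longleftrightarrow> (\<forall>x\<in>X. \<forall>y\<in>X. \<exists>g\<in>G. g x = y)"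
proof -
  have "group_hom (perm_group X G) (BijGroup X) (\<lambda>g. g)"
    unfolding group_hom_def group_hom_axioms_def
    using perm_group_is_group[OF assms] group_BijGroup subgroup.subset[OF assms]
    by (auto simp: hom_def perm_group_def)
  then show ?thesis
    by (simp add: transitive_on_def transitive_action_def transitive_action_axioms_def
        group_action_def Ball_def)
qed

text \<open>Counts the arcs once by their tails and once by their heads.\<close>

lemma regular_digraph_degrees_eq:
  assumes "finite X" "X \<noteq> {}" "D \<subseteq> X \<times> X"
    and "\<And>x. x \<in> X \<Longrightarrow> card (D `` {x}) = p" "\<And>x. x \<in> X \<Longrightarrow> card (D\<inverse> `` {x}) = q"
  shows "p = q"
proof -
  have card_eq: "card E = card X * r"
    if "E \<subseteq> X \<times> X" "\<And>x. x \<in> X \<Longrightarrow> card (E `` {x}) = r" for E :: "('a \<times> 'a) set" and r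
  proof -
    have "E = Sigma X (\<lambda>x. E `` {x})" using that(1) by auto
    moreover have "card (Sigma X (\<lambda>x. E `` {x})) = (\<Sum>x\<in>X. card (E `` {x}))"
      using that(1) assms(1) by (intro card_SigmaI) (auto intro: finite_subset[OF _ assms(1)])
    ultimately show ?thesis using that(2) by simp
  qed
  have "D\<inverse> \<subseteq> X \<times> X" using assms(3) by auto
  then have "card X * p = card X * q"
    using card_eq[of D p] card_eq[of "D\<inverse>" q] assms card_inverse[of D] by simp
  then show ?thesis using assms(1,2) by simp
qed

text \<open>Vertex-transitivity makes the out- and in-valencies constant, hence equal; they add up
  to 4 since the orientation and its converse are disjoint. Connectedness becomes strong
  connectedness because each arc can be reversed by a directed walk.\<close>

lemma qp_digraph_of_basic:
  assumes "basic_quasiprimitive \<Gamma> G"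
  obtains \<Delta> where "qp_digraph (perm_group (pverts \<Gamma>) G) (pverts \<Gamma>) (\<lambda>g. g) \<Delta>"
    "parcs \<Gamma> = \<Delta> \<union> \<Delta>\<inverse>" "subgroup G (BijGroup (pverts \<Gamma>))"
proof -
  define X where "X = pverts \<Gamma>"
  define P where "P = perm_group X G"
  have \<Gamma>: "pair_graph \<Gamma>" and con: "connected (with_proj \<Gamma>)"
    and deg: "\<And>x. x \<in> X \<Longrightarrow> out_degree (with_proj \<Gamma>) x = 4"
    and sub: "subgroup G (BijGroup X)" and tr: "transitive_on X G" and ori: "oriented_by \<Gamma> G"
    and qp: "quasiprimitive_on X G"
    using assms unfolding basic_quasiprimitive_def OG4_def X_def by auto
  interpret \<Gamma>: pair_graph \<Gamma> by (fact \<Gamma>)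
  interpret P: group P unfolding P_def by (rule perm_group_is_group[OF sub])
  have finX: "finite X" unfolding X_def by (rule \<Gamma>.pair_finite_verts)
  have GB: "G \<subseteq> Bij X" by (rule subgroup_Bij[OF sub])
  have act: "g x \<in> X" if "g \<in> G" "x \<in> X" for g x
    using that GB Bij_imp_funcset by blast
  have cP: "carrier P = G" by (simp add: P_def)
  have mult: "(g \<otimes>\<^bsub>P\<^esub> h) x = g (h x)" if "g \<in> G" "h \<in> G" "x \<in> X" for g h x
    using perm_group_mult[OF GB that(1,2)] that by (simp add: P_def compose_def)
  have one: "\<one>\<^bsub>P\<^esub> x = x" if "x \<in> X" for x using that by (simp add: P_def)
  have inv: "(inv\<^bsub>P\<^esub> g) (g x) = x" if "g \<in> G" "x \<in> X" for g x
    using mult[of "inv\<^bsub>P\<^esub> g" g x] P.inv_closed[of g] P.l_inv[of g] one that by (simp add: cP)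
  have inv_G: "inv\<^bsub>P\<^esub> g \<in> G" if "g \<in> G" for g using that P.inv_closed[of g] cP by simp
  have mult_G: "g \<otimes>\<^bsub>P\<^esub> h \<in> G" if "g \<in> G" "h \<in> G" for g h using that P.m_closed[of g h] cP by simp
  have trans: "\<exists>g\<in>G. g x = y" if "x \<in> X" "y \<in> X" for x y
    using tr that unfolding transitive_on_iff[OF sub] by blast
  obtain x0 y0 \<Delta> where xy0: "x0 \<in> X" "y0 \<in> X"
    and \<Delta>_def: "\<Delta> = orbit P (\<lambda>g. map_prod g g) (x0, y0)"
    and disj: "\<Delta> \<inter> \<Delta>\<inverse> = {}" and arcs: "parcs \<Gamma> = \<Delta> \<union> \<Delta>\<inverse>"
    using ori unfolding oriented_by_def X_def P_def by blast
  have \<Delta>: "\<Delta> = {(g x0, g y0) | g. g \<in> G}" unfolding \<Delta>_def orbit_def cP by auto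
  have \<Delta>X: "\<Delta> \<subseteq> X \<times> X" using xy0 act by (auto simp: \<Delta>)
  have \<Delta>_inv: "(g x, g y) \<in> \<Delta>" if g: "g \<in> G" and xy: "(x, y) \<in> \<Delta>" for g x y
  proof -
    obtain h where h: "h \<in> G" "x = h x0" "y = h y0" using xy by (auto simp: \<Delta>)
    then have "g x = (g \<otimes>\<^bsub>P\<^esub> h) x0" "g y = (g \<otimes>\<^bsub>P\<^esub> h) y0" using mult g xy0 by auto
    then show ?thesis using mult_G[OF g h(1)] unfolding \<Delta> by blast
  qed
  have card_eq: "card (E `` {g x}) = card (E `` {x})"
    if g: "g \<in> G" and x: "x \<in> X" and E: "E \<subseteq> X \<times> X"
      "\<And>g x y. \<lbrakk>g \<in> G; (x, y) \<in> E\<rbrakk> \<Longrightarrow> (g x, g y) \<in> E" for g x and E :: "('a \<times> 'a) set"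
  proof -
    have "bij_betw g (E `` {x}) (E `` {g x})"
    proof (rule bij_betwI[where g = "inv\<^bsub>P\<^esub> g"])
      show "g \<in> E `` {x} \<rightarrow> E `` {g x}" using E(2) g by auto
      show "inv\<^bsub>P\<^esub> g \<in> E `` {g x} \<rightarrow> E `` {x}"
        using E(2)[OF inv_G[OF g], of "g x"] inv[OF g x] by auto
      show "(inv\<^bsub>P\<^esub> g) (g y) = y" if "y \<in> E `` {x}" for y using that E(1) inv g by auto
      show "g ((inv\<^bsub>P\<^esub> g) y) = y" if "y \<in> E `` {g x}" for y
      proof -
        have "y \<in> X" using that E(1) by auto
        then show ?thesis
          using inv[OF inv_G[OF g], of y] P.inv_inv[of g] g by (simp add: cP)
      qed
    qed
    then show ?thesis by (simp add: bij_betw_same_card)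
  qed
  define p where "p = card (\<Delta> `` {x0})"
  define q where "q = card (\<Delta>\<inverse> `` {x0})"
  have cp: "card (\<Delta> `` {x}) = p" if "x \<in> X" for x
    using trans[OF xy0(1) that] card_eq[OF _ xy0(1) \<Delta>X] \<Delta>_inv unfolding p_def by metis
  have \<Delta>cX: "\<Delta>\<inverse> \<subseteq> X \<times> X" using \<Delta>X by auto
  have cq: "card (\<Delta>\<inverse> `` {x}) = q" if "x \<in> X" for x
    using trans[OF xy0(1) that] card_eq[OF _ xy0(1) \<Delta>cX] \<Delta>_inv unfolding q_def converse_iff by metis
  have "p = q" using regular_digraph_degrees_eq[OF finX _ \<Delta>X cp cq] xy0 by auto
  moreover have "p + q = 4"
  proof -
    have fin: "finite (\<Delta> `` {x0})" "finite (\<Delta>\<inverse> `` {x0})"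
      using \<Delta>X by (auto intro: finite_subset[OF _ finX])
    have "out_arcs (with_proj \<Gamma>) x0 = Pair x0 ` (\<Delta> `` {x0} \<union> \<Delta>\<inverse> `` {x0})"
      using arcs by (auto simp: out_arcs_def)
    then have "out_degree (with_proj \<Gamma>) x0 = card (\<Delta> `` {x0} \<union> \<Delta>\<inverse> `` {x0})"
      by (simp add: out_degree_def card_image inj_on_def)
    also have "\<dots> = p + q"
      unfolding p_def q_def using disj by (intro card_Un_disjoint fin) auto
    finally show ?thesis using deg xy0 by simp
  qed
  ultimately have p2: "p = 2" by simp
  \<comment> \<open>If \<open>g\<close> takes \<open>x\<close> to \<open>y\<close>, the translates
    of the arc by powers of \<open>g\<close> form a directed walk from \<open>y\<close>, which
    returns to \<open>x\<close> because \<open>g\<close> has finite order.\<close>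
  have rev_arc: "(y, x) \<in> \<Delta>\<^sup>*" if xy: "(x, y) \<in> \<Delta>" for x y
  proof -
    have X: "x \<in> X" "y \<in> X" using xy \<Delta>X by auto
    obtain g where g: "g \<in> G" "g x = y" using trans X by blast
    have pow_G: "g [^]\<^bsub>P\<^esub> i \<in> G" for i :: nat using P.nat_pow_closed[of g i] g cP by simp
    have step: "(y, (g [^]\<^bsub>P\<^esub> i) y) \<in> \<Delta>\<^sup>*" for i :: nat
    proof (induction i)
      case 0
      then show ?case using one X by simp
    next
      case (Suc i)
      have "((g [^]\<^bsub>P\<^esub> Suc i) x, (g [^]\<^bsub>P\<^esub> Suc i) y) \<in> \<Delta>" using \<Delta>_inv[OF pow_G xy] .
      moreover have "(g [^]\<^bsub>P\<^esub> Suc i) x = (g [^]\<^bsub>P\<^esub> i) y"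
        using mult[OF pow_G g(1) X(1)] g(2) P.nat_pow_Suc[of g i] by simp
      ultimately show ?case using Suc by (metis rtrancl.rtrancl_into_rtrancl)
    qed
    have "finite G" using GB finite_Bij[OF finX] finite_subset by blast
    then obtain m where m: "order P = Suc m" using P.order_gt_0_iff_finite cP
      by (metis gr0_implies_Suc)
    have "g [^]\<^bsub>P\<^esub> Suc m = \<one>\<^bsub>P\<^esub>" using P.pow_order_eq_1[of g] g m cP by simp
    then have "(g [^]\<^bsub>P\<^esub> m) y = x"
      using mult[OF pow_G g(1) X(1), of m] g(2) one[OF X(1)] P.nat_pow_Suc[of g m] by simp
    then show ?thesis using step[of m] by simp
  qed
  interpret S: pair_wf_digraph "mk_symmetric (with_proj \<Gamma>)"
    by (rule \<Gamma>.wellformed_mk_symmetric)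
  have strong: "(x, y) \<in> \<Delta>\<^sup>*" if "x \<in> X" "y \<in> X" for x y
  proof -
    have "x \<rightarrow>\<^sup>*\<^bsub>with_proj (mk_symmetric (with_proj \<Gamma>))\<^esub> y"
      using con that unfolding connected_def strongly_connected_def X_def by simp
    then have "(x, y) \<in> (parcs (mk_symmetric (with_proj \<Gamma>)))\<^sup>*"
      unfolding S.reachable_conv by blast
    moreover have "parcs (mk_symmetric (with_proj \<Gamma>)) \<subseteq> \<Delta>\<^sup>*"
      using arcs rev_arc by (auto simp: parcs_mk_symmetric)
    ultimately show ?thesis by (metis rtrancl_idemp rtrancl_mono subsetD)
  qed
  have "qp_digraph P X (\<lambda>g. g) \<Delta>"
  proof (intro qp_digraph.intro qp_digraph_axioms.intro P.is_group)
    show "finite (carrier P)" unfolding cP using GB finite_Bij[OF finX] finite_subset by blast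
    show "g = \<one>\<^bsub>P\<^esub>" if g: "g \<in> carrier P" and fixg: "\<And>x. x \<in> X \<Longrightarrow> g x = x" for g
    proof -
      have "g \<in> extensional X" using g GB by (auto simp: cP Bij_def)
      then show ?thesis using fixg by (auto simp: P_def fun_eq_iff extensional_def)
    qed
    show "\<exists>g\<in>carrier P. g x = u \<and> g y = v" if "(x, y) \<in> \<Delta>" "(u, v) \<in> \<Delta>" for x y u v
    proof -
      obtain g h where g: "g \<in> G" "x = g x0" "y = g y0" and h: "h \<in> G" "u = h x0" "v = h y0"
        using \<open>(x, y) \<in> \<Delta>\<close> \<open>(u, v) \<in> \<Delta>\<close> unfolding \<Delta> by auto
      have "(h \<otimes>\<^bsub>P\<^esub> inv\<^bsub>P\<^esub> g) x = u" "(h \<otimes>\<^bsub>P\<^esub> inv\<^bsub>P\<^esub> g) y = v"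
        using g h mult[OF h(1) inv_G[OF g(1)]] inv[OF g(1)] act xy0 by auto
      then show ?thesis using mult_G[OF h(1) inv_G[OF g(1)]] cP by blast
    qed
    show "\<exists>n\<in>N. n x = y" if N: "N \<lhd> P" "N \<noteq> {\<one>\<^bsub>P\<^esub>}" and xy: "x \<in> X" "y \<in> X" for N x y
    proof -
      have "transitive_on X N" using qp N unfolding quasiprimitive_on_def P_def by blast
      then interpret a: transitive_action "perm_group X N" X "\<lambda>g. g"
        unfolding transitive_on_def .
      show ?thesis using a.unique_orbit[OF xy] by simp
    qed
  qed (use finX xy0 act mult one \<Delta>X \<Delta>_inv cp p2 strong disj cP in auto)
  then show ?thesis using that[of \<Delta>] arcs sub unfolding P_def X_def by blast
qed

text \<open>\<open>T\<close> is found inside \<open>G\<close>, as \<open>N\<close> itself or as its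
  factor \<open>M\<close>, so its elements are permutations of the vertices. For
  \<open>k = 2\<close> the cases are separated by whether \<open>N\<close> is regular.\<close>

lemma structure_of_basic:
  fixes \<Gamma> :: "'a pair_pre_digraph"
  assumes "basic_quasiprimitive \<Gamma> G"
  shows "\<exists>N (T :: ('a \<Rightarrow> 'a) monoid) k. unique_minimal_normal_power (pverts \<Gamma>) G N T k \<and> k \<le> 2 \<and>
    (k = 1 \<or>
      (k = 2 \<and> card (rcosets\<^bsub>perm_group (pverts \<Gamma>) G\<^esub> N) = 2 \<and> twisted_wreath \<Gamma> G N T) \<or>
      (k = 2 \<and> \<not> regular_on (pverts \<Gamma>) N))"
proof -
  define X where "X = pverts \<Gamma>"
  obtain \<Delta> where Q: "qp_digraph (perm_group X G) X (\<lambda>g. g) \<Delta>" and arcs: "parcs \<Gamma> = \<Delta> \<union> \<Delta>\<inverse>"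
    and sub: "subgroup G (BijGroup X)"
    using qp_digraph_of_basic[OF assms] unfolding X_def by blast
  interpret Q: qp_digraph "perm_group X G" X "\<lambda>g. g" \<Delta> by (fact Q)
  obtain N where un: "unique_minimal_normal N (perm_group X G)"
    using Q.ex_unique_minimal_normal by blast
  then have min: "minimal_normal N (perm_group X G)" by (simp add: unique_minimal_normal_def)
  then have N: "N \<lhd> perm_group X G" "N \<noteq> {\<one>\<^bsub>perm_group X G\<^esub>}"
    by (simp_all add: minimal_normal_def)
  have subN: "subgroup N (perm_group X G)" using N normal_imp_subgroup by blast
  have NG: "N \<subseteq> G" using subgroup.subset[OF subN] by simp
  have finG: "finite G" using Q.finG by simp
  have GB: "G \<subseteq> Bij X" by (rule subgroup_Bij[OF sub])
  have nonab: "\<not> (\<forall>x\<in>N. \<forall>y\<in>N. x \<otimes>\<^bsub>perm_group X G\<^esub> y = y \<otimes>\<^bsub>perm_group X G\<^esub> x)"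
    by (rule Q.normal_not_abelian[OF N])
  have comm: "x \<otimes>\<^bsub>perm_group X G\<^esub> y = y \<otimes>\<^bsub>perm_group X G\<^esub> x"
    if "comm_group (perm_group X M)" "x \<in> M" "y \<in> M" for M x y
    using comm_monoid.m_comm[OF comm_group.axioms(1)[OF that(1)], of x y] that
    by (simp add: perm_group_def)
  consider "simple_group (perm_group X N)"
    | M where "simple_group (perm_group X M)" "subgroup M (perm_group X G)" "M \<subseteq> N" "\<not> G \<subseteq> N"
      "\<And>h. h \<in> G - N \<Longrightarrow> conj_factors (perm_group X G) M N h"
  proof (cases "simple_group (perm_group X N)")
    case False
    then obtain M where M: "simple_group (perm_group X M)" "subgroup M (perm_group X G)" "M \<subseteq> N"
      "\<not> G \<subseteq> N" and fac: "\<forall>h\<in>G - N. M \<inter> Q.cj h ` M = {\<one>\<^bsub>perm_group X G\<^esub>} \<and>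
        (\<forall>x\<in>M. \<forall>y\<in>M. x \<otimes>\<^bsub>perm_group X G\<^esub> Q.cj h y = Q.cj h y \<otimes>\<^bsub>perm_group X G\<^esub> x) \<and>
        (\<lambda>(x, y). x \<otimes>\<^bsub>perm_group X G\<^esub> Q.cj h y) ` (M \<times> M) = N"
      using Q.minimal_normal_structure[OF min]
      unfolding perm_group_carrier_update perm_group_carrier by blast
    have "conj_factors (perm_group X G) M N h" if h: "h \<in> G - N" for h
      by (intro conj_factors.intro conj_factors_axioms.intro Q.is_group)
        (use M fac[rule_format, OF h] h in auto)
    then show ?thesis using that(2) M by blast
  qed
  then show ?thesis
  proof cases
    case 1
    have "\<not> comm_group (perm_group X N)" using comm nonab by blast
    then have "finite_nonabelian_simple (perm_group X N)"
      using 1 finG NG finite_subset by (auto simp: finite_nonabelian_simple_def)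
    moreover have "perm_group X N \<cong> direct_power (perm_group X N) 1"
      using iso_direct_power_1 by (rule is_isoI)
    ultimately have "unique_minimal_normal_power X G N (perm_group X N) 1"
      using un by (simp add: unique_minimal_normal_power_def)
    then show ?thesis unfolding X_def[symmetric]
      by (intro exI[of _ N] exI[of _ "perm_group X N"] exI[of _ 1]) simp
  next
    case (2 M)
    let ?T = "perm_group X M"
    obtain h where h: "h \<in> G - N" using 2 by blast
    interpret F: conj_factors "perm_group X G" M N h using 2(5)[OF h] .
    have "\<not> comm_group ?T"
    proof
      assume c: "comm_group ?T"
      have "x \<otimes>\<^bsub>perm_group X G\<^esub> y = y \<otimes>\<^bsub>perm_group X G\<^esub> x" if xy: "x \<in> N" "y \<in> N" for x y
      proof -
        obtain p q where pq: "p \<in> M \<times> M" "x = F.phi p" "q \<in> M \<times> M" "y = F.phi q"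
          using F.N_eq_phi xy by metis
        have "p \<otimes>\<^bsub>F.T \<times>\<times> F.T\<^esub> q = q \<otimes>\<^bsub>F.T \<times>\<times> F.T\<^esub> p"
          using pq comm[OF c] by (auto simp: mult_DirProd')
        then show ?thesis using pq F.phi.hom_mult[of p q] F.phi.hom_mult[of q p] by simp
      qed
      then show False using nonab by blast
    qed
    then have "finite_nonabelian_simple ?T"
      using 2 finG NG finite_subset[of M G] by (auto simp: finite_nonabelian_simple_def)
    moreover have "perm_group X N \<cong> direct_power ?T 2"
      using F.iso_direct_power unfolding F.T_def perm_group_carrier_update .
    ultimately have pow: "unique_minimal_normal_power X G N ?T 2"
      using un by (simp add: unique_minimal_normal_power_def)
    show ?thesis
    proof (cases "regular_on X N")
      case False
      then show ?thesis using pow unfolding X_def[symmetric]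
        by (intro exI[of _ N] exI[of _ ?T] exI[of _ 2]) simp
    next
      case True
      have sr: "n = \<one>\<^bsub>perm_group X G\<^esub>" if "n \<in> N" "x \<in> X" "n x = x" for n x
        using True that by (auto simp: regular_on_def BijGroup_def)
      have "M \<noteq> {\<one>\<^bsub>perm_group X G\<^esub>}"
        using simple_group.simple_not_triv[OF 2(1)] by simp
      note tw = Q.twisted_wreath_of_regular[of N M, OF N _ 2(2) this,
          unfolded perm_group_carrier_update perm_group_carrier]
      have "card (rcosets\<^bsub>perm_group X G\<^esub> N) = 2 \<and> twisted_wreath \<Gamma> G N ?T"
        unfolding twisted_wreath_def transport_def X_def[symmetric] arcs carrier_DirProd
          perm_group_carrier
        by (rule tw) (use sr 2(5) in auto)
      then show ?thesis using pow unfolding X_def[symmetric]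
        by (intro exI[of _ N] exI[of _ ?T] exI[of _ 2]) simp
    qed
  qed
qed

section \<open>Alternating groups\<close>

text \<open>The telescoping step for products of involutions: odd factors stay paired, so every
  intermediate product is even.\<close>

lemma comp_cancel: "y \<circ> y = id \<Longrightarrow> (x \<circ> y) \<circ> (y \<circ> z) = x \<circ> z"
  by (simp add: fun_eq_iff)

lemma conj_transpose:
  assumes "bij p" shows "p \<circ> transpose a b \<circ> inv' p = transpose (p a) (p b)"
proof
  fix x
  obtain y where "x = p y" using assms by (metis bij_pointE)
  then show "(p \<circ> transpose a b \<circ> inv' p) x = transpose (p a) (p b) x"
    using assms by (simp add: transpose_def bij_is_inj inj_eq)
qed

lemma conj_transpose_comp:
  assumes "bij p"
  shows "p \<circ> (transpose a b \<circ> transpose c d) \<circ> inv' p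
    = transpose (p a) (p b) \<circ> transpose (p c) (p d)"
proof -
  have "inv' p \<circ> p = id" using assms by (simp add: bij_is_inj)
  then have "p \<circ> (transpose a b \<circ> transpose c d) \<circ> inv' p
      = (p \<circ> transpose a b \<circ> inv' p) \<circ> (p \<circ> transpose c d \<circ> inv' p)"
    by (metis (no_types, lifting) comp_assoc comp_id)
  then show ?thesis using conj_transpose[OF assms] by simp
qed

lemma alt_group_bij: "p \<in> carrier (alt_group n) \<Longrightarrow> bij p"
  by (auto simp: alt_group_carrier permutes_bij)

lemma transpose_pair_alt:
  assumes "{a, b, c, d} \<subseteq> {1..n}" "a \<noteq> b" "c \<noteq> d"
  shows "transpose a b \<circ> transpose c d \<in> carrier (alt_group n)"
  using assms permutes_swap_id[of _ "{1..n}"]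
  by (auto simp: alt_group_carrier evenperm_comp evenperm_swap permutation_swap_id
      intro!: permutes_compose)

lemma ex_two_outside:
  fixes xs :: "nat list"
  assumes "length xs + 2 \<le> n"
  obtains p q where "p \<in> {1..n} - set xs" "q \<in> {1..n} - set xs" "p \<noteq> q"
proof -
  have "2 \<le> card ({1..n} - set xs)"
    using diff_card_le_card_Diff[of "set xs" "{1..n}"] card_length[of xs] assms by simp
  then obtain S where "S \<subseteq> {1..n} - set xs" "card S = 2" by (metis obtain_subset_with_card_n)
  then show ?thesis using that by (metis card_2_iff insert_subset)
qed

text \<open>Three transpositions move the points as prescribed. If the result is odd, a
  transposition of two points other than \<open>x\<close>, \<open>y\<close>, \<open>z\<close>
  repairs the parity; this takes five points.\<close>

lemma alt_group_three_transitive: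
  assumes "5 \<le> n" and ijp: "{i, j, p} \<subseteq> {1..n}" "i \<noteq> j" "i \<noteq> p" "j \<noteq> p"
    and xyz: "{x, y, z} \<subseteq> {1..n}" "x \<noteq> y" "x \<noteq> z" "y \<noteq> z"
  obtains \<sigma> where "\<sigma> \<in> carrier (alt_group n)" "\<sigma> i = x" "\<sigma> j = y" "\<sigma> p = z"
proof -
  define t1 where "t1 = transpose i x"
  define t2 where "t2 = transpose y (t1 j) \<circ> t1"
  define t3 where "t3 = transpose z (t2 p) \<circ> t2"
  have t1: "t1 permutes {1..n}" unfolding t1_def using ijp xyz by (intro permutes_swap_id) auto
  then have "t1 j \<in> {1..n}" using ijp permutes_in_image by (metis insert_subset)
  then have t2: "t2 permutes {1..n}" unfolding t2_def using t1 xyz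
    by (intro permutes_compose permutes_swap_id) auto
  then have "t2 p \<in> {1..n}" using ijp permutes_in_image by (metis insert_subset)
  then have t3: "t3 permutes {1..n}" unfolding t3_def using t2 xyz
    by (intro permutes_compose permutes_swap_id) auto
  have "t1 i = x" by (simp add: t1_def)
  moreover have "t1 j \<noteq> t1 i" using permutes_inj[OF t1] ijp by (simp add: inj_eq)
  ultimately have t2ij: "t2 i = x" "t2 j = y" using xyz by (auto simp: t2_def)
  moreover have "t2 p \<noteq> t2 i" "t2 p \<noteq> t2 j" using permutes_inj[OF t2] ijp by (auto simp: inj_eq)
  ultimately have t3ijp: "t3 i = x" "t3 j = y" "t3 p = z" using xyz by (auto simp: t3_def)
  have "length [x, y, z] + 2 \<le> n" using assms(1) by simp
  then obtain u v where uv: "u \<in> {1..n} - set [x, y, z]" "v \<in> {1..n} - set [x, y, z]" "u \<noteq> v"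
    by (rule ex_two_outside)
  define s where "s = transpose u v \<circ> t3"
  have s: "s permutes {1..n}" unfolding s_def using t3 uv
    by (intro permutes_compose permutes_swap_id) auto
  have "permutation t3" using t3 permutation_permutes by blast
  then have "evenperm s \<longleftrightarrow> \<not> evenperm t3"
    unfolding s_def using uv by (simp add: evenperm_comp evenperm_swap permutation_swap_id)
  moreover have "s i = x" "s j = y" "s p = z" using t3ijp uv by (auto simp: s_def)
  ultimately show ?thesis
    using that[of s] that[of t3] s t3 t3ijp by (auto simp: alt_group_carrier)
qed

text \<open>The commutator of \<open>\<rho> \<in> M\<close> with the \<open>3\<close>-cycle \<open>(a b c)\<close> lies in \<open>M\<close> and moves at most six points. If
  \<open>\<rho>\<close> fixes \<open>b\<close> and \<open>c\<close>, it is a \<open>3\<close>-cycle.\<close>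

lemma alt_group_simple:
  assumes n: "8 \<le> n" shows "simple_group (alt_group n)"
proof -
  interpret A: group "alt_group n" by (rule alt_group_is_group)
  have conj: "\<sigma> \<circ> p \<circ> inv' \<sigma> \<in> M"
    if "M \<lhd> alt_group n" "p \<in> M" "\<sigma> \<in> carrier (alt_group n)" for M \<sigma> p
    using normal.inv_op_closed2[OF that(1,3,2)] alt_group_inv_equality[OF that(3)]
    by (simp add: alt_group_mult)
  have comp: "p \<circ> q \<in> M" if "M \<lhd> alt_group n" "p \<in> M" "q \<in> M" for M p q
    using subgroup.m_closed[OF normal_imp_subgroup[OF that(1)] that(2,3)] by (simp add: alt_group_mult)
  have car: "p \<in> carrier (alt_group n)" if "M \<lhd> alt_group n" "p \<in> M" for M p
    using subgroup.mem_carrier[OF normal_imp_subgroup[OF that(1)] that(2)] .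
  have inv_in: "inv' p \<in> M" if "M \<lhd> alt_group n" "p \<in> M" for M p
    using subgroup.m_inv_closed[OF normal_imp_subgroup[OF that(1)] that(2)]
      alt_group_inv_equality[OF car[OF that]] by simp
  have commutator: "transpose (\<rho> a) (\<rho> b) \<circ> transpose (\<rho> b) (\<rho> c) \<circ> (transpose b c \<circ> transpose a b) \<in> M"
    if M: "M \<lhd> alt_group n" and r: "\<rho> \<in> M" and abc: "{a, b, c} \<subseteq> {1..n}" "a \<noteq> b" "b \<noteq> c"
    for M \<rho> a b c
  proof -
    define t where "t = transpose a b \<circ> transpose b c"
    have t: "t \<in> carrier (alt_group n)" unfolding t_def using abc by (intro transpose_pair_alt) auto
    have br: "bij \<rho>" using car[OF M r] alt_group_bij by blast
    have it: "inv' t = transpose b c \<circ> transpose a b"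
      unfolding t_def by (rule inv_unique_comp) (simp_all add: fun_eq_iff)
    have "\<rho> \<circ> (t \<circ> inv' \<rho> \<circ> inv' t) \<in> M"
      using comp[OF M r] conj[OF M inv_in[OF M r] t] by blast
    moreover have "\<rho> \<circ> (t \<circ> inv' \<rho> \<circ> inv' t) = (\<rho> \<circ> t \<circ> inv' \<rho>) \<circ> inv' t"
      by (simp add: comp_assoc)
    ultimately show ?thesis unfolding it unfolding t_def conj_transpose_comp[OF br] by simp
  qed
  have "M = carrier (alt_group n)" if M: "M \<lhd> alt_group n" and M1: "M \<noteq> {\<one>\<^bsub>alt_group n\<^esub>}" for M
  proof -
    have "\<one>\<^bsub>alt_group n\<^esub> \<in> M" using normal_imp_subgroup[OF M] subgroup.one_closed by blast
    then obtain r0 where r0: "r0 \<in> M" "r0 \<noteq> id" using M1 unfolding alt_group_one by auto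
    then obtain i where i: "r0 i \<noteq> i" by (auto simp: fun_eq_iff)
    have perm: "p permutes {1..n}" if "p \<in> M" for p using car[OF M that] alt_group_carrier by blast
    have iin: "i \<in> {1..n}" using perm[OF r0(1)] i by (metis permutes_not_in)
    have rin: "r0 i \<in> {1..n}" using permutes_in_image[OF perm[OF r0(1)]] iin by blast
    have "length [i, r0 i] + 2 \<le> n" using n by simp
    then obtain a b where ab: "a \<in> {1..n} - set [i, r0 i]" "b \<in> {1..n} - set [i, r0 i]" "a \<noteq> b"
      by (rule ex_two_outside)
    \<comment> \<open>The points \<open>a\<close> and \<open>b\<close> avoid \<open>i\<close> and
      \<open>r0 i\<close>, so this commutator sends \<open>r0 i\<close> to \<open>r0 a\<close> and
      is not the identity.\<close>
    define k where "k = transpose (r0 i) (r0 a) \<circ> transpose (r0 a) (r0 b) \<circ> (transpose a b \<circ> transpose i a)"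
    have kM: "k \<in> M" unfolding k_def using ab iin by (intro commutator[OF M r0(1)]) auto
    have kfix: "k x = x" if "x \<notin> {i, a, b, r0 i, r0 a, r0 b}" for x
      using that by (simp add: k_def)
    have "r0 a \<noteq> r0 i" "r0 b \<noteq> r0 i" using permutes_inj[OF perm[OF r0(1)]] ab by (auto simp: inj_eq)
    then have "k (r0 i) \<noteq> r0 i" using ab i by (auto simp: k_def)
    then obtain i' where i': "k i' \<noteq> i'" by blast
    have iin': "i' \<in> {1..n}" using perm[OF kM] i' by (metis permutes_not_in)
    have kin': "k i' \<in> {1..n}" using permutes_in_image[OF perm[OF kM]] iin' by blast
    have "length [i, a, b, r0 i, r0 a, r0 b] + 2 \<le> n" using n by simp
    then obtain p q where pq: "p \<in> {1..n} - set [i, a, b, r0 i, r0 a, r0 b]"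
      "q \<in> {1..n} - set [i, a, b, r0 i, r0 a, r0 b]" "p \<noteq> q"
      by (rule ex_two_outside)
    then have kpq: "k p = p" "k q = q" using kfix by auto
    then have ipq: "i' \<noteq> p" "i' \<noteq> q" "k i' \<noteq> p"
      using i' permutes_inj[OF perm[OF kM]] by (auto dest: injD)
    \<comment> \<open>As \<open>k\<close> fixes \<open>p\<close> and \<open>q\<close>, the two
      copies of \<open>transpose p q\<close> in the second commutator cancel, leaving a 3-cycle on
      \<open>k i'\<close>, \<open>p\<close>, \<open>i'\<close>.\<close>
    have "transpose (k i') p \<circ> transpose p q \<circ> (transpose p q \<circ> transpose i' p) \<in> M"
      using commutator[OF M kM, of i' p q] pq iin' ipq kpq by auto
    then have tc: "transpose (k i') p \<circ> transpose p i' \<in> M"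
      by (metis (no_types, lifting) comp_assoc comp_id transpose_comp_involutory transpose_commute)
    have "three_cycles n \<subseteq> M"
    proof
      fix c assume "c \<in> three_cycles n"
      then obtain cs where cs: "c = cycle_of_list cs" "cycle cs" "length cs = 3" "set cs \<subseteq> {1..n}"
        by auto
      obtain x y z where xyz: "cs = [x, y, z]" using stupid_lemma[OF cs(3)] by blast
      then have c: "c = transpose x y \<circ> transpose y z" using cs by simp
      obtain \<sigma> where s: "\<sigma> \<in> carrier (alt_group n)" "\<sigma> (k i') = x" "\<sigma> p = y" "\<sigma> i' = z"
        by (rule alt_group_three_transitive[of n "k i'" p i' x y z])
          (use n iin' kin' pq ipq i' cs xyz in auto)
      have "\<sigma> \<circ> (transpose (k i') p \<circ> transpose p i') \<circ> inv' \<sigma> \<in> M" using conj[OF M tc s(1)] .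
      then show "c \<in> M" unfolding conj_transpose_comp[OF alt_group_bij[OF s(1)]] c s(2-4) .
    qed
    then have "generate (alt_group n) (three_cycles n) \<subseteq> M"
      using A.generate_subgroup_incl normal_imp_subgroup[OF M] by blast
    then show ?thesis using alt_group_carrier_as_three_cycles[of n] car[OF M] by blast
  qed
  moreover have "1 < order (alt_group n)"
  proof -
    have "(2 :: nat) < fact n" using n fact_mono_nat[of 3 n] by (simp add: fact_numeral)
    then show ?thesis using alt_group_card_carrier[of n] n by (simp add: order_def)
  qed
  ultimately show ?thesis by unfold_locales auto
qed

section \<open>A long cycle and the generation of the alternating group\<close>

fun cyc :: "nat \<Rightarrow> nat \<Rightarrow> nat" where
  "cyc 0 = id"
| "cyc (Suc m) = cyc m \<circ> transpose (Suc m) (Suc (Suc m))"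

lemma cyc_apply:
  "cyc m x = (if 1 \<le> x \<and> x \<le> m then Suc x else if x = Suc m then 1 else x)"
  by (induction m arbitrary: x) (auto simp: transpose_def)

lemma cyc_permutes: "cyc m permutes {1..Suc m}"
proof (induction m)
  case (Suc m)
  have "cyc m permutes {1..Suc (Suc m)}" by (rule permutes_subset[OF Suc]) auto
  then show ?case unfolding cyc.simps by (intro permutes_compose permutes_swap_id) auto
qed (auto simp: permutes_id)

text \<open>The index counts transpositions, while the cycle has one point more. So
  \<open>cyc (2 * m)\<close> is an even cycle on all \<open>2 * m + 1\<close> points.\<close>

lemma evenperm_cyc: "evenperm (cyc m) \<longleftrightarrow> even m"
proof (induction m)
  case (Suc m)
  have p: "permutation (cyc m)" using cyc_permutes permutation_permutes by blast
  show ?case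
    unfolding cyc.simps evenperm_comp[OF p permutation_swap_id] by (simp add: Suc evenperm_swap)
qed simp

lemma cyc_funpow_1: "k \<le> m \<Longrightarrow> (cyc m ^^ k) 1 = Suc k"
  by (induction k) (auto simp: cyc_apply)

lemma cyc_funpow_period: "cyc m ^^ Suc m = id"
proof
  fix x
  have 1: "(cyc m ^^ Suc m) 1 = 1" using cyc_funpow_1[of m m] by (simp add: cyc_apply)
  show "(cyc m ^^ Suc m) x = id x"
  proof (cases "x \<in> {1..Suc m}")
    case True
    then have "x - 1 \<le> m" "Suc (x - 1) = x" by auto
    then have x: "x = (cyc m ^^ (x - 1)) 1" using cyc_funpow_1[of "x - 1" m] by simp
    have "(cyc m ^^ Suc m) ((cyc m ^^ (x - 1)) 1) = (cyc m ^^ (x - 1)) ((cyc m ^^ Suc m) 1)"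
      by (metis add.commute comp_apply funpow_add)
    then show ?thesis using 1 x by simp
  next
    case False
    have "(cyc m ^^ k) x = x" for k
      using False permutes_not_in[OF cyc_permutes] by (induction k) auto
    from this[of "Suc m"] show ?thesis by (simp del: funpow.simps)
  qed
qed

text \<open>Conjugating \<open>u\<close> by powers of \<open>a\<close> gives the products \<open>t\<^sub>k t\<^sub>k\<^sub>+\<^sub>2\<close> of adjacent transpositions, with indices
  modulo \<open>n\<close>. As \<open>n\<close> is odd, these yield all \<open>t\<^sub>k t\<^sub>k\<^sub>+\<^sub>1\<close>.\<close>

lemma alt_group_generated:
  assumes m: "4 \<le> m" and n: "n = Suc (2 * m)"
  shows "generate (alt_group n) {cyc (2 * m), transpose 1 2 \<circ> transpose 3 4} = carrier (alt_group n)"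
proof -
  define a where "a = cyc (2 * m)"
  define u where "u = transpose 1 2 \<circ> transpose 3 (4 :: nat)"
  define K where "K = generate (alt_group n) {a, u}"
  interpret A: group "alt_group n" by (rule alt_group_is_group)
  have aA: "a \<in> carrier (alt_group n)"
    using cyc_permutes[of "2 * m"] evenperm_cyc[of "2 * m"] by (simp add: alt_group_carrier a_def n)
  have uA: "u \<in> carrier (alt_group n)" unfolding u_def using m n by (intro transpose_pair_alt) auto
  have sub: "subgroup K (alt_group n)" unfolding K_def using aA uA by (intro A.generate_is_subgroup) auto
  have KA: "x \<in> carrier (alt_group n)" if "x \<in> K" for x using subgroup.mem_carrier[OF sub that] .
  have comp: "x \<circ> y \<in> K" if "x \<in> K" "y \<in> K" for x y
    using subgroup.m_closed[OF sub that] by (simp add: alt_group_mult)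
  have invK: "inv' x \<in> K" if "x \<in> K" for x
    using subgroup.m_inv_closed[OF sub that] alt_group_inv_equality[OF KA[OF that]] by simp
  have idK: "id \<in> K" using subgroup.one_closed[OF sub] by (simp add: alt_group_one)
  have aK: "a \<in> K" "u \<in> K" unfolding K_def by (auto intro: generate.incl)
  have powK: "a ^^ k \<in> K" for k
    using subgroup.one_closed[OF sub] comp[OF aK(1)] by (induction k) (auto simp: alt_group_one)
  \<comment> \<open>The transposition of two neighbours on the cycle \<open>a\<close>. Taking the
    points as powers of \<open>a\<close> applied to 1 makes the index cyclic modulo
    \<open>n\<close>.\<close>
  define t where "t k = transpose ((a ^^ k) 1) ((a ^^ Suc k) 1)" for k
  have t_adj: "t k = transpose (Suc k) (Suc (Suc k))" if "k < 2 * m" for k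
    using that cyc_funpow_1[of k "2 * m"] cyc_funpow_1[of "Suc k" "2 * m"] unfolding t_def a_def by simp
  have t_period: "t (k + n) = t k" for k
  proof -
    have "a ^^ (k + n) = a ^^ k" for k
      using cyc_funpow_period[of "2 * m"] unfolding funpow_add n a_def by simp
    from this[of k] this[of "Suc k"] show ?thesis by (simp add: t_def)
  qed
  have tt: "t k \<circ> t k = id" for k by (simp add: t_def)
  have t2: "t k \<circ> t (k + 2) \<in> K" for k
  proof -
    have "t (k + j) = (a ^^ k) \<circ> t j \<circ> inv' (a ^^ k)" for j
      unfolding t_def conj_transpose[OF alt_group_bij[OF KA[OF powK]]]
      using funpow_add[of k j a] funpow_add[of k "Suc j" a] by (simp del: funpow.simps)
    from this[of 0] this[of 2]
    have eq: "t k = (a ^^ k) \<circ> t 0 \<circ> inv' (a ^^ k)" "t (k + 2) = (a ^^ k) \<circ> t 2 \<circ> inv' (a ^^ k)"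
      by simp_all
    have "t 0 \<circ> t 2 = u" using t_adj[of 0] t_adj[of 2] m by (simp add: u_def numeral_eq_Suc)
    moreover have "t k \<circ> t (k + 2) = (a ^^ k) \<circ> (t 0 \<circ> t 2) \<circ> inv' (a ^^ k)"
    proof -
      have "inv' (a ^^ k) \<circ> (a ^^ k) = id"
        using alt_group_bij[OF KA[OF powK[of k]]] by (simp add: bij_is_inj)
      then show ?thesis unfolding eq by (metis (no_types, lifting) comp_assoc comp_id)
    qed
    ultimately show ?thesis using comp powK invK aK by metis
  qed
  have t_even: "t k \<circ> t (k + 2 * j) \<in> K" for k j
  proof (induction j)
    case 0
    then show ?case by (simp only: mult_0_right add_0_right tt idK)
  next
    case (Suc j)
    have "k + 2 * Suc j = k + 2 * j + 2" by simp
    then show ?case using comp[OF Suc t2[of "k + 2 * j"]] unfolding comp_cancel[OF tt] by (simp only:)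
  qed
  \<comment> \<open>Since \<open>2 * Suc m\<close> is \<open>n + 1\<close>, steps of length two go
    once around the odd cycle and end at the next index.\<close>
  have t_Suc: "t k \<circ> t (Suc k) \<in> K" for k
    using t_even[of k "Suc m"] t_period[of "Suc k"] by (simp add: n)
  have t_0: "t 0 \<circ> t k \<in> K" for k
  proof (induction k)
    case 0
    then show ?case by (simp only: mult_0_right add_0_right tt idK)
  next
    case (Suc k)
    from comp[OF this t_Suc[of k]] show ?case unfolding comp_cancel[OF tt] .
  qed
  have inv_comp: "inv' (x \<circ> y) = y \<circ> x" if "x \<circ> x = id" "y \<circ> y = id" for x y :: "nat \<Rightarrow> nat"
    using that by (intro inv_unique_comp) (metis comp_assoc comp_id)+
  have t_0': "t k \<circ> t 0 \<in> K" for k using invK[OF t_0[of k]] inv_comp[OF tt tt] by simp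
  \<comment> \<open>A transposition is odd, so it is paired with the fixed \<open>t 0\<close>.
    Conjugating by the next adjacent transposition \<open>?s\<close> lengthens it by one
    point.\<close>
  have tr_le: "transpose (Suc i) (Suc (i + Suc d)) \<circ> t 0 \<in> K" if "i + Suc d \<le> 2 * m" for i d
    using that
  proof (induction d)
    case 0
    then have "t i = transpose (Suc i) (Suc (i + Suc 0))" using t_adj[of i] by simp
    then show ?case using t_0'[of i] by (simp only:)
  next
    case (Suc d)
    let ?p = "transpose (Suc i) (Suc (i + Suc d))" and ?s = "t (i + Suc d)"
    have s: "?s = transpose (Suc (i + Suc d)) (Suc (i + Suc (Suc d)))"
      using t_adj[of "i + Suc d"] Suc.prems by simp
    have IH: "?p \<circ> t 0 \<in> K" using Suc.prems by (intro Suc.IH) simp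
    then have IH': "t 0 \<circ> ?p \<in> K"
      using invK[OF IH] inv_comp[of ?p "t 0"] tt by simp
    have "(?s \<circ> t 0) \<circ> (t 0 \<circ> ?p) \<circ> (?s \<circ> t 0) \<in> K"
      using comp t_0' IH' by blast
    moreover have "(?s \<circ> t 0) \<circ> (t 0 \<circ> ?p) \<circ> (?s \<circ> t 0) = (?s \<circ> ?p \<circ> ?s) \<circ> t 0"
      using tt[of 0] by (metis (no_types, lifting) comp_assoc comp_id)
    moreover have "?s \<circ> ?p \<circ> ?s = transpose (Suc i) (Suc (i + Suc (Suc d)))"
      unfolding s by (auto simp: fun_eq_iff transpose_def)
    ultimately show ?case by metis
  qed
  have tr: "transpose x y \<circ> t 0 \<in> K" if xy: "x \<in> {1..n}" "y \<in> {1..n}" "x < y" for x y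
  proof -
    obtain i where i: "x = Suc i" using xy by (cases x) auto
    obtain d where "y = x + Suc d" using less_imp_Suc_add[OF xy(3)] by auto
    then show ?thesis using tr_le[of i d] xy i n by simp
  qed
  have tr: "transpose x y \<circ> t 0 \<in> K" if "x \<in> {1..n}" "y \<in> {1..n}" "x \<noteq> y" for x y
    using tr[OF that(1,2)] tr[OF that(2,1)] that(3) by (metis linorder_neqE_nat transpose_commute)
  have tr': "t 0 \<circ> transpose x y \<in> K" if "x \<in> {1..n}" "y \<in> {1..n}" "x \<noteq> y" for x y
    using invK[OF tr[OF that]] inv_comp[of "transpose x y" "t 0"] tt by simp
  have "three_cycles n \<subseteq> K"
  proof
    fix c assume "c \<in> three_cycles n"
    then obtain cs where cs: "c = cycle_of_list cs" "cycle cs" "length cs = 3" "set cs \<subseteq> {1..n}"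
      by auto
    obtain x y z where xyz: "cs = [x, y, z]" using stupid_lemma[OF cs(3)] by blast
    have "(transpose x y \<circ> t 0) \<circ> (t 0 \<circ> transpose y z) \<in> K"
      using cs xyz by (intro comp tr tr') auto
    then have "transpose x y \<circ> transpose y z \<in> K" unfolding comp_cancel[OF tt] .
    then show "c \<in> K" using cs xyz by simp
  qed
  then have "generate (alt_group n) (three_cycles n) \<subseteq> K"
    using A.generate_subgroup_incl sub by blast
  then show ?thesis using alt_group_carrier_as_three_cycles[of n] KA
    unfolding K_def a_def u_def by blast
qed

lemma card_Image_bij:
  assumes "bij_betw f X X" "E \<subseteq> X \<times> X" "x \<in> X"
    and "\<And>x y. \<lbrakk>x \<in> X; y \<in> X\<rbrakk> \<Longrightarrow> (f x, f y) \<in> E \<longleftrightarrow> (x, y) \<in> E"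
  shows "card (E `` {f x}) = card (E `` {x})"
proof -
  have "f ` (E `` {x}) = E `` {f x}"
  proof (intro equalityI subsetI)
    fix z assume z: "z \<in> E `` {f x}"
    then have "z \<in> X" using assms(2) by auto
    then obtain y where "y \<in> X" "z = f y" using assms(1) by (auto simp: bij_betw_def)
    then show "z \<in> f ` (E `` {x})" using z assms(3,4) by auto
  next
    fix z assume "z \<in> f ` (E `` {x})"
    then obtain y where "z = f y" "(x, y) \<in> E" by auto
    then show "z \<in> E `` {f x}" using assms(2-4) by auto
  qed
  moreover have "inj_on f (E `` {x})"
    using assms(1,2) by (auto simp: bij_betw_def intro: inj_on_subset)
  ultimately show ?thesis by (metis card_image)
qed

section \<open>Coset digraphs\<close>

text \<open>The digraph on the left cosets of \<open>H\<close> with arcs \<open>(x H, x h g H)\<close>; the double coset \<open>H g H\<close> is the union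
  of the two left cosets \<open>g H\<close> and \<open>h0 g H\<close>.\<close>

locale coset_digraph = group G for G (structure) +
  fixes H :: "'a set" and g h0 :: 'a
  assumes finite_carrier: "finite (carrier G)" and H_sub: "subgroup H G"
    and g_carrier [simp]: "g \<in> carrier G" and gen: "generate G (H \<union> {g}) = carrier G"
    and h0: "h0 \<in> H" "inv g \<otimes> (h0 \<otimes> g) \<notin> H"
    and two: "h \<in> H \<Longrightarrow> inv g \<otimes> (h \<otimes> g) \<in> H \<or> inv g \<otimes> (inv h0 \<otimes> (h \<otimes> g)) \<in> H"
    and anti: "\<lbrakk>h \<in> H; h' \<in> H\<rbrakk> \<Longrightarrow> h \<otimes> g \<otimes> h' \<noteq> inv g"
    and normal_factor: "\<lbrakk>M \<lhd> G; M \<noteq> {\<one>}; x \<in> carrier G\<rbrakk> \<Longrightarrow> \<exists>m\<in>M. inv m \<otimes> x \<in> H"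
begin

lemma H_carrier [simp]: "h \<in> H \<Longrightarrow> h \<in> carrier G"
  using subgroup.mem_carrier[OF H_sub] .

lemma H_closed [simp]: "\<one> \<in> H" "\<lbrakk>x \<in> H; y \<in> H\<rbrakk> \<Longrightarrow> x \<otimes> y \<in> H" "x \<in> H \<Longrightarrow> inv x \<in> H"
  using subgroup.one_closed[OF H_sub] subgroup.m_closed[OF H_sub]
    subgroup.m_inv_closed[OF H_sub] by auto

lemma inv_cancel [simp]:
  "\<lbrakk>x \<in> carrier G; y \<in> carrier G\<rbrakk> \<Longrightarrow> inv x \<otimes> (x \<otimes> y) = y"
  "\<lbrakk>x \<in> carrier G; y \<in> carrier G\<rbrakk> \<Longrightarrow> x \<otimes> (inv x \<otimes> y) = y"
  by (simp_all flip: m_assoc)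

lemma H_inv_iff: "\<lbrakk>x \<in> carrier G; y \<in> carrier G\<rbrakk> \<Longrightarrow> inv x \<otimes> y \<in> H \<longleftrightarrow> inv y \<otimes> x \<in> H"
  using H_closed(3)[of "inv x \<otimes> y"] H_closed(3)[of "inv y \<otimes> x"] by (auto simp: inv_mult_group)

lemma g_notin: "g \<notin> H"
  using anti[of "inv g" "inv g"] by auto

section \<open>Left cosets and the action on them\<close>

definition cl :: "'a \<Rightarrow> 'a set" where "cl x = {y \<in> carrier G. inv x \<otimes> y \<in> H}"

text \<open>A numbering of the left cosets of \<open>H\<close>.\<close>

definition nu :: "'a \<Rightarrow> nat" where
  "nu x = (SOME f. inj_on f (cl ` carrier G)) (cl x)"

lemma cl_eq_iff:
  assumes "x \<in> carrier G" "y \<in> carrier G" shows "cl x = cl y \<longleftrightarrow> inv x \<otimes> y \<in> H"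
proof
  assume "cl x = cl y"
  moreover have "y \<in> cl y" using assms by (simp add: cl_def)
  ultimately show "inv x \<otimes> y \<in> H" by (auto simp: cl_def)
next
  have sub: "cl x \<subseteq> cl y" if "x \<in> carrier G" "y \<in> carrier G" "inv x \<otimes> y \<in> H" for x y
  proof
    fix z assume z: "z \<in> cl x"
    then have "inv (inv x \<otimes> y) \<otimes> (inv x \<otimes> z) \<in> H" using that by (simp add: cl_def)
    then show "z \<in> cl y" using that z by (simp add: cl_def inv_mult_group m_assoc)
  qed
  assume "inv x \<otimes> y \<in> H"
  then show "cl x = cl y" using sub[of x y] sub[of y x] H_inv_iff assms by blast
qed

lemma nu_eq_iff:
  assumes "x \<in> carrier G" "y \<in> carrier G" shows "nu x = nu y \<longleftrightarrow> inv x \<otimes> y \<in> H"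
proof -
  have "\<exists>f :: 'a set \<Rightarrow> nat. inj_on f (cl ` carrier G)"
    using finite_imp_inj_to_nat_seg[of "cl ` carrier G"] finite_carrier by blast
  then have "inj_on (SOME f :: 'a set \<Rightarrow> nat. inj_on f (cl ` carrier G)) (cl ` carrier G)"
    by (rule someI_ex)
  then show ?thesis using cl_eq_iff[OF assms] assms unfolding nu_def by (auto simp: inj_on_def)
qed

definition X where "X = nu ` carrier G"

lemma X_ne: "X \<noteq> {}"
  using one_closed by (auto simp: X_def)

definition perm :: "'a \<Rightarrow> nat \<Rightarrow> nat" where
  "perm k = (\<lambda>v\<in>X. nu (k \<otimes> inv_into (carrier G) nu v))"

lemma nu_X [simp]: "x \<in> carrier G \<Longrightarrow> nu x \<in> X"
  by (simp add: X_def)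

lemma X_nu: "v \<in> X \<Longrightarrow> \<exists>x\<in>carrier G. v = nu x"
  by (auto simp: X_def)

lemma perm_nu [simp]:
  assumes "k \<in> carrier G" "x \<in> carrier G" shows "perm k (nu x) = nu (k \<otimes> x)"
proof -
  let ?r = "inv_into (carrier G) nu (nu x)"
  have r: "?r \<in> carrier G" "nu ?r = nu x"
    using assms by (auto intro: inv_into_into f_inv_into_f)
  then have "nu (k \<otimes> ?r) = nu (k \<otimes> x)" using assms by (simp add: nu_eq_iff inv_mult_group m_assoc)
  then show ?thesis using assms by (simp add: perm_def)
qed

lemma perm_Bij: assumes "k \<in> carrier G" shows "perm k \<in> Bij X"
proof -
  have "bij_betw (perm k) X X"
    by (rule bij_betwI[where g = "perm (inv k)"]) (use assms in \<open>auto dest!: X_nu\<close>)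
  then show ?thesis by (simp add: Bij_def perm_def)
qed

lemma finite_X: "finite X"
  using finite_carrier by (simp add: X_def)

definition Gp where "Gp = perm ` carrier G"

lemma perm_hom: "perm \<in> hom G (BijGroup X)"
proof (rule homI)
  fix k l assume kl: "k \<in> carrier G" "l \<in> carrier G"
  have "perm (k \<otimes> l) v = compose X (perm k) (perm l) v" for v
  proof (cases "v \<in> X")
    case True
    then show ?thesis using kl by (auto dest!: X_nu simp: compose_def m_assoc)
  qed (simp add: compose_def perm_def)
  then show "perm (k \<otimes> l) = perm k \<otimes>\<^bsub>BijGroup X\<^esub> perm l"
    using perm_Bij kl by (auto simp: BijGroup_def)
qed (use perm_Bij in \<open>simp add: BijGroup_def\<close>)

sublocale perm: group_hom G "BijGroup X" perm
  using is_group group_BijGroup perm_hom by (simp add: group_hom_def group_hom_axioms_def)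

declare perm.hom_mult [simp del] perm.hom_inv [simp del]

lemma Gp_subgroup: "subgroup Gp (BijGroup X)"
  unfolding Gp_def by (rule perm.img_is_subgroup)

lemma perm_fix_iff: "k \<in> carrier G \<Longrightarrow> perm k (nu \<one>) = nu \<one> \<longleftrightarrow> k \<in> H"
  using nu_eq_iff[of k \<one>] H_closed(3)[of "inv k"] by auto

text \<open>A nontrivial kernel would satisfy \<open>normal_factor\<close>, so \<open>g\<close>
  would be a kernel element times an element of \<open>H\<close>. The kernel fixes the base coset
  and lies in \<open>H\<close>, which would put \<open>g\<close> into \<open>H\<close>.\<close>

lemma perm_inj: "inj_on perm (carrier G)"
proof -
  let ?K = "kernel G (BijGroup X) perm"
  have "?K = {\<one>}"
  proof (rule ccontr)
    assume "?K \<noteq> {\<one>}"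
    then obtain m where m: "m \<in> ?K" "inv m \<otimes> g \<in> H"
      using normal_factor[OF perm.normal_kernel _ g_carrier] by blast
    then have mG: "m \<in> carrier G" "perm m = \<one>\<^bsub>BijGroup X\<^esub>" by (auto simp: kernel_def)
    then have "perm m (nu \<one>) = nu \<one>" by (simp add: BijGroup_def)
    then have mH: "m \<in> H" using perm_fix_iff mG by blast
    have "m \<otimes> (inv m \<otimes> g) \<in> H" by (rule H_closed(2)[OF mH m(2)])
    moreover have "m \<otimes> (inv m \<otimes> g) = g" using mG by simp
    ultimately show False using g_notin by metis
  qed
  then show ?thesis by (rule perm.trivial_ker_imp_inj)
qed

lemma perm_eq_one_iff: "k \<in> carrier G \<Longrightarrow> perm k = \<one>\<^bsub>BijGroup X\<^esub> \<longleftrightarrow> k = \<one>"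
  using inj_on_eq_iff[OF perm_inj, of k \<one>] perm.hom_one by simp

lemma perm_iso: "perm \<in> iso G (perm_group X Gp)"
proof -
  have "perm \<in> hom G (perm_group X Gp)"
    using perm_hom by (auto simp: hom_def perm_group_def Gp_def)
  moreover have "bij_betw perm (carrier G) Gp"
    using perm_inj by (simp add: bij_betw_def Gp_def)
  ultimately show ?thesis by (simp add: iso_def)
qed

section \<open>Arcs and valencies\<close>

definition D where "D = {(nu x, nu (x \<otimes> g)) | x. x \<in> carrier G}"

lemma D_I: "x \<in> carrier G \<Longrightarrow> (nu x, nu (x \<otimes> g)) \<in> D"
  by (auto simp: D_def)

lemma D_X: "D \<subseteq> X \<times> X"
  by (auto simp: D_def)

lemma D_perm:
  assumes "k \<in> carrier G" "(u, v) \<in> D" shows "(perm k u, perm k v) \<in> D"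
proof -
  obtain x where "x \<in> carrier G" "u = nu x" "v = nu (x \<otimes> g)" using assms by (auto simp: D_def)
  then show ?thesis using assms D_I[of "k \<otimes> x"] by (simp add: m_assoc)
qed

lemma perm_inv_perm [simp]: "\<lbrakk>k \<in> carrier G; v \<in> X\<rbrakk> \<Longrightarrow> perm (inv k) (perm k v) = v"
  by (auto dest!: X_nu)

lemma D_perm_iff:
  assumes "k \<in> carrier G" "u \<in> X" "v \<in> X" shows "(perm k u, perm k v) \<in> D \<longleftrightarrow> (u, v) \<in> D"
  using D_perm[of k u v] D_perm[of "inv k" "perm k u" "perm k v"] assms by auto

text \<open>Two opposite arcs would place \<open>inv g\<close> in the double coset of
  \<open>g\<close>, which \<open>anti\<close> forbids.\<close>

lemma D_disjoint: "D \<inter> D\<inverse> = {}"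
proof -
  have False if uv: "(u, v) \<in> D" "(v, u) \<in> D" for u v
  proof -
    obtain x where x: "x \<in> carrier G" "u = nu x" "v = nu (x \<otimes> g)" using uv by (auto simp: D_def)
    obtain y where y: "y \<in> carrier G" "v = nu y" "u = nu (y \<otimes> g)" using uv by (auto simp: D_def)
    define h where "h = inv (x \<otimes> g) \<otimes> y"
    define h' where "h' = inv x \<otimes> (y \<otimes> g)"
    have h: "h \<in> H" "h' \<in> H" using x y nu_eq_iff[of "x \<otimes> g" y] nu_eq_iff[of x "y \<otimes> g"]
      by (simp_all add: h_def h'_def)
    have "g \<otimes> h = inv x \<otimes> y" using x y by (simp add: h_def inv_mult_group m_assoc)
    then have "g \<otimes> h \<otimes> g = h'" using x y by (simp add: h'_def m_assoc)
    moreover have "g \<otimes> (h \<otimes> g \<otimes> inv h') = (g \<otimes> h \<otimes> g) \<otimes> inv h'" using h by (simp add: m_assoc)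
    ultimately have "g \<otimes> (h \<otimes> g \<otimes> inv h') = \<one>" using h by simp
    then have "inv (h \<otimes> g \<otimes> inv h') = g" using h by (intro inv_equality) auto
    moreover have "inv (inv (h \<otimes> g \<otimes> inv h')) = h \<otimes> g \<otimes> inv h'" using h by simp
    ultimately have "h \<otimes> g \<otimes> inv h' = inv g" by simp
    then show False using anti[OF h(1) H_closed(3)[OF h(2)]] by contradiction
  qed
  then show ?thesis by auto
qed

text \<open>The out-neighbours of the base coset are the cosets of \<open>h \<otimes> g\<close> with
  \<open>h\<close> in \<open>H\<close>. The assumption \<open>two\<close> leaves at most two of
  them, and \<open>h0\<close> separates these.\<close>

lemma D_out_card: "v \<in> X \<Longrightarrow> card (D `` {v}) = 2"
proof -
  assume "v \<in> X"
  then obtain x where x: "x \<in> carrier G" "v = nu x" using X_nu by blast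
  have H0: "h0 \<in> carrier G" using h0 by simp
  have "D `` {nu \<one>} = {nu g, nu (h0 \<otimes> g)}"
  proof (intro equalityI subsetI)
    fix v assume "v \<in> D `` {nu \<one>}"
    then obtain h where h: "h \<in> carrier G" "nu \<one> = nu h" "v = nu (h \<otimes> g)" by (auto simp: D_def)
    then have hH: "h \<in> H" using nu_eq_iff[of \<one> h] by simp
    from two[OF hH] show "v \<in> {nu g, nu (h0 \<otimes> g)}"
    proof
      assume "inv g \<otimes> (h \<otimes> g) \<in> H"
      then have "nu g = nu (h \<otimes> g)" using h by (simp add: nu_eq_iff)
      then show ?thesis using h by simp
    next
      assume "inv g \<otimes> (inv h0 \<otimes> (h \<otimes> g)) \<in> H"
      then have "nu (h0 \<otimes> g) = nu (h \<otimes> g)" using h H0 by (simp add: nu_eq_iff inv_mult_group m_assoc)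
      then show ?thesis using h by simp
    qed
  next
    fix v assume v: "v \<in> {nu g, nu (h0 \<otimes> g)}"
    have "nu \<one> = nu h0" using h0 H0 by (simp add: nu_eq_iff)
    then show "v \<in> D `` {nu \<one>}" using v D_I[of \<one>] D_I[OF H0] by auto
  qed
  moreover have "nu g \<noteq> nu (h0 \<otimes> g)" using h0 H0 by (simp add: nu_eq_iff)
  ultimately have "card (D `` {nu \<one>}) = 2" by simp
  moreover have "bij_betw (perm x) X X" using perm_Bij[OF x(1)] by (simp add: Bij_def)
  then have "card (D `` {perm x (nu \<one>)}) = card (D `` {nu \<one>})"
    by (rule card_Image_bij[OF _ D_X]) (use D_perm_iff x in auto)
  ultimately show ?thesis using x by simp
qed

lemma D_in_card: "v \<in> X \<Longrightarrow> card (D\<inverse> `` {v}) = 2"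
proof -
  have eq: "card (D\<inverse> `` {v}) = card (D\<inverse> `` {nu \<one>})" if vX: "v \<in> X" for v
  proof -
    obtain x where x: "x \<in> carrier G" "v = nu x" using X_nu[OF vX] by blast
    have "bij_betw (perm x) X X" using perm_Bij[OF x(1)] by (simp add: Bij_def)
    then have "card (D\<inverse> `` {perm x (nu \<one>)}) = card (D\<inverse> `` {nu \<one>})"
      by (rule card_Image_bij) (use D_perm_iff D_X x in auto)
    then show ?thesis using x by simp
  qed
  have "2 = card (D\<inverse> `` {nu \<one>})"
    by (rule regular_digraph_degrees_eq[OF finite_X X_ne D_X D_out_card eq])
  then show "v \<in> X \<Longrightarrow> card (D\<inverse> `` {v}) = 2" using eq[of v] by linarith
qed

section \<open>The coset graph as a basic pair\<close>

definition graph :: "nat pair_pre_digraph" where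
  "graph = \<lparr>pverts = X, parcs = D \<union> D\<inverse>\<rparr>"

lemma graph_simps [simp]: "pverts graph = X" "parcs graph = D \<union> D\<inverse>"
  by (simp_all add: graph_def)

lemma pair_graph_graph: "pair_graph graph"
proof
  have "D \<subseteq> X \<times> X" "finite (X \<times> X)" using D_X finite_X by auto
  then show "finite (parcs graph)" using finite_subset by auto
  have "u \<noteq> v" if "(u, v) \<in> D" for u v using that D_disjoint by blast
  then show "fst e \<noteq> snd e" if "e \<in> parcs graph" for e using that by force
  show "symmetric (with_proj graph)" by (auto simp: symmetric_def sym_def)
qed (use D_X finite_X in auto)

lemma graph_connected: "connected (with_proj graph)"
proof -
  interpret g: pair_graph graph by (rule pair_graph_graph)
  interpret S: pair_wf_digraph "mk_symmetric (with_proj graph)"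
    by (rule g.wellformed_mk_symmetric)
  have E: "parcs (mk_symmetric (with_proj graph)) = D \<union> D\<inverse>"
    by (auto simp: parcs_mk_symmetric)
  \<comment> \<open>Letters from \<open>H\<close> at the end of a word do not change the coset, and
    a letter \<open>g\<close> or its inverse is an edge. The start \<open>x\<close> varies because
    later letters act from an already moved coset.\<close>
  have step: "(nu x, nu (x \<otimes> y)) \<in> (D \<union> D\<inverse>)\<^sup>*" if "y \<in> generate G (H \<union> {g})" "x \<in> carrier G" for x y
    using that
  proof (induction y arbitrary: x rule: generate.induct)
    case one
    then show ?case by simp
  next
    case (incl h)
    from incl(1) show ?case
    proof
      assume "h \<in> H"
      then have "nu x = nu (x \<otimes> h)" using incl by (simp add: nu_eq_iff)
      then show ?thesis by simp
    next
      assume "h \<in> {g}"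
      then show ?thesis using D_I incl by auto
    qed
  next
    case (inv h)
    from inv(1) show ?case
    proof
      assume "h \<in> H"
      then have "nu x = nu (x \<otimes> inv h)" using inv by (simp add: nu_eq_iff)
      then show ?thesis by simp
    next
      assume "h \<in> {g}"
      then have "(nu (x \<otimes> inv h), nu x) \<in> D" using D_I[of "x \<otimes> inv g"] inv by (simp add: m_assoc)
      then show ?thesis by auto
    qed
  next
    case (eng y z)
    then have "y \<in> carrier G" "z \<in> carrier G" using gen by auto
    then show ?case using eng.IH(1)[of x] eng.IH(2)[of "x \<otimes> y"] eng.prems by (simp add: m_assoc)
  qed
  have "(u, v) \<in> (D \<union> D\<inverse>)\<^sup>*" if uv: "u \<in> X" "v \<in> X" for u v
  proof -
    obtain x y where "x \<in> carrier G" "u = nu x" "y \<in> carrier G" "v = nu y" using X_nu uv by blast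
    then show ?thesis using step[of "inv x \<otimes> y" x] gen by simp
  qed
  then show ?thesis
    using X_ne unfolding connected_def strongly_connected_def S.reachable_conv E by simp
qed

lemma arc_perm:
  assumes "(u, v) \<in> D" shows "\<exists>k\<in>carrier G. perm k (nu \<one>) = u \<and> perm k (nu g) = v"
proof -
  obtain x where "x \<in> carrier G" "u = nu x" "v = nu (x \<otimes> g)" using assms by (auto simp: D_def)
  then show ?thesis by (intro bexI[of _ x]) auto
qed

lemma graph_OG4: "(graph, Gp) \<in> OG4"
proof -
  interpret g: pair_graph graph by (rule pair_graph_graph)
  have deg: "out_degree (with_proj graph) v = 4" if v: "v \<in> X" for v
  proof -
    have fin: "finite (D `` {v})" "finite (D\<inverse> `` {v})"
      using D_X by (auto intro: finite_subset[OF _ finite_X])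
    have "out_arcs (with_proj graph) v = Pair v ` (D `` {v} \<union> D\<inverse> `` {v})"
      by (auto simp: out_arcs_def)
    then have "out_degree (with_proj graph) v = card (D `` {v} \<union> D\<inverse> `` {v})"
      by (simp add: out_degree_def card_image inj_on_def)
    also have "\<dots> = card (D `` {v}) + card (D\<inverse> `` {v})"
      using D_disjoint by (intro card_Un_disjoint fin) auto
    finally show ?thesis using D_out_card D_in_card v by simp
  qed
  have aut: "Gp \<subseteq> graph_aut graph"
    using perm_Bij D_perm_iff by (auto simp: Gp_def graph_aut_def)
  have trans: "transitive_on X Gp"
    unfolding transitive_on_iff[OF Gp_subgroup]
  proof (intro ballI)
    fix u v assume "u \<in> X" "v \<in> X"
    then obtain x y where "x \<in> carrier G" "u = nu x" "y \<in> carrier G" "v = nu y" using X_nu by blast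
    then have "perm (y \<otimes> inv x) u = v" "y \<otimes> inv x \<in> carrier G" by (simp_all add: m_assoc)
    then show "\<exists>k\<in>Gp. k u = v" unfolding Gp_def by blast
  qed
  have "\<exists>k\<in>Gp. {k x, k y} = {u, v}" if "(x, y) \<in> D \<union> D\<inverse>" "(u, v) \<in> D \<union> D\<inverse>" for x y u v
  proof -
    have arcs: "\<exists>k\<in>Gp. k x = u \<and> k y = v" if xy: "(x, y) \<in> D" and uv: "(u, v) \<in> D" for x y u v
    proof -
      obtain k where k: "k \<in> carrier G" "perm k (nu \<one>) = x" "perm k (nu g) = y" using arc_perm[OF xy] by blast
      obtain l where l: "l \<in> carrier G" "perm l (nu \<one>) = u" "perm l (nu g) = v" using arc_perm[OF uv] by blast
      have "perm (l \<otimes> inv k) x = u" "perm (l \<otimes> inv k) y = v"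
        using k l by (auto simp: m_assoc)
      then show ?thesis using k l unfolding Gp_def by blast
    qed
    from that have "(x, y) \<in> D \<or> (y, x) \<in> D" "(u, v) \<in> D \<or> (v, u) \<in> D" by auto
    then obtain k where "k \<in> Gp" "k x = u \<and> k y = v \<or> k x = v \<and> k y = u"
      using arcs[of x y u v] arcs[of y x u v] arcs[of x y v u] arcs[of y x v u] by blast
    then show ?thesis by (intro bexI[of _ k]) auto
  qed
  then have edge: "edge_transitive graph Gp" unfolding edge_transitive_def by auto
  have "orbit (perm_group X Gp) (\<lambda>g. map_prod g g) (nu \<one>, nu g) = {(perm k (nu \<one>), perm k (nu g)) | k. k \<in> carrier G}"
    by (auto simp: orbit_def Gp_def)
  also have "\<dots> = D" by (force simp: D_def)
  finally have "\<exists>\<Delta>. \<Delta> = orbit (perm_group X Gp) (\<lambda>g. map_prod g g) (nu \<one>, nu g) \<and>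
      \<Delta> \<inter> \<Delta>\<inverse> = {} \<and> D \<union> D\<inverse> = \<Delta> \<union> \<Delta>\<inverse>"
    using D_disjoint by simp
  then have "oriented_by graph Gp"
    unfolding oriented_by_def graph_simps using nu_X[OF one_closed] nu_X[OF g_carrier] by (intro bexI)
  then show ?thesis
    using pair_graph_graph graph_connected deg aut trans edge Gp_subgroup by (simp add: OG4_def)
qed

text \<open>A normal subgroup pulled back along \<open>perm\<close> meets every left coset of
  \<open>H\<close> by \<open>normal_factor\<close>, so it moves the base coset to every
  vertex.\<close>

lemma graph_basic_quasiprimitive: "basic_quasiprimitive graph Gp"
proof -
  interpret P: group "perm_group X Gp" by (rule perm_group_is_group[OF Gp_subgroup])
  have "transitive_on X N" if N: "N \<lhd> perm_group X Gp" "N \<noteq> {\<one>\<^bsub>perm_group X Gp\<^esub>}" for N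
  proof -
    have subP: "subgroup N (perm_group X Gp)" using N normal_imp_subgroup by blast
    then have sub: "subgroup N (BijGroup X)"
      using group.incl_subgroup[OF group_BijGroup Gp_subgroup] by (simp add: perm_group_def)
    define M where "M = inv_into (carrier G) perm ` N"
    have iso: "inv_into (carrier G) perm \<in> iso (perm_group X Gp) G" by (rule iso_set_sym[OF perm_iso])
    have M: "M \<lhd> G" unfolding M_def by (rule iso_normal_subgroup[OF iso P.is_group is_group N(1)])
    have NGp: "N \<subseteq> Gp" using subgroup.subset[OF subP] by simp
    have pM: "perm m \<in> N" if mM: "m \<in> M" for m
    proof -
      obtain n where n: "n \<in> N" "m = inv_into (carrier G) perm n" using mM by (auto simp: M_def)
      then have "n \<in> perm ` carrier G" using NGp by (auto simp: Gp_def)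
      then show ?thesis using n by (simp add: f_inv_into_f)
    qed
    have "M \<noteq> {\<one>}"
    proof
      assume M1: "M = {\<one>}"
      have "n = \<one>\<^bsub>perm_group X Gp\<^esub>" if n: "n \<in> N" for n
      proof -
        have "inv_into (carrier G) perm n = \<one>" using M1 n by (auto simp: M_def)
        moreover have "n \<in> perm ` carrier G" using n NGp by (auto simp: Gp_def)
        ultimately have "n = perm \<one>" using f_inv_into_f by metis
        then show ?thesis using perm.hom_one by (simp add: BijGroup_def)
      qed
      then show False using N(2) subgroup.one_closed[OF subP] by blast
    qed
    then have ex: "\<exists>m\<in>M. nu x = perm m (nu \<one>)" if "x \<in> carrier G" for x
    proof -
      obtain m where m: "m \<in> M" "inv m \<otimes> x \<in> H" using normal_factor[OF M \<open>M \<noteq> {\<one>}\<close> \<open>x \<in> carrier G\<close>] by blast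
      then have "m \<in> carrier G" using M normal_imp_subgroup subgroup.mem_carrier by metis
      then show ?thesis using m that by (intro bexI[of _ m]) (auto simp: nu_eq_iff[symmetric])
    qed
    show ?thesis unfolding transitive_on_iff[OF sub]
    proof (intro ballI)
      fix u v assume "u \<in> X" "v \<in> X"
      then obtain x y where xy: "x \<in> carrier G" "u = nu x" "y \<in> carrier G" "v = nu y" using X_nu by blast
      obtain m n where mn: "m \<in> M" "u = perm m (nu \<one>)" "n \<in> M" "v = perm n (nu \<one>)"
        using ex xy by metis
      have mnG: "m \<in> carrier G" "n \<in> carrier G"
        using mn M normal_imp_subgroup subgroup.mem_carrier by metis+
      have "n \<otimes> inv m \<in> M" using mn normal_imp_subgroup[OF M]
        by (simp add: subgroup.m_closed subgroup.m_inv_closed)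
      then have "perm (n \<otimes> inv m) \<in> N" by (rule pM)
      moreover have "perm (n \<otimes> inv m) u = v" using mn mnG by (simp add: m_assoc)
      ultimately show "\<exists>k\<in>N. k u = v" by blast
    qed
  qed
  then show ?thesis using graph_OG4
    by (auto simp: basic_quasiprimitive_def quasiprimitive_on_def)
qed

text \<open>With \<open>H\<close> of order at most 4 this bounds the number of vertices from below,
  which makes the orders of the examples unbounded.\<close>

lemma card_carrier_le: "card (carrier G) \<le> card X * card H"
proof -
  let ?r = "inv_into (carrier G) nu"
  let ?f = "\<lambda>x. (nu x, inv (?r (nu x)) \<otimes> x)"
  have r: "?r (nu x) \<in> carrier G" "nu (?r (nu x)) = nu x" if "x \<in> carrier G" for x
    using that by (auto intro: inv_into_into f_inv_into_f)
  have "inj_on ?f (carrier G)"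
  proof (rule inj_onI)
    fix x y assume xy: "x \<in> carrier G" "y \<in> carrier G" "?f x = ?f y"
    then have "nu x = nu y" by simp
    then have "inv (?r (nu x)) \<otimes> x = inv (?r (nu x)) \<otimes> y" using xy(3) by simp
    then have "?r (nu x) \<otimes> (inv (?r (nu x)) \<otimes> x) = ?r (nu x) \<otimes> (inv (?r (nu x)) \<otimes> y)"
      by (simp only:)
    then show "x = y" using xy(1,2) r(1) by simp
  qed
  moreover have "?f ` carrier G \<subseteq> X \<times> H" using r nu_eq_iff by auto
  moreover have "finite H" using finite_carrier subgroup.subset[OF H_sub] finite_subset by blast
  ultimately have "card (carrier G) \<le> card (X \<times> H)"
    using finite_X by (intro card_inj_on_le) auto
  then show ?thesis by (simp add: card_cartesian_product)
qed

lemma unique_minimal_normal_perm: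
  assumes M: "M \<lhd> G" "M \<noteq> {\<one>}" and le: "\<And>L. \<lbrakk>L \<lhd> G; L \<noteq> {\<one>}\<rbrakk> \<Longrightarrow> M \<subseteq> L"
    and T: "finite_nonabelian_simple T" "G\<lparr>carrier := M\<rparr> \<cong> direct_power T k"
  shows "unique_minimal_normal_power X Gp (perm ` M) T k"
proof -
  let ?P = "perm_group X Gp"
  interpret P: group ?P by (rule perm_group_is_group[OF Gp_subgroup])
  have MG: "M \<subseteq> carrier G" and subM: "subgroup M G"
    using M normal_imp_subgroup subgroup.subset by blast+
  have p1: "perm \<one> = \<one>\<^bsub>?P\<^esub>" using perm.hom_one by (simp add: BijGroup_def)
  have N: "perm ` M \<lhd> ?P" by (rule iso_normal_subgroup[OF perm_iso is_group P.is_group M(1)])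
  have N1: "perm ` L \<noteq> {\<one>\<^bsub>?P\<^esub>}" if L: "L \<noteq> {\<one>}" "subgroup L G" for L
  proof -
    obtain l where l: "l \<in> L" "l \<noteq> \<one>" using L subgroup.one_closed[of L G] by blast
    then have "perm l \<noteq> \<one>\<^bsub>BijGroup X\<^esub>" using perm_eq_one_iff subgroup.mem_carrier[OF L(2)] by blast
    then have "perm l \<notin> {\<one>\<^bsub>?P\<^esub>}" using p1 perm.hom_one by simp
    then show ?thesis using l by blast
  qed
  have Nle: "perm ` M \<subseteq> L" if L: "L \<lhd> ?P" "L \<noteq> {\<one>\<^bsub>?P\<^esub>}" for L
  proof -
    let ?i = "inv_into (carrier G) perm"
    have LG: "L \<subseteq> perm ` carrier G"
      using subgroup.subset[OF normal_imp_subgroup[OF L(1)]] by (simp add: Gp_def)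
    have iso: "?i \<in> iso ?P G" by (rule iso_set_sym[OF perm_iso])
    have iL: "?i ` L \<lhd> G" by (rule iso_normal_subgroup[OF iso P.is_group is_group L(1)])
    have pi: "perm ` ?i ` L = L" using LG by (simp add: image_inv_into_cancel[OF refl])
    have "?i ` L \<noteq> {\<one>}"
    proof
      assume "?i ` L = {\<one>}"
      then have "L = {perm \<one>}" using pi by auto
      then show False using L p1 by simp
    qed
    then have "M \<subseteq> ?i ` L" using le iL by blast
    then show ?thesis using pi by (metis image_mono)
  qed
  have "unique_minimal_normal (perm ` M) ?P"
    unfolding unique_minimal_normal_def minimal_normal_def
    using N N1[OF M(2) subM] Nle by blast
  moreover have "perm_group X (perm ` M) \<cong> direct_power T k"
  proof -
    have "restrict perm M \<in> iso (G\<lparr>carrier := M\<rparr>) (?P\<lparr>carrier := perm ` M\<rparr>)"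
      by (rule iso_restrict[OF perm_iso is_group P.is_group subM])
    then have "G\<lparr>carrier := M\<rparr> \<cong> perm_group X (perm ` M)"
      unfolding perm_group_carrier_update by (rule is_isoI)
    then have "perm_group X (perm ` M) \<cong> G\<lparr>carrier := M\<rparr>"
      using group.iso_sym subgroup_imp_group[OF subM] by blast
    then show ?thesis using T(2) iso_trans by blast
  qed
  ultimately show ?thesis using T(1) by (simp add: unique_minimal_normal_power_def)
qed

lemma not_regular_perm:
  assumes "m \<in> M" "m \<in> H" "m \<noteq> \<one>" shows "\<not> regular_on X (perm ` M)"
proof
  assume "regular_on X (perm ` M)"
  moreover have "perm m (nu \<one>) = nu \<one>" using perm_fix_iff assms by simp
  ultimately have "perm m = \<one>\<^bsub>BijGroup X\<^esub>" using assms nu_X[of \<one>] unfolding regular_on_def by blast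
  then show False using perm_eq_one_iff assms by simp
qed

end

section \<open>Examples\<close>

text \<open>The wreath product of \<open>T\<close> with the group of order two; the Boolean component is \<open>True\<close> outside
  the base group.\<close>

definition wr2 :: "('a, 'b) monoid_scheme \<Rightarrow> (('a \<times> 'a) \<times> bool) monoid" where
  "wr2 T = \<lparr>carrier = (carrier T \<times> carrier T) \<times> UNIV,
     monoid.mult = (\<lambda>(x, e) (y, f). (x \<otimes>\<^bsub>T \<times>\<times> T\<^esub> (if e then prod.swap y else y), e \<noteq> f)),
     one = ((\<one>\<^bsub>T\<^esub>, \<one>\<^bsub>T\<^esub>), False)\<rparr>"

text \<open>The input for both examples. From \<open>au\<close> the involution does not survive
  conjugation by \<open>a\<close>, which separates the two out-neighbours; \<open>anti_au\<close>
  excludes opposite arcs; the two power conditions serve the generation of the wreath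
  product.\<close>

locale involution_pair = simple_group T for T (structure) +
  fixes a u :: 'a and n :: nat
  assumes finite_T: "finite (carrier T)" and a_carrier [simp]: "a \<in> carrier T"
    and u_carrier [simp]: "u \<in> carrier T" and uu: "u \<otimes> u = \<one>" and au: "a \<otimes> u \<noteq> u \<otimes> a"
    and gen_au: "generate T {a, u} = carrier T"
    and anti_au: "\<lbrakk>x \<in> {\<one>, u}; y \<in> {\<one>, u}\<rbrakk> \<Longrightarrow> x \<otimes> a \<otimes> y \<noteq> inv a"
    and a_pow: "a [^] n = \<one>" and au_pow: "(a \<otimes> u) [^] n \<noteq> \<one>"
begin

lemma inv_cancel [simp]:
  "\<lbrakk>x \<in> carrier T; y \<in> carrier T\<rbrakk> \<Longrightarrow> inv x \<otimes> (x \<otimes> y) = y"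
  "\<lbrakk>x \<in> carrier T; y \<in> carrier T\<rbrakk> \<Longrightarrow> x \<otimes> (inv x \<otimes> y) = y"
  by (simp_all flip: m_assoc)

lemma inv_u [simp]: "inv u = u"
  using uu by (simp add: inv_equality)

lemma uu_cancel [simp]: "u \<otimes> u = \<one>" "x \<in> carrier T \<Longrightarrow> u \<otimes> (u \<otimes> x) = x"
  using uu by (simp_all flip: m_assoc)

lemma u_ne_one: "u \<noteq> \<one>"
  using au by auto

lemma conj_u_notin: "inv a \<otimes> (u \<otimes> a) \<notin> {\<one>, u}"
proof
  assume "inv a \<otimes> (u \<otimes> a) \<in> {\<one>, u}"
  then have "inv a \<otimes> (u \<otimes> a) = \<one> \<or> inv a \<otimes> (u \<otimes> a) = u" by blast
  then have "a \<otimes> (inv a \<otimes> (u \<otimes> a)) = a \<otimes> \<one> \<or> a \<otimes> (inv a \<otimes> (u \<otimes> a)) = a \<otimes> u" by metis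
  then have "u \<otimes> a = a \<or> u \<otimes> a = a \<otimes> u" by simp
  then show False using au u_ne_one by auto
qed

lemma nonabelian: "finite_nonabelian_simple T"
proof -
  have "\<not> comm_group T"
    using comm_monoid.m_comm[OF comm_group.axioms(1), of T a u] au by auto
  then show ?thesis using finite_T is_simple_group by (simp add: finite_nonabelian_simple_def)
qed

lemma centre_trivial:
  assumes "x \<in> carrier T" "x \<noteq> \<one>" shows "\<exists>t\<in>carrier T. x \<otimes> t \<noteq> t \<otimes> x"
proof (rule ccontr)
  assume *: "\<not> ?thesis"
  let ?Z = "{g \<in> carrier T. \<forall>n\<in>carrier T. cj g n = n}"
  have "?Z \<lhd> T" using centralizer_normal[of "carrier T"] nsub_carrier[of "carrier T"]
    by (simp add: nsub_def subgroup_self)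
  moreover have "x \<in> ?Z" using * assms cj_fix_iff by auto
  ultimately have "?Z = carrier T" using no_real_normal_subgroup assms(2) by blast
  then have "cj a u = u" using a_carrier u_carrier by blast
  then show False using au cj_fix_iff by simp
qed

text \<open>The vertex stabiliser has order two. The last conjunct is twice the bound
  \<open>card_carrier_le\<close>, in the form shared with the wreath product example.\<close>

lemma simple_example:
  "\<exists>(\<Gamma> :: nat pair_pre_digraph) G N. basic_quasiprimitive \<Gamma> G \<and>
    unique_minimal_normal_power (pverts \<Gamma>) G N T 1 \<and> 2 * card (carrier T) \<le> 4 * card (pverts \<Gamma>)"
proof -
  interpret S: coset_digraph T "{\<one>, u}" a u
  proof (intro coset_digraph.intro coset_digraph_axioms.intro is_group)
    show "subgroup {\<one>, u} T" by (rule subgroupI) auto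
    have "generate T {a, u} \<subseteq> generate T ({\<one>, u} \<union> {a})" by (rule mono_generate) auto
    then show "generate T ({\<one>, u} \<union> {a}) = carrier T"
      using gen_au generate_incl[of "{\<one>, u} \<union> {a}"] by auto
    show "inv a \<otimes> (u \<otimes> a) \<notin> {\<one>, u}" by (rule conj_u_notin)
    show "inv a \<otimes> (h \<otimes> a) \<in> {\<one>, u} \<or> inv a \<otimes> (inv u \<otimes> (h \<otimes> a)) \<in> {\<one>, u}"
      if "h \<in> {\<one>, u}" for h using that by auto
    show "h \<otimes> a \<otimes> h' \<noteq> inv a" if "h \<in> {\<one>, u}" "h' \<in> {\<one>, u}" for h h'
      using anti_au that by blast
    show "\<exists>m\<in>M. inv m \<otimes> x \<in> {\<one>, u}" if "M \<lhd> T" "M \<noteq> {\<one>}" "x \<in> carrier T" for M x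
      using no_real_normal_subgroup[OF that(1)] that(2,3) by (intro bexI[of _ x]) auto
  qed (use finite_T in auto)
  have "T \<cong> direct_power T 1" using iso_direct_power_1 by (rule is_isoI)
  then have "unique_minimal_normal_power S.X S.Gp (S.perm ` carrier T) T 1"
    using nonabelian no_real_normal_subgroup simple_not_triv nsub_carrier[of "carrier T"]
    by (intro S.unique_minimal_normal_perm) (auto simp: nsub_def subgroup_self)
  moreover have "card {\<one>, u} = 2" using u_ne_one by simp
  then have "2 * card (carrier T) \<le> 4 * card S.X" using S.card_carrier_le by simp
  ultimately show ?thesis using S.graph_basic_quasiprimitive
    by (intro exI[of _ S.graph] exI[of _ S.Gp] exI[of _ "S.perm ` carrier T"]) simp
qed

section \<open>The wreath product example\<close>

abbreviation W where "W \<equiv> wr2 T"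

lemma W_carrier [simp]: "((x, y), e) \<in> carrier W \<longleftrightarrow> x \<in> carrier T \<and> y \<in> carrier T"
  by (simp add: wr2_def)

lemma W_one [simp]: "\<one>\<^bsub>W\<^esub> = ((\<one>, \<one>), False)"
  by (simp add: wr2_def)

lemma W_mult [simp]:
  "((x, y), False) \<otimes>\<^bsub>W\<^esub> ((z, t), f) = ((x \<otimes> z, y \<otimes> t), f)"
  "((x, y), True) \<otimes>\<^bsub>W\<^esub> ((z, t), f) = ((x \<otimes> t, y \<otimes> z), \<not> f)"
  by (auto simp: wr2_def)

lemma W_cases: "w \<in> carrier W \<Longrightarrow> \<exists>x\<in>carrier T. \<exists>y\<in>carrier T. w = ((x, y), False) \<or> w = ((x, y), True)"
  by (cases w; cases "snd w") (auto simp: wr2_def)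

lemma W_group: "group W"
proof (rule groupI)
  fix w v z assume "w \<in> carrier W" "v \<in> carrier W" "z \<in> carrier W"
  then show "(w \<otimes>\<^bsub>W\<^esub> v) \<otimes>\<^bsub>W\<^esub> z = w \<otimes>\<^bsub>W\<^esub> (v \<otimes>\<^bsub>W\<^esub> z)"
    by (auto dest!: W_cases simp: m_assoc)
next
  fix w assume "w \<in> carrier W"
  then obtain x y where xy: "x \<in> carrier T" "y \<in> carrier T" "w = ((x, y), False) \<or> w = ((x, y), True)"
    using W_cases by blast
  from xy(3) show "\<exists>v\<in>carrier W. v \<otimes>\<^bsub>W\<^esub> w = \<one>\<^bsub>W\<^esub>"
  proof
    assume "w = ((x, y), False)"
    then show ?thesis using xy(1,2) by (intro bexI[of _ "((inv x, inv y), False)"]) auto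
  next
    assume "w = ((x, y), True)"
    then show ?thesis using xy(1,2) by (intro bexI[of _ "((inv y, inv x), True)"]) auto
  qed
qed (auto dest!: W_cases)

sublocale W: group W by (rule W_group)

lemma W_inv [simp]:
  assumes "x \<in> carrier T" "y \<in> carrier T"
  shows "inv\<^bsub>W\<^esub> ((x, y), False) = ((inv x, inv y), False)"
    and "inv\<^bsub>W\<^esub> ((x, y), True) = ((inv y, inv x), True)"
  using assms by (auto intro!: W.inv_equality)

definition base where "base = {((x, y), False) | x y. x \<in> carrier T \<and> y \<in> carrier T}"

lemma base_normal: "base \<lhd> W"
proof (rule W.normal_cjI)
  show "subgroup base W"
  proof (rule W.subgroupI)
    have "((\<one>, \<one>), False) \<in> base" by (simp add: base_def)
    then show "base \<noteq> {}" by blast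
  qed (auto simp: base_def)
  show "W.cj g v \<in> base" if "g \<in> carrier W" "v \<in> base" for g v
    using that by (auto dest!: W_cases simp: base_def W.cj_def)
qed

lemma base_iso: "W\<lparr>carrier := base\<rparr> \<cong> direct_power T 2"
proof -
  have "bij_betw fst base (carrier T \<times> carrier T)"
    by (rule bij_betwI[where g = "\<lambda>p. (p, False)"]) (auto simp: base_def)
  then have "fst \<in> iso (W\<lparr>carrier := base\<rparr>) (T \<times>\<times> T)"
    by (auto simp: iso_def hom_def base_def)
  then show ?thesis using iso_direct_power_2[of T] by (meson is_isoI iso_trans)
qed

text \<open>Commuting with a base element brings \<open>L\<close> into the base group, and commuting
  with \<open>(t, \<one>)\<close> then clears the second coordinate. Simplicity of \<open>T\<close>
  fills the first factor, and the swap fills the other.\<close>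

lemma base_le_normal:
  assumes L: "L \<lhd> W" "L \<noteq> {\<one>\<^bsub>W\<^esub>}" shows "base \<subseteq> L"
proof -
  interpret L: normal L W by (fact L(1))
  have comm: "l \<otimes>\<^bsub>W\<^esub> W.cj k (inv\<^bsub>W\<^esub> l) \<in> L" if "l \<in> L" "k \<in> carrier W" for l k
    using that W.normal_cj[OF L(1)] by blast
  have swap: "((y, x), False) \<in> L" if "((x, y), False) \<in> L" for x y
  proof -
    have xy: "x \<in> carrier T" "y \<in> carrier T" using L.mem_carrier[OF that] by auto
    have "W.cj ((\<one>, \<one>), True) ((x, y), False) \<in> L" using W.normal_cj[OF L(1) _ that] by simp
    then show ?thesis using xy by (simp add: W.cj_def)
  qed
  obtain l where l: "l \<in> L" "l \<noteq> \<one>\<^bsub>W\<^esub>" using L(2) L.one_closed by blast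
  have "\<exists>x y. ((x, y), False) \<in> L \<and> (x \<noteq> \<one> \<or> y \<noteq> \<one>)"
  proof -
    obtain x y where xy: "x \<in> carrier T" "y \<in> carrier T" "l = ((x, y), False) \<or> l = ((x, y), True)"
      using W_cases[OF L.mem_carrier[OF l(1)]] by blast
    from xy(3) show ?thesis
    proof
      assume "l = ((x, y), False)"
      then show ?thesis using l by auto
    next
      assume lT: "l = ((x, y), True)"
      \<comment> \<open>The first coordinate of this commutator is \<open>u\<close> whatever
        \<open>x\<close> and \<open>y\<close> are, so it is nontrivial.\<close>
      have "l \<otimes>\<^bsub>W\<^esub> W.cj ((u, \<one>), False) (inv\<^bsub>W\<^esub> l) \<in> L" using comm[OF l(1)] by simp
      then have "((u, y \<otimes> (u \<otimes> inv y)), False) \<in> L" using xy(1,2) lT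
        by (simp add: W.cj_def m_assoc)
      then show ?thesis using u_ne_one by blast
    qed
  qed
  then obtain x y where xy: "((x, y), False) \<in> L" "x \<noteq> \<one>" using swap by metis
  then have xyT: "x \<in> carrier T" "y \<in> carrier T" using L.mem_carrier[OF xy(1)] by auto
  obtain t where t: "t \<in> carrier T" "x \<otimes> t \<noteq> t \<otimes> x" using centre_trivial[OF xyT(1) xy(2)] by blast
  define c where "c = x \<otimes> (t \<otimes> (inv x \<otimes> inv t))"
  have cT: "c \<in> carrier T" using xyT t by (simp add: c_def)
  have "((x, y), False) \<otimes>\<^bsub>W\<^esub> W.cj ((t, \<one>), False) (inv\<^bsub>W\<^esub> ((x, y), False)) \<in> L"
    using comm[OF xy(1)] t by simp
  then have c: "((c, \<one>), False) \<in> L" using xyT t by (simp add: W.cj_def c_def m_assoc)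
  have c1: "c \<noteq> \<one>"
  proof
    assume "c = \<one>"
    then have "c \<otimes> (t \<otimes> x) = t \<otimes> x" using t xyT by simp
    then show False using t xyT by (simp add: c_def m_assoc)
  qed
  define R where "R = {z \<in> carrier T. ((z, \<one>), False) \<in> L}"
  have "R \<lhd> T"
  proof (rule normal_cjI)
    show "subgroup R T"
    proof (rule subgroupI)
      show "R \<noteq> {}" using c cT by (auto simp: R_def)
      show "inv z \<in> R" if "z \<in> R" for z
        using that L.m_inv_closed[of "((z, \<one>), False)"] by (simp add: R_def)
      show "z \<otimes> w \<in> R" if "z \<in> R" "w \<in> R" for z w
        using that L.m_closed[of "((z, \<one>), False)" "((w, \<one>), False)"] by (simp add: R_def)
    qed (auto simp: R_def)
    show "cj k z \<in> R" if "k \<in> carrier T" "z \<in> R" for k z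
      using that W.normal_cj[OF L(1), of "((k, \<one>), False)" "((z, \<one>), False)"]
      by (simp add: R_def W.cj_def cj_def)
  qed
  moreover have "c \<in> R" using c cT by (simp add: R_def)
  ultimately have R: "R = carrier T" using no_real_normal_subgroup c1 by blast
  show ?thesis
  proof
    fix w assume "w \<in> base"
    then obtain x y where w: "w = ((x, y), False)" "x \<in> carrier T" "y \<in> carrier T" by (auto simp: base_def)
    then have "((x, \<one>), False) \<in> L" "((\<one>, y), False) \<in> L" using R swap by (auto simp: R_def)
    then have "((x, \<one>), False) \<otimes>\<^bsub>W\<^esub> ((\<one>, y), False) \<in> L" by (rule L.m_closed)
    then show "w \<in> L" using w by simp
  qed
qed

definition HW :: "(('a \<times> 'a) \<times> bool) set" where "HW = {((h, h), e) | h e. h \<in> {\<one>, u}}"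

definition gW where "gW = ((a, a \<otimes> u), False)"

text \<open>The \<open>n\<close>-th power of \<open>gW\<close> is \<open>(1, (a u)\<^sup>n)\<close>. The elements \<open>z\<close> with \<open>(1, z)\<close> in the generated subgroup
  form a normal subgroup of \<open>T\<close>, because the second coordinates of that subgroup exhaust \<open>T\<close>.\<close>

lemma HW_generate: "generate W (HW \<union> {gW}) = carrier W"
proof -
  define K where "K = generate W (HW \<union> {gW})"
  have HK: "HW \<union> {gW} \<subseteq> carrier W" by (auto simp: HW_def gW_def)
  have sub: "subgroup K W" unfolding K_def using HK by (rule W.generate_is_subgroup)
  interpret K: subgroup K W by (fact sub)
  have tau: "((\<one>, \<one>), True) \<in> K" and uK: "((u, u), False) \<in> K" and gK: "gW \<in> K"
    unfolding K_def by (auto simp: HW_def intro: generate.incl)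
  have pow: "gW [^]\<^bsub>W\<^esub> k = ((a [^] k, (a \<otimes> u) [^] k), False)" for k :: nat
    by (induction k) (auto simp: gW_def)
  have "gW [^]\<^bsub>W\<^esub> k \<in> K" for k :: nat
    using gK K.one_closed K.m_closed by (induction k) auto
  then have wK: "((\<one>, (a \<otimes> u) [^] n), False) \<in> K" using pow[of n] a_pow by metis
  define S where "S = {y \<in> carrier T. \<exists>x\<in>carrier T. ((x, y), False) \<in> K}"
  have S_I: "y \<in> S" if "((x, y), False) \<in> K" for x y
    using that K.mem_carrier[OF that] unfolding S_def by auto
  have "subgroup S T"
  proof (rule subgroupI)
    show "S \<noteq> {}" using S_I[OF wK] by blast
    show "inv y \<in> S" if yS: "y \<in> S" for y
    proof -
      obtain x where x: "((x, y), False) \<in> K" "x \<in> carrier T" "y \<in> carrier T"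
        using yS by (auto simp: S_def)
      then have "((inv x, inv y), False) \<in> K" using K.m_inv_closed[OF x(1)] by simp
      then show ?thesis by (rule S_I)
    qed
    show "y \<otimes> z \<in> S" if yS: "y \<in> S" and zS: "z \<in> S" for y z
    proof -
      obtain x where x: "((x, y), False) \<in> K" using yS by (auto simp: S_def)
      obtain x' where x': "((x', z), False) \<in> K" using zS by (auto simp: S_def)
      have "((x \<otimes> x', y \<otimes> z), False) \<in> K" using K.m_closed[OF x x'] by simp
      then show ?thesis by (rule S_I)
    qed
  qed (auto simp: S_def)
  then interpret S: subgroup S T .
  have uS: "u \<in> S" using S_I[OF uK] .
  have "a \<otimes> u \<in> S" using S_I gK unfolding gW_def by blast
  then have "(a \<otimes> u) \<otimes> u \<in> S" using uS by blast
  then have "a \<in> S" by (simp add: m_assoc)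
  then have "generate T {a, u} \<subseteq> S" using uS S.subgroup_axioms by (intro generate_subgroup_incl) auto
  then have S: "\<exists>x\<in>carrier T. ((x, y), False) \<in> K" if "y \<in> carrier T" for y
    using that unfolding gen_au S_def by blast
  define R where "R = {z \<in> carrier T. ((\<one>, z), False) \<in> K}"
  have "R \<lhd> T"
  proof (rule normal_cjI)
    show "subgroup R T"
    proof (rule subgroupI)
      have "(a \<otimes> u) [^] n \<in> R" using wK by (simp add: R_def)
      then show "R \<noteq> {}" by blast
      show "inv z \<in> R" if "z \<in> R" for z
        using that K.m_inv_closed[of "((\<one>, z), False)"] by (simp add: R_def)
      show "z \<otimes> w \<in> R" if "z \<in> R" "w \<in> R" for z w
        using that K.m_closed[of "((\<one>, z), False)" "((\<one>, w), False)"] by (simp add: R_def)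
    qed (auto simp: R_def)
    show "cj y z \<in> R" if y: "y \<in> carrier T" and z: "z \<in> R" for y z
    proof -
      obtain x where x: "x \<in> carrier T" "((x, y), False) \<in> K" using S[OF y] by blast
      have zK: "z \<in> carrier T" "((\<one>, z), False) \<in> K" using z by (auto simp: R_def)
      have "((x, y), False) \<otimes>\<^bsub>W\<^esub> ((\<one>, z), False) \<otimes>\<^bsub>W\<^esub> inv\<^bsub>W\<^esub> ((x, y), False) \<in> K"
        using x zK by blast
      then show ?thesis using x y zK by (simp add: R_def cj_def)
    qed
  qed
  moreover have "(a \<otimes> u) [^] n \<in> R" using wK by (simp add: R_def)
  ultimately have R: "R = carrier T" using no_real_normal_subgroup au_pow by blast
  have K2: "((\<one>, y), False) \<in> K" if "y \<in> carrier T" for y using that R by (auto simp: R_def)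
  have K1: "((x, \<one>), False) \<in> K" if "x \<in> carrier T" for x
  proof -
    have "((\<one>, \<one>), True) \<otimes>\<^bsub>W\<^esub> ((\<one>, x), False) \<otimes>\<^bsub>W\<^esub> ((\<one>, \<one>), True) \<in> K"
      using tau K2[OF that] by blast
    then show ?thesis using that by simp
  qed
  have KF: "((x, y), False) \<in> K" if "x \<in> carrier T" "y \<in> carrier T" for x y
    using K.m_closed[OF K1[OF that(1)] K2[OF that(2)]] that by simp
  have KT: "((x, y), True) \<in> K" if "x \<in> carrier T" "y \<in> carrier T" for x y
    using K.m_closed[OF KF[OF that] tau] that by simp
  have "carrier W \<subseteq> K" using KF KT by (auto dest!: W_cases)
  then show ?thesis using K.subset by (simp add: K_def)
qed

lemma nonregular_example:
  "\<exists>(\<Gamma> :: nat pair_pre_digraph) G N. basic_quasiprimitive \<Gamma> G \<and>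
    unique_minimal_normal_power (pverts \<Gamma>) G N T 2 \<and> \<not> regular_on (pverts \<Gamma>) N \<and>
    2 * card (carrier T) \<le> 4 * card (pverts \<Gamma>)"
proof -
  have HW_cases: "h = ((\<one>, \<one>), False) \<or> h = ((u, u), False) \<or> h = ((\<one>, \<one>), True) \<or> h = ((u, u), True)"
    if "h \<in> HW" for h using that by (auto simp: HW_def)
  have HW_in: "((x, y), e) \<in> HW \<longleftrightarrow> x = y \<and> x \<in> {\<one>, u}" for x y e by (auto simp: HW_def)
  interpret S: coset_digraph W HW gW "((u, u), False)"
  proof (intro coset_digraph.intro coset_digraph_axioms.intro W_group)
    show "finite (carrier W)" using finite_T by (simp add: wr2_def)
    show "subgroup HW W"
    proof (rule W.subgroupI)
      show "HW \<subseteq> carrier W" by (auto simp: HW_def)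
      show "HW \<noteq> {}" by (auto simp: HW_def)
    qed (auto dest!: HW_cases simp: HW_in)
    show "inv\<^bsub>W\<^esub> gW \<otimes>\<^bsub>W\<^esub> (((u, u), False) \<otimes>\<^bsub>W\<^esub> gW) \<notin> HW"
      using conj_u_notin by (simp add: gW_def HW_in)
    \<comment> \<open>Conjugating the swap by \<open>gW\<close> gives \<open>((u, u), True)\<close>,
      again in \<open>HW\<close>. Hence the swap preserves the coset of \<open>gW\<close>, and only
      \<open>\<one>\<close> and \<open>(u, u)\<close> remain as representatives.\<close>
    show "inv\<^bsub>W\<^esub> gW \<otimes>\<^bsub>W\<^esub> (h \<otimes>\<^bsub>W\<^esub> gW) \<in> HW \<or>
        inv\<^bsub>W\<^esub> gW \<otimes>\<^bsub>W\<^esub> (inv\<^bsub>W\<^esub> ((u, u), False) \<otimes>\<^bsub>W\<^esub> (h \<otimes>\<^bsub>W\<^esub> gW)) \<in> HW"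
      if "h \<in> HW" for h
      using HW_cases[OF that] by (auto simp: gW_def HW_in inv_mult_group m_assoc)
    show "h \<otimes>\<^bsub>W\<^esub> gW \<otimes>\<^bsub>W\<^esub> h' \<noteq> inv\<^bsub>W\<^esub> gW" if h: "h \<in> HW" "h' \<in> HW" for h h'
    proof -
      obtain x e where x: "x \<in> {\<one>, u}" "h = ((x, x), e)" using h(1) by (auto simp: HW_def)
      obtain y f where y: "y \<in> {\<one>, u}" "h' = ((y, y), f)" using h(2) by (auto simp: HW_def)
      \<comment> \<open>First coordinates suffice: on the left it is
        \<open>x \<otimes> a \<otimes> y\<close>, or
        \<open>x \<otimes> a \<otimes> (u \<otimes> y)\<close> if \<open>h\<close> contains the
        swap, and on the right \<open>inv a\<close>.\<close>
      have "u \<otimes> y \<in> {\<one>, u}" "x \<in> carrier T" "y \<in> carrier T" using x y by auto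
      then show ?thesis
        using anti_au[OF x(1) y(1)] anti_au[OF x(1), of "u \<otimes> y"] x(2) y(2)
        by (cases e) (auto simp: gW_def m_assoc)
    qed
    show "\<exists>m\<in>M. inv\<^bsub>W\<^esub> m \<otimes>\<^bsub>W\<^esub> w \<in> HW" if M: "M \<lhd> W" "M \<noteq> {\<one>\<^bsub>W\<^esub>}" and w: "w \<in> carrier W" for M w
    proof -
      obtain x y e where xy: "x \<in> carrier T" "y \<in> carrier T" "w = ((x, y), e)"
        using W_cases[OF w] by blast
      then have "((x, y), False) \<in> M" using base_le_normal[OF M] by (auto simp: base_def)
      then show ?thesis using xy by (intro bexI[of _ "((x, y), False)"]) (auto simp: HW_in)
    qed
  qed (use HW_generate in \<open>auto simp: gW_def HW_in\<close>)
  have ubase: "((u, u), False) \<in> base" by (auto simp: base_def)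
  moreover have "((u, u), False) \<noteq> \<one>\<^bsub>W\<^esub>" using u_ne_one by simp
  ultimately have "base \<noteq> {\<one>\<^bsub>W\<^esub>}" by blast
  then have "unique_minimal_normal_power S.X S.Gp (S.perm ` base) T 2"
    using base_normal base_le_normal nonabelian base_iso by (intro S.unique_minimal_normal_perm)
  moreover have "\<not> regular_on S.X (S.perm ` base)"
    using S.not_regular_perm[OF ubase] u_ne_one by (simp add: HW_in)
  moreover have "2 * card (carrier T) \<le> 4 * card S.X"
  proof -
    have HW_eq: "HW = (\<lambda>(h, e). ((h, h), e)) ` ({\<one>, u} \<times> UNIV)" by (force simp: HW_def)
    have "card HW \<le> card ({\<one>, u} \<times> (UNIV :: bool set))"
      unfolding HW_eq by (rule card_image_le) simp
    also have "\<dots> = 4" using u_ne_one by (simp add: card_cartesian_product)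
    finally have "card S.X * card HW \<le> card S.X * 4" by (rule mult_le_mono2)
    then have "card (carrier W) \<le> card S.X * 4" using S.card_carrier_le by (rule le_trans[rotated])
    moreover have "card (carrier W) = (card (carrier T) * card (carrier T)) * 2"
      by (simp add: wr2_def card_cartesian_product)
    moreover have "card (carrier T) \<le> card (carrier T) * card (carrier T)" by (rule le_square)
    ultimately show ?thesis by linarith
  qed
  ultimately show ?thesis using S.graph_basic_quasiprimitive
    by (intro exI[of _ S.graph] exI[of _ S.Gp] exI[of _ "S.perm ` base"]) simp
qed

end

section \<open>Alternating groups as input and the infinitude of the orders\<close>

lemma alt_group_pow: "p [^]\<^bsub>alt_group n\<^esub> (k :: nat) = p ^^ k"
proof (induction k)
  case (Suc k)
  interpret A: group "alt_group n" by (rule alt_group_is_group)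
  show ?case using Suc by (simp add: alt_group_mult funpow_Suc_right del: funpow.simps)
qed (simp add: alt_group_one nat_pow_def)

lemma alt_group_involution_pair:
  assumes m: "4 \<le> m"
  defines "n \<equiv> Suc (2 * m)"
  shows "involution_pair (alt_group n) (cyc (2 * m)) (transpose 1 2 \<circ> transpose 3 4) n"
proof -
  define a where "a = cyc (2 * m)"
  define u where "u = transpose 1 2 \<circ> transpose 3 (4 :: nat)"
  interpret A: simple_group "alt_group n" using m by (intro alt_group_simple) (simp add: n_def)
  have aA: "a \<in> carrier (alt_group n)"
    using cyc_permutes[of "2 * m"] evenperm_cyc[of "2 * m"] by (simp add: alt_group_carrier a_def n_def)
  have uA: "u \<in> carrier (alt_group n)" unfolding u_def using m by (intro transpose_pair_alt) (auto simp: n_def)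
  have a_apply: "a x = (if 1 \<le> x \<and> x \<le> 2 * m then Suc x else if x = Suc (2 * m) then 1 else x)" for x
    by (simp add: a_def cyc_apply)
  have u_apply: "u x = (if x = 1 then 2 else if x = 2 then 1 else if x = 3 then 4 else if x = 4 then 3 else x)"
    for x by (auto simp: u_def transpose_def)
  have uu: "u \<circ> u = id" by (auto simp: u_def fun_eq_iff transpose_def)
  have fin: "finite (carrier (alt_group n))"
    using finite_permutations[of "{1..n}"] by (rule finite_subset[rotated]) (auto simp: alt_group_carrier)
  have "(a \<circ> u) 1 \<noteq> (u \<circ> a) 1" using m by (simp add: u_apply a_apply)
  then have "a \<circ> u \<noteq> u \<circ> a" by metis
  moreover have "x \<circ> a \<circ> y \<noteq> inv' a" if "x \<in> {id, u}" "y \<in> {id, u}" for x y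
  proof
    assume "x \<circ> a \<circ> y = inv' a"
    \<comment> \<open>The test point \<open>a 6\<close>, which is 7, and its image 8 under
      \<open>a\<close> lie outside the support of \<open>u\<close>. So the left side is 8 for all
      choices of \<open>x\<close> and \<open>y\<close>, while the right side is 6.\<close>
    then have "x (a (y (a 6))) = inv' a (a 6)" by (metis comp_apply)
    then have "x (a (y (a 6))) = 6" using alt_group_bij[OF aA] by (simp add: bij_is_inj)
    then show False using that m by (auto simp: a_apply u_apply)
  qed
  moreover have "(a \<circ> u) ^^ n \<noteq> id"
  proof -
    \<comment> \<open>This product fixes 2 and 4 and runs through 1, 3, 5, 6, ..., \<open>n\<close>,
      a cycle of length \<open>n - 2\<close>. Its n-th power therefore moves 1 two steps on, to
      5.\<close>
    define f where "f = a \<circ> u"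
    have f: "f 1 = 3" "f 3 = 5" "f (Suc (2 * m)) = 1" "\<And>x. \<lbrakk>5 \<le> x; x \<le> 2 * m\<rbrakk> \<Longrightarrow> f x = Suc x"
      using m by (auto simp: f_def a_apply u_apply)
    have "k \<le> 2 * m - 4 \<Longrightarrow> (f ^^ Suc (Suc k)) 1 = k + 5" for k
    proof (induction k)
      case 0
      have "(f ^^ Suc (Suc 0)) 1 = f (f 1)" by simp
      then show ?case using f(1,2) by simp
    next
      case (Suc k)
      have "(f ^^ Suc (Suc (Suc k))) 1 = f ((f ^^ Suc (Suc k)) 1)" by simp
      also have "\<dots> = f (k + 5)" using Suc by simp
      also have "\<dots> = Suc k + 5" using f(4)[of "k + 5"] Suc.prems by simp
      finally show ?case .
    qed
    from this[of "2 * m - 4"] have 1: "(f ^^ Suc (Suc (2 * m - 4))) 1 = Suc (2 * m)" using m by simp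
    have "n = Suc (Suc (Suc (Suc (Suc (2 * m - 4)))))" using m by (simp add: n_def)
    then have "(f ^^ n) 1 = f (f (f ((f ^^ Suc (Suc (2 * m - 4))) 1)))" by simp
    also have "\<dots> = 5" unfolding 1 using f(1-3) by simp
    finally show ?thesis unfolding f_def by auto
  qed
  moreover have "a ^^ n = id" unfolding a_def n_def by (rule cyc_funpow_period)
  moreover have "generate (alt_group n) {a, u} = carrier (alt_group n)"
    unfolding a_def u_def by (rule alt_group_generated[OF m n_def[THEN meta_eq_to_obj_eq]])
  ultimately show ?thesis
    unfolding a_def[symmetric] u_def[symmetric]
    using aA uA uu fin A.is_simple_group alt_group_inv_equality[OF aA]
    by (intro involution_pair.intro involution_pair_axioms.intro)
      (auto simp: alt_group_mult alt_group_one alt_group_pow)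
qed

lemma card_alt_group_ge: "2 \<le> n \<Longrightarrow> n \<le> 2 * card (carrier (alt_group n))"
  using alt_group_card_carrier[of n] fact_ge_self[of n] by simp

lemma infinite_nat_setI:
  assumes "\<And>m. 4 \<le> m \<Longrightarrow> \<exists>k\<in>A. m \<le> 4 * k" shows "infinite (A :: nat set)"
proof
  assume "finite A"
  then obtain b where b: "\<forall>k\<in>A. k \<le> b" using finite_nat_set_iff_bounded_le by auto
  obtain k where "k \<in> A" "4 * b + 4 \<le> 4 * k" using assms[of "4 * b + 4"] by auto
  then show False using b by fastforce
qed

lemma infinite_example_orders_simple: "infinite example_orders_simple"
proof (rule infinite_nat_setI)
  fix m :: nat assume m: "4 \<le> m"
  let ?n = "Suc (2 * m)"
  obtain \<Gamma> :: "nat pair_pre_digraph" and G N where ex: "basic_quasiprimitive \<Gamma> G"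
    "unique_minimal_normal_power (pverts \<Gamma>) G N (alt_group ?n) 1"
    "2 * card (carrier (alt_group ?n)) \<le> 4 * card (pverts \<Gamma>)"
    using involution_pair.simple_example[OF alt_group_involution_pair[OF m]] by blast
  then have "card (pverts \<Gamma>) \<in> example_orders_simple" unfolding example_orders_simple_def by blast
  then show "\<exists>k\<in>example_orders_simple. m \<le> 4 * k"
    using ex(3) card_alt_group_ge[of ?n] m by (intro bexI[of _ "card (pverts \<Gamma>)"]) auto
qed

lemma infinite_example_orders_nonregular: "infinite example_orders_nonregular"
proof (rule infinite_nat_setI)
  fix m :: nat assume m: "4 \<le> m"
  let ?n = "Suc (2 * m)"
  obtain \<Gamma> :: "nat pair_pre_digraph" and G N where ex: "basic_quasiprimitive \<Gamma> G"
    "unique_minimal_normal_power (pverts \<Gamma>) G N (alt_group ?n) 2" "\<not> regular_on (pverts \<Gamma>) N"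
    "2 * card (carrier (alt_group ?n)) \<le> 4 * card (pverts \<Gamma>)"
    using involution_pair.nonregular_example[OF alt_group_involution_pair[OF m]] by blast
  then have "card (pverts \<Gamma>) \<in> example_orders_nonregular"
    unfolding example_orders_nonregular_def by blast
  then show "\<exists>k\<in>example_orders_nonregular. m \<le> 4 * k"
    using ex(4) card_alt_group_ge[of ?n] m by (intro bexI[of _ "card (pverts \<Gamma>)"]) auto
qed

theorem theorem1p3:
  shows "(\<forall>(\<Gamma> :: 'a pair_pre_digraph) G. basic_quasiprimitive \<Gamma> G \<longrightarrow>
            (\<exists>N (T :: ('a \<Rightarrow> 'a) monoid) k.
               unique_minimal_normal_power (pverts \<Gamma>) G N T k \<and> k \<le> 2 \<and>
               (k = 1 \<or>
                (k = 2 \<and> card (rcosets\<^bsub>perm_group (pverts \<Gamma>) G\<^esub> N) = 2 \<and> twisted_wreath \<Gamma> G N T) \<or>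
                (k = 2 \<and> \<not> regular_on (pverts \<Gamma>) N)))) \<and>
         infinite example_orders_simple \<and>
         infinite example_orders_nonregular"
  using structure_of_basic infinite_example_orders_simple infinite_example_orders_nonregular
  by blast

end
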